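(* Let $d\geq 2$ and consider first passage percolation on $(\mathbb{Z}^d,\mathbb{E}^d)$ with i.i.d. capacities $(t(e))_{e\in\mathbb{E}^d}$ of common distribution function $F$ on $[0,+\infty)$, and suppose there exists $\gamma>0$ with $\int_{[0,+\infty)}e^{\gamma x}\,dF(x)<\infty$. Let $A$ be a non degenerate hyperrectangle in $\mathbb{R}^d$ with unit normal vector $\vec{v}$, and let $h:\mathbb{N}\to\mathbb{R}^+$ satisfy $\lim_{n\to\infty}h(n)=+\infty$. Then for every $\lambda>\nu(\vec{v})$, $$\liminf_{n\to\infty}\frac{-1}{\mathcal{H}^{d-1}(nA)\,h(n)}\log\mathbb{P}\left[\phi(nA,h(n))\geq\lambda\,\mathcal{H}^{d-1}(nA)\right]>0.$$
   Context: $\mathbb{E}^d$ is the set of pairs of nearest neighbours in $\mathbb{Z}^d$; $t(e)\geq0$ is the capacity of edge $e$. An edge $\langle x,y\rangle$ belongs to $C\subset\mathbb{R}^d$ if the segment joining $x$ and $y$ (possibly excluding endpoints) is included in $C$. For $F_1,F_2\subset C\cap\mathbb{Z}^d$, the maximal flow $\phi(F_1\to F_2\text{ in }C)$ is the supremum over streams (assignments $0\leq g(e)\leq t(e)$ with orientations on edges in $C$, conserving flow at vertices of $C\setminus(F_1\cup F_2)$) of the net flow from $F_1$ to $F_2$; equivalently it equals $\min\{\sum_{e\in E}t(e): E$ a set of edges in $C$ with no path from $F_1$ to $F_2$ in $C\setminus E\}$. For a hyperrectangle $A$ (closed box of dimension $d-1$) with unit normal $\vec{v}$ and $h>0$, $\mathrm{cyl}(A,h)=\{x+t\vec{v}:x\in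 A,\ t\in[-h,h]\}$. Its top $T(A,h)$ (resp. bottom $B(A,h)$) is the set of $x\in\mathrm{cyl}(A,h)$ for which there is $y\notin\mathrm{cyl}(A,h)$ with $\langle x,y\rangle\in\mathbb{E}^d$ and $\langle x,y\rangle$ intersecting $A+h\vec{v}$ (resp. $A-h\vec{v}$). Then $\phi(A,h)=\phi(B(A,h)\to T(A,h)\text{ in }\mathrm{cyl}(A,h))$. Also, with $\mathcal{C}_1(A,h),\mathcal{C}_2(A,h)$ the two connected components of $\mathrm{cyl}(A,h)\setminus\mathrm{hyp}(A)$ and $A_i^h$ the points of $\mathcal{C}_i(A,h)\cap\mathbb{Z}^d$ with a nearest neighbour outside $\mathrm{cyl}(A,h)$, $\tau(A,h)=\phi(A_1^h\to A_2^h\text{ in }\mathrm{cyl}(A,h))$. $\nu(\vec{v})$ is the constant (existing since $F$ has finite mean) such that for every non degenerate hyperrectangle $A$ orthogonal to $\vec{v}$ and every $h$ with $h(n)\to\infty$, $\tau(nA,h(n))/\mathcal{H}^{d-1}(nA)\to\nu(\vec{v})$ in $L^1$. $\mathcal{H}^{d-1}$ is $(d-1)$-dimensional Hausdorff measure. *)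

theory Defs
  imports "HOL-Probability.Probability"
begin

section \<open>Lattice Z^d and its nearest-neighbour edges\<close>

definition Zd :: "(real^'n) set" where
  "Zd = {x. \<forall>i. x $ i \<in> \<int>}"

text \<open>Edges are unordered pairs of nearest neighbours.\<close>
definition Ed :: "(real^'n) set set" where
  "Ed = {{x, y} | x y. x \<in> Zd \<and> y \<in> Zd \<and> dist x y = 1}"

text \<open>An edge belongs to C if the segment joining its endpoints (endpoints excluded) lies in C.\<close>
definition edges_in :: "(real^'n) set \<Rightarrow> (real^'n) set set" where
  "edges_in C = {e \<in> Ed. \<exists>x y. e = {x, y} \<and> open_segment x y \<subseteq> C}"

text \<open>There is a path from F1 to F2 using edges of C not in E.\<close>
definition path_avoiding ::
  "(real^'n) set \<Rightarrow> (real^'n) set set \<Rightarrow> (real^'n) set \<Rightarrow> (real^'n) set \<Rightarrow> bool" where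
  "path_avoiding C E F1 F2 \<longleftrightarrow>
     (\<exists>a\<in>F1. \<exists>b\<in>F2. (a, b) \<in> ({(x, y). {x, y} \<in> edges_in C - E})\<^sup>*)"

text \<open>Maximal flow from F1 to F2 in C for the capacity configuration t (min-cut form).\<close>
definition maxflow ::
  "((real^'n) set \<Rightarrow> real) \<Rightarrow> (real^'n) set \<Rightarrow> (real^'n) set \<Rightarrow> (real^'n) set \<Rightarrow> real" where
  "maxflow t F1 F2 C =
     Inf {sum t E | E. finite E \<and> E \<subseteq> edges_in C \<and> \<not> path_avoiding C E F1 F2}"

section \<open>Hyperrectangles, cylinders\<close>

text \<open>Non degenerate hyperrectangle: closed box of dimension d-1 with positive side lengths.\<close>
definition nd_hyperrect :: "(real^'n) set \<Rightarrow> bool" where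
  "nd_hyperrect A \<longleftrightarrow>
     (\<exists>c (u :: 'n \<Rightarrow> real^'n) (k0 :: 'n) l. (\<forall>i j. u i \<bullet> u j = (if i = j then 1 else 0)) \<and>
        (\<forall>i. i \<noteq> k0 \<longrightarrow> l i > (0::real)) \<and>
        A = {c + (\<Sum>i\<in>UNIV - {k0}. s i *\<^sub>R u i) | s. \<forall>i. i \<noteq> k0 \<longrightarrow> 0 \<le> s i \<and> s i \<le> l i})"

definition unit_normal :: "(real^'n) set \<Rightarrow> real^'n \<Rightarrow> bool" where
  "unit_normal A v \<longleftrightarrow> norm v = 1 \<and> (\<forall>a\<in>A. \<forall>b\<in>A. (a - b) \<bullet> v = 0)"

definition cyl :: "(real^'n) set \<Rightarrow> real \<Rightarrow> real^'n \<Rightarrow> (real^'n) set" where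
  "cyl A h v = {x + s *\<^sub>R v | x s. x \<in> A \<and> -h \<le> s \<and> s \<le> h}"

definition top_cyl :: "(real^'n) set \<Rightarrow> real \<Rightarrow> real^'n \<Rightarrow> (real^'n) set" where
  "top_cyl A h v = {x \<in> cyl A h v. \<exists>y. y \<notin> cyl A h v \<and> {x, y} \<in> Ed \<and>
      closed_segment x y \<inter> (\<lambda>a. a + h *\<^sub>R v) ` A \<noteq> {}}"

definition bot_cyl :: "(real^'n) set \<Rightarrow> real \<Rightarrow> real^'n \<Rightarrow> (real^'n) set" where
  "bot_cyl A h v = {x \<in> cyl A h v. \<exists>y. y \<notin> cyl A h v \<and> {x, y} \<in> Ed \<and>
      closed_segment x y \<inter> (\<lambda>a. a - h *\<^sub>R v) ` A \<noteq> {}}"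

definition phi :: "(real^'n) set \<Rightarrow> real \<Rightarrow> real^'n \<Rightarrow> ((real^'n) set \<Rightarrow> real) \<Rightarrow> real" where
  "phi A h v t = maxflow t (bot_cyl A h v) (top_cyl A h v) (cyl A h v)"

text \<open>tau: flow between the lattice boundary parts of the two connected components of
  cyl(A,h) minus hyp(A) (the affine hyperplane spanned by A).\<close>
definition tau :: "(real^'n) set \<Rightarrow> real \<Rightarrow> real^'n \<Rightarrow> ((real^'n) set \<Rightarrow> real) \<Rightarrow> real" where
  "tau A h v t =
     (let K = cyl A h v;
          S = components (K - affine hull A);
          C1 = (SOME X. X \<in> S);
          C2 = (SOME X. X \<in> S \<and> X \<noteq> C1);
          bd = (\<lambda>X. {x \<in> X \<inter> Zd. \<exists>y. {x, y} \<in> Ed \<and> y \<notin> K})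
      in maxflow t (bd C1) (bd C2) K)"

section \<open>Hausdorff measure\<close>

definition hm_const :: "real \<Rightarrow> real" where
  "hm_const s = pi powr (s / 2) / Gamma (s / 2 + 1)"

definition hausdorff_measure :: "real \<Rightarrow> ('a::metric_space) set \<Rightarrow> ennreal" where
  "hausdorff_measure s A =
     (SUP \<delta>\<in>{0<..}. INF C \<in> {C :: nat \<Rightarrow> 'a set. A \<subseteq> \<Union>(range C) \<and>
                                 (\<forall>i. bounded (C i) \<and> diameter (C i) \<le> \<delta>)}.
        (\<Sum>i. ennreal (hm_const s * (diameter (C i) / 2) powr s)))"

text \<open>(d-1)-dimensional Hausdorff measure of the dilate nA.\<close>
definition area :: "(real^'n) set \<Rightarrow> nat \<Rightarrow> real" where
  "area A n = enn2real (hausdorff_measure (real CARD('n) - 1) ((\<lambda>x. real n *\<^sub>R x) ` A))"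

section \<open>The constant nu\<close>

definition nu :: "'w measure \<Rightarrow> ((real^'n) set \<Rightarrow> 'w \<Rightarrow> real) \<Rightarrow> real^'n \<Rightarrow> real" where
  "nu M t v = (THE c. \<forall>(A :: (real^'n) set) (h :: nat \<Rightarrow> real).
      nd_hyperrect A \<and> unit_normal A v \<and> (\<forall>n. h n > 0) \<and> filterlim h at_top sequentially \<longrightarrow>
        (\<forall>\<^sub>F n in sequentially.
           integrable M (\<lambda>\<omega>. tau ((\<lambda>x. real n *\<^sub>R x) ` A) (h n) v (\<lambda>e. t e \<omega>) / area A n)) \<and>
        ((\<lambda>n. LINT \<omega>|M. \<bar>tau ((\<lambda>x. real n *\<^sub>R x) ` A) (h n) v (\<lambda>e. t e \<omega>) / area A n - c\<bar>)
           \<longlonglongrightarrow> 0))"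

text \<open>Logarithm with values in the extended reals (log 0 = -infinity).\<close>
definition elog :: "real \<Rightarrow> ereal" where
  "elog p = (if p = 0 then - \<infinity> else ereal (ln p))"

end

(*
  Proof idea.  A minimal cut of a large cylinder is bounded by cuts of disjoint lattice
  translates of a fixed tile (a small cylinder over an n-fold rectangle), glued along all
  edges that lie near the hyperplane but in no tile; the number of these glue edges is a
  small fraction of the area.  The tile flows and the glue edges are independent, so the
  exponential moment of the bound factorises, and for a small parameter theta it is at most
  exp(theta * area * (mean tile flow + epsilon)).

  Applied to tau at two scales this compares the normalised means in both directions, hence
  they converge to a limit that does not depend on the rectangle or on h.  It also controls
  the positive part of tau / area - limit, and then the L1 norm, so nu is this limit.

  For phi the cylinder is cut into order h(n) disjoint slabs, each carrying its own tiling.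
  Since phi is at most the bound of every slab, Chernoff's inequality for the sum of the
  independent bounds gives a tail exp(-c * area * h(n)).
*)
theory Submission
  imports Defs
begin

section \<open>Functions of boxes that are additive in each side length\<close>

text \<open>The law of the capacities is invariant only under lattice translations, while
  \<open>v\<close> may be irrational, so in general no periodic tiling of the hyperplane by lattice
  translates of one tile is available. Each ideal translation is therefore rounded to
  \<open>Zd\<close>; the rounding error, at most the dimension \<open>R\<close>, is the source of
  margins such as \<open>2 * R + 1\<close> and \<open>2 * R + 4\<close>. Tile and large rectangle
  share only their normal; their other axes may differ by a rotation, which is why the limit forgets
  the rectangle. All comparisons bound a large scale from above by a fixed small one. Convergence
  still follows, since a nonnegative sequence whose tail stays below each late term plus epsilon
  converges; convergence of the means then turns control of the positive part into control in L1.
  The parameter theta and the slab spacing \<open>s\<close> depend on the tile alone, so one theta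
  serves all larger scales. With J slabs the sum of the bounds dominates J copies of phi, and this
  factor J becomes h(n) in the rate. Hausdorff measure enters through its values on boxes, which
  additivity in each side length determines up to a constant.\<close>

text \<open>Cover a length \<open>a\<close> by pieces of length \<open>x\<close>, pack such pieces
  into the length \<open>b\<close>, and let \<open>x\<close> tend to 0. The slack \<open>e\<close>
  has two uses: abutting open boxes miss their common face (\<open>sub\<close>), and Hausdorff
  measure adds up over sets at positive distance (\<open>super\<close>).\<close>

lemma additive_mono_le:
  fixes g :: "real \<Rightarrow> ennreal"
  assumes mono: "\<And>x y. 0 < x \<Longrightarrow> x \<le> y \<Longrightarrow> g x \<le> g y"
    and sub: "\<And>x y e. 0 < x \<Longrightarrow> 0 < y \<Longrightarrow> 0 < e \<Longrightarrow> g (x + y) \<le> g (x + e) + g y"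
    and super: "\<And>x y e. 0 < x \<Longrightarrow> 0 < y \<Longrightarrow> 0 < e \<Longrightarrow> g x + g y \<le> g (x + y + e)"
    and a: "0 < a" and b: "0 < b"
  shows "g a \<le> ennreal (a / b) * g b"
proof -
  have sub_n: "g (real (Suc k) * x) \<le> of_nat (Suc k) * g (x + e)" if "0 < x" "0 < e" for k x e
  proof (induction k)
    case 0
    show ?case using mono[of x "x + e"] that by simp
  next
    case (Suc k)
    have "g (real (Suc (Suc k)) * x) = g (x + real (Suc k) * x)"
      by (simp add: algebra_simps)
    also have "\<dots> \<le> g (x + e) + g (real (Suc k) * x)"
      using that by (intro sub) auto
    also have "\<dots> \<le> g (x + e) + of_nat (Suc k) * g (x + e)"
      using Suc by (intro add_left_mono)
    finally show ?case by (simp add: algebra_simps)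
  qed
  have super_n: "of_nat (Suc k) * g x \<le> g (real (Suc k) * (x + e))" if "0 < x" "0 < e" for k x e
  proof (induction k)
    case 0
    show ?case using mono[of x "x + e"] that by simp
  next
    case (Suc k)
    have "of_nat (Suc (Suc k)) * g x = g x + of_nat (Suc k) * g x"
      by (simp add: algebra_simps)
    also have "\<dots> \<le> g x + g (real (Suc k) * (x + e))"
      using Suc by (intro add_left_mono)
    also have "\<dots> \<le> g (x + real (Suc k) * (x + e) + e)"
      using that by (intro super) (auto intro!: mult_pos_pos)
    finally show ?case by (simp add: algebra_simps)
  qed
  have bound: "g a \<le> ennreal ((real (Suc (Suc m)) * a / b + 1) / real (Suc m)) * g b" for m
  proof -
    \<comment> \<open>Dividing by \<open>m + 2\<close> lets \<open>m + 1\<close> pieces slightly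
      longer than \<open>x\<close> fill \<open>b\<close>, which is the slack \<open>e'\<close> for
      \<open>super_n\<close>. Likewise \<open>Suc k * x > a\<close> is strict so as to leave the
      slack \<open>e\<close> for \<open>sub_n\<close>.\<close>
    define x where "x = b / real (Suc (Suc m))"
    have x: "0 < x" using b by (simp add: x_def)
    obtain k :: nat where k: "real (Suc k) * x > a" "real (Suc k) \<le> a / x + 1"
    proof -
      define k where "k = nat \<lfloor>a / x\<rfloor>"
      have nn: "0 \<le> \<lfloor>a / x\<rfloor>" using a x by simp
      have "real k \<le> a / x" unfolding k_def using nn by linarith
      moreover have "a / x < real (Suc k)" unfolding k_def using nn by linarith
      ultimately show thesis using x by (intro that[of k]) (auto simp: field_simps)
    qed
    define e where "e = x - a / real (Suc k)"
    have e: "0 < e" using k(1) by (simp add: e_def field_simps)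
    have "g a = g (real (Suc k) * (a / real (Suc k)))" by simp
    also have "\<dots> \<le> of_nat (Suc k) * g (a / real (Suc k) + e)"
      using a e by (intro sub_n) auto
    also have "a / real (Suc k) + e = x" by (simp add: e_def)
    finally have 1: "g a \<le> of_nat (Suc k) * g x" .
    define e' where "e' = b / real (Suc m) - x"
    have "b / real (Suc (Suc m)) < b / real (Suc m)"
      using b by (intro divide_strict_left_mono) auto
    then have e': "0 < e'" by (simp add: e'_def x_def)
    have "of_nat (Suc m) * g x \<le> g (real (Suc m) * (x + e'))"
      using x e' by (rule super_n)
    also have "real (Suc m) * (x + e') = b" by (simp add: e'_def)
    finally have 2: "of_nat (Suc m) * g x \<le> g b" .
    have "ennreal (1 / real (Suc m)) * of_nat (Suc m) = 1"
      unfolding ennreal_of_nat_eq_real_of_nat by (simp flip: ennreal_mult del: of_nat_Suc)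
    then have "g x = ennreal (1 / real (Suc m)) * (of_nat (Suc m) * g x)"
      by (metis mult.assoc mult_1)
    also have "\<dots> \<le> ennreal (1 / real (Suc m)) * g b"
      using 2 by (intro mult_left_mono) auto
    finally have 3: "g x \<le> ennreal (1 / real (Suc m)) * g b" .
    have "g a \<le> ennreal (real (Suc k)) * (ennreal (1 / real (Suc m)) * g b)"
      using 1 3 by (metis (no_types, lifting) ennreal_of_nat_eq_real_of_nat mult_left_mono order_trans zero_le)
    also have "\<dots> = ennreal (real (Suc k) / real (Suc m)) * g b"
      by (simp flip: mult.assoc ennreal_mult del: of_nat_Suc)
    also have "\<dots> \<le> ennreal ((a / x + 1) / real (Suc m)) * g b"
      using k(2) by (intro mult_right_mono ennreal_leI divide_right_mono) auto
    also have "a / x = real (Suc (Suc m)) * a / b" by (simp add: x_def)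
    finally show ?thesis .
  qed
  show ?thesis
  proof (cases "g b")
    case top
    then show ?thesis using a b by (simp add: ennreal_mult_top)
  next
    case (real r)
    have bd: "g a \<le> ennreal ((real (Suc (Suc m)) * a / b + 1) / real (Suc m) * r)" for m
    proof -
      have "0 \<le> (real (Suc (Suc m)) * a / b + 1) / real (Suc m)" using a b by simp
      then show ?thesis using bound[of m] real by (metis ennreal_mult)
    qed
    then have "g a < \<top>"
      using le_less_trans ennreal_less_top by blast
    then obtain s where s: "g a = ennreal s" "0 \<le> s" by (cases "g a") auto
    have "s \<le> (real (Suc (Suc m)) * a / b + 1) / real (Suc m) * r" for m
    proof -
      have "0 \<le> (real (Suc (Suc m)) * a / b + 1) / real (Suc m) * r"
        using a b real by simp
      then show ?thesis using bd[of m] s by (simp add: ennreal_le_iff)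
    qed
    moreover have "(\<lambda>m. (real (Suc (Suc m)) * a / b + 1) / real (Suc m) * r) \<longlonglongrightarrow> a / b * r"
    proof (intro tendsto_mult tendsto_const)
      have "(\<lambda>m. a / b + (a / b + 1) * (1 / real (Suc m))) \<longlonglongrightarrow> a / b + (a / b + 1) * 0"
        by (intro tendsto_intros LIMSEQ_Suc lim_1_over_n)
      moreover have "(\<lambda>m. a / b + (a / b + 1) * (1 / real (Suc m)))
          = (\<lambda>m. (real (Suc (Suc m)) * a / b + 1) / real (Suc m))"
      proof
        fix m
        have *: "q + (q + 1) * (1 / n) = ((n + 1) * q + 1) / n" if "0 < n" for q n :: real
          using that by (simp add: field_simps)
        have "real (Suc (Suc m)) * a / b = (real (Suc m) + 1) * (a / b)" by simp
        then show "a / b + (a / b + 1) * (1 / real (Suc m)) = (real (Suc (Suc m)) * a / b + 1) / real (Suc m)"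
          using *[of "real (Suc m)" "a / b"] by simp
      qed
      ultimately show "(\<lambda>m. (real (Suc (Suc m)) * a / b + 1) / real (Suc m)) \<longlonglongrightarrow> a / b" by simp
    qed
    ultimately have "s \<le> a / b * r" by (intro LIMSEQ_le_const) auto
    then show ?thesis using s real a b by (simp add: ennreal_leI flip: ennreal_mult)
  qed
qed

lemma additive_mono_linear:
  fixes g :: "real \<Rightarrow> ennreal"
  assumes mono: "\<And>x y. 0 < x \<Longrightarrow> x \<le> y \<Longrightarrow> g x \<le> g y"
    and sub: "\<And>x y e. 0 < x \<Longrightarrow> 0 < y \<Longrightarrow> 0 < e \<Longrightarrow> g (x + y) \<le> g (x + e) + g y"
    and super: "\<And>x y e. 0 < x \<Longrightarrow> 0 < y \<Longrightarrow> 0 < e \<Longrightarrow> g x + g y \<le> g (x + y + e)"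
    and a: "0 < a"
  shows "g a = ennreal a * g 1"
proof (rule antisym)
  show "g a \<le> ennreal a * g 1"
    using additive_mono_le[OF mono sub super a, of 1] by simp
  have "g 1 \<le> ennreal (1 / a) * g a"
    using additive_mono_le[OF mono sub super, of 1 a] a by simp
  then have "ennreal a * g 1 \<le> ennreal a * (ennreal (1 / a) * g a)"
    by (intro mult_left_mono) auto
  then show "ennreal a * g 1 \<le> g a"
    using a by (simp flip: mult.assoc ennreal_mult)
qed

text \<open>The sides in \<open>S\<close> are normalised to 1 one after the other, each by linearity
  in a single length. Sides outside \<open>S\<close> are carried along unchanged: for flat boxes
  this is the normal direction, for Lebesgue measure there is none.\<close>

lemma box_functional_eq_prod:
  fixes f :: "('i::finite \<Rightarrow> real) \<Rightarrow> ennreal"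
  assumes mono: "\<And>l l'. (\<And>i. 0 < l i) \<Longrightarrow> (\<And>i. l i \<le> l' i) \<Longrightarrow> f l \<le> f l'"
    and sub: "\<And>i l x y e. i \<in> S \<Longrightarrow> (\<And>i. 0 < l i) \<Longrightarrow> 0 < x \<Longrightarrow> 0 < y \<Longrightarrow> 0 < e \<Longrightarrow>
        f (l(i := x + y)) \<le> f (l(i := x + e)) + f (l(i := y))"
    and super: "\<And>i l x y e. i \<in> S \<Longrightarrow> (\<And>i. 0 < l i) \<Longrightarrow> 0 < x \<Longrightarrow> 0 < y \<Longrightarrow> 0 < e \<Longrightarrow>
        f (l(i := x)) + f (l(i := y)) \<le> f (l(i := x + y + e))"
    and l: "\<And>i. 0 < l i"
  shows "f l = ennreal (\<Prod>i\<in>S. l i) * f (\<lambda>i. if i \<in> S then 1 else l i)"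
proof -
  have "T \<subseteq> S \<Longrightarrow> f l = ennreal (\<Prod>i\<in>T. l i) * f (\<lambda>i. if i \<in> T then 1 else l i)" for T
  proof (induction T rule: infinite_finite_induct)
    case (insert j T)
    let ?l = "\<lambda>i. if i \<in> T then 1 else l i"
    have pos: "0 < ?l i" for i using l by auto
    have "f (?l(j := l j)) = ennreal (l j) * f (?l(j := 1))"
    proof (rule additive_mono_linear)
      fix x y :: real assume "0 < x" "x \<le> y"
      then show "f (?l(j := x)) \<le> f (?l(j := y))" using l by (intro mono) auto
    next
      fix x y e :: real assume xy: "0 < x" "0 < y" "0 < e"
      have "j \<in> S" using insert by auto
      then show "f (?l(j := x + y)) \<le> f (?l(j := x + e)) + f (?l(j := y))"
        "f (?l(j := x)) + f (?l(j := y)) \<le> f (?l(j := x + y + e))"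
        using xy pos by (intro sub super; simp)+
    qed (use l in auto)
    moreover have "?l(j := l j) = ?l" using insert by auto
    moreover have "?l(j := 1) = (\<lambda>i. if i \<in> insert j T then 1 else l i)" by auto
    ultimately have "f ?l = ennreal (l j) * f (\<lambda>i. if i \<in> insert j T then 1 else l i)" by simp
    then show ?case using insert l
      by (simp add: prod_nonneg less_imp_le mult_ac ennreal_mult)
  qed auto
  then show ?thesis by blast
qed

section \<open>Hausdorff measure of flat boxes\<close>

text \<open>The premeasure at a fixed scale. Covers are merged, split and transported at one scale,
  and the supremum over scales is taken afterwards.\<close>

definition hausdorff_pre :: "real \<Rightarrow> real \<Rightarrow> ('a::metric_space) set \<Rightarrow> ennreal" where
  "hausdorff_pre s \<delta> A = (INF C \<in> {C :: nat \<Rightarrow> 'a set. A \<subseteq> \<Union>(range C) \<and>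
                                 (\<forall>i. bounded (C i) \<and> diameter (C i) \<le> \<delta>)}.
        (\<Sum>i. ennreal (hm_const s * (diameter (C i) / 2) powr s)))"

lemma hausdorff_measure_eq_SUP: "hausdorff_measure s A = (SUP \<delta>\<in>{0<..}. hausdorff_pre s \<delta> A)"
  by (simp add: hausdorff_measure_def hausdorff_pre_def)

lemma hausdorff_pre_mono: "A \<subseteq> B \<Longrightarrow> hausdorff_pre s \<delta> A \<le> hausdorff_pre s \<delta> B"
  unfolding hausdorff_pre_def by (intro INF_superset_mono) auto

lemma hausdorff_pre_antimono: "\<delta> \<le> \<delta>' \<Longrightarrow> hausdorff_pre s \<delta>' A \<le> hausdorff_pre s \<delta> A"
  unfolding hausdorff_pre_def by (intro INF_superset_mono) (auto intro: order_trans)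

lemma hausdorff_pre_le_single:
  assumes "bounded A" "diameter A \<le> \<delta>" "0 < \<delta>" "0 < s"
  shows "hausdorff_pre s \<delta> A \<le> ennreal (hm_const s * (diameter A / 2) powr s)"
proof -
  define C where "C n = (if n = 0 then A else {})" for n :: nat
  have "hausdorff_pre s \<delta> A \<le> (\<Sum>i. ennreal (hm_const s * (diameter (C i) / 2) powr s))"
    unfolding hausdorff_pre_def using assms by (intro INF_lower) (auto simp: C_def)
  also have "\<dots> = (\<Sum>i\<in>{0}. ennreal (hm_const s * (diameter (C i) / 2) powr s))"
    by (intro suminf_finite) (auto simp: C_def)
  finally show ?thesis by (simp add: C_def)
qed

lemma hausdorff_pre_subadditive:
  "hausdorff_pre s \<delta> (A \<union> B) \<le> hausdorff_pre s \<delta> A + hausdorff_pre s \<delta> B"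
proof (rule ennreal_le_epsilon)
  let ?h = "\<lambda>X :: 'a set. ennreal (hm_const s * (diameter X / 2) powr s)"
  fix e :: real assume fin: "hausdorff_pre s \<delta> A + hausdorff_pre s \<delta> B < \<top>" and e: "0 < e"
  have half: "0 < e / 2" using e by simp
  obtain C where C: "A \<subseteq> \<Union>(range C)" "\<And>i. bounded (C i) \<and> diameter (C i) \<le> \<delta>"
      "(\<Sum>i::nat. ?h (C i)) < hausdorff_pre s \<delta> A + ennreal (e / 2)"
    using fin INF_approx_ennreal[OF half hausdorff_pre_def[of s \<delta> A]]
    by (auto simp: less_top)
  obtain D where D: "B \<subseteq> \<Union>(range D)" "\<And>i. bounded (D i) \<and> diameter (D i) \<le> \<delta>"
      "(\<Sum>i::nat. ?h (D i)) < hausdorff_pre s \<delta> B + ennreal (e / 2)"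
    using fin INF_approx_ennreal[OF half hausdorff_pre_def[of s \<delta> B]]
    by (auto simp: less_top)
  define G where "G i = (if even i then C (i div 2) else D (i div 2))" for i
  have "x \<in> \<Union>(range G)" if "x \<in> A \<union> B" for x
  proof -
    have "x \<in> \<Union>(range C) \<or> x \<in> \<Union>(range D)" using that C(1) D(1) by auto
    moreover have "C i = G (2 * i)" "D i = G (2 * i + 1)" for i by (auto simp: G_def)
    ultimately show ?thesis by (metis UN_iff UNIV_I)
  qed
  then have "A \<union> B \<subseteq> \<Union>(range G)" by blast
  moreover have "bounded (G i) \<and> diameter (G i) \<le> \<delta>" for i
    using C(2) D(2) by (simp add: G_def)
  ultimately have "hausdorff_pre s \<delta> (A \<union> B) \<le> (\<Sum>i. ?h (G i))"
    unfolding hausdorff_pre_def by (intro INF_lower) blast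
  also have "\<dots> \<le> (\<Sum>i. ?h (C i)) + (\<Sum>i. ?h (D i))"
  proof (rule suminf_le_const)
    fix n
    have "(\<Sum>i<n. ?h (G i)) \<le> (\<Sum>i<2*n. ?h (G i))" by (intro sum_mono2) auto
    also have "\<dots> = (\<Sum>i<n. ?h (C i)) + (\<Sum>i<n. ?h (D i))"
      by (induction n) (auto simp: G_def algebra_simps)
    also have "\<dots> \<le> (\<Sum>i. ?h (C i)) + (\<Sum>i. ?h (D i))"
      by (intro add_mono sum_le_suminf) auto
    finally show "(\<Sum>i<n. ?h (G i)) \<le> (\<Sum>i. ?h (C i)) + (\<Sum>i. ?h (D i))" .
  qed auto
  also have "\<dots> \<le> (hausdorff_pre s \<delta> A + ennreal (e / 2)) + (hausdorff_pre s \<delta> B + ennreal (e / 2))"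
    using C(3) D(3) by (intro add_mono) auto
  also have "\<dots> = hausdorff_pre s \<delta> A + hausdorff_pre s \<delta> B + (ennreal (e / 2) + ennreal (e / 2))"
    by (simp add: algebra_simps)
  also have "ennreal (e / 2) + ennreal (e / 2) = ennreal e" using e by (simp flip: ennreal_plus)
  finally show "hausdorff_pre s \<delta> (A \<union> B) \<le> hausdorff_pre s \<delta> A + hausdorff_pre s \<delta> B + ennreal e" .
qed

text \<open>A set of diameter at most \<open>\<delta>\<close> cannot meet both \<open>A\<close> and
  \<open>B\<close>, so a cover of the union splits into two covers. Sets that miss a part are
  replaced by the empty set, which has weight 0.\<close>

lemma hausdorff_pre_separated:
  assumes sep: "\<And>a b. a \<in> A \<Longrightarrow> b \<in> B \<Longrightarrow> \<delta> < dist a b" and s: "0 < s" and \<delta>: "0 < \<delta>"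
  shows "hausdorff_pre s \<delta> A + hausdorff_pre s \<delta> B \<le> hausdorff_pre s \<delta> (A \<union> B)"
  unfolding hausdorff_pre_def[of s \<delta> "A \<union> B"]
proof (rule INF_greatest, clarify)
  let ?h = "\<lambda>X :: 'a set. ennreal (hm_const s * (diameter X / 2) powr s)"
  fix C :: "nat \<Rightarrow> 'a set"
  assume C: "A \<union> B \<subseteq> \<Union>(range C)" "\<forall>i. bounded (C i) \<and> diameter (C i) \<le> \<delta>"
  define CA where "CA i = (if C i \<inter> A = {} then {} else C i)" for i
  define CB where "CB i = (if C i \<inter> B = {} then {} else C i)" for i
  have A: "hausdorff_pre s \<delta> A \<le> (\<Sum>i. ?h (CA i))"
    unfolding hausdorff_pre_def
  proof (intro INF_lower CollectI conjI subsetI)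
    fix x assume "x \<in> A"
    then obtain i where "x \<in> C i" using C(1) by auto
    then have "x \<in> CA i" using \<open>x \<in> A\<close> by (auto simp: CA_def)
    then show "x \<in> \<Union>(range CA)" by auto
  qed (use C \<delta> in \<open>auto simp: CA_def\<close>)
  have B: "hausdorff_pre s \<delta> B \<le> (\<Sum>i. ?h (CB i))"
    unfolding hausdorff_pre_def
  proof (intro INF_lower CollectI conjI subsetI)
    fix x assume "x \<in> B"
    then obtain i where "x \<in> C i" using C(1) by auto
    then have "x \<in> CB i" using \<open>x \<in> B\<close> by (auto simp: CB_def)
    then show "x \<in> \<Union>(range CB)" by auto
  qed (use C \<delta> in \<open>auto simp: CB_def\<close>)
  have "CA i = {} \<or> CB i = {}" for i
  proof (rule ccontr)
    assume "\<not> ?thesis"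
    then obtain a b where "a \<in> C i" "a \<in> A" "b \<in> C i" "b \<in> B"
      by (auto simp: CA_def CB_def split: if_splits)
    then have "dist a b \<le> \<delta>" using C(2) diameter_bounded_bound order_trans by blast
    then show False using sep \<open>a \<in> A\<close> \<open>b \<in> B\<close> by force
  qed
  moreover have "CA i = {} \<or> CA i = C i" "CB i = {} \<or> CB i = C i" for i
    by (auto simp: CA_def CB_def)
  moreover have "?h {} = 0" using s by simp
  ultimately have "?h (CA i) + ?h (CB i) \<le> ?h (C i)" for i
    by (metis add.left_neutral add.right_neutral order_refl zero_le)
  then have "(\<Sum>i. ?h (CA i)) + (\<Sum>i. ?h (CB i)) \<le> (\<Sum>i. ?h (C i))"
    by (subst suminf_add) (auto intro!: suminf_le)
  then show "hausdorff_pre s \<delta> A + hausdorff_pre s \<delta> B \<le> (\<Sum>i. ?h (C i))"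
    using A B add_mono order_trans by blast
qed

lemma hausdorff_pre_isometry:
  fixes f :: "'a::metric_space \<Rightarrow> 'b::metric_space"
  assumes iso: "\<And>x y. dist (f x) (f y) = dist x y"
  shows "hausdorff_pre s \<delta> (f ` A) \<le> hausdorff_pre s \<delta> A"
  unfolding hausdorff_pre_def[of s \<delta> A]
proof (rule INF_greatest, clarify)
  fix C :: "nat \<Rightarrow> 'a set"
  assume C: "A \<subseteq> \<Union>(range C)" "\<forall>i. bounded (C i) \<and> diameter (C i) \<le> \<delta>"
  have [simp]: "diameter (f ` X) = diameter X" for X
  proof -
    have "(\<lambda>(x, y). dist x y) ` (f ` X \<times> f ` X) = (\<lambda>(x, y). dist x y) ` (X \<times> X)"
      using iso by (force simp: image_iff)
    then show ?thesis by (simp add: diameter_def)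
  qed
  have "bounded (f ` X)" if "bounded X" for X
  proof -
    from that obtain x e where "\<forall>y\<in>X. dist x y \<le> e" unfolding bounded_def by blast
    then have "\<forall>y\<in>f ` X. dist (f x) y \<le> e" using iso by auto
    then show ?thesis unfolding bounded_def by blast
  qed
  moreover have "f ` A \<subseteq> \<Union>(range (\<lambda>i. f ` C i))" using C(1) by blast
  ultimately have "(\<lambda>i. f ` C i) \<in> {C. f ` A \<subseteq> \<Union>(range C) \<and>
      (\<forall>i. bounded (C i) \<and> diameter (C i) \<le> \<delta>)}"
    using C(2) by simp
  from INF_lower[OF this]
  have "hausdorff_pre s \<delta> (f ` A) \<le> (\<Sum>i. ennreal (hm_const s * (diameter (f ` C i) / 2) powr s))"
    unfolding hausdorff_pre_def .
  then show "hausdorff_pre s \<delta> (f ` A) \<le> (\<Sum>i. ennreal (hm_const s * (diameter (C i) / 2) powr s))"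
    by simp
qed

lemma hausdorff_measure_isometry_le:
  assumes "\<And>x y. dist (f x) (f y) = dist x y"
  shows "hausdorff_measure s (f ` A) \<le> hausdorff_measure s A"
  unfolding hausdorff_measure_eq_SUP using assms
  by (intro SUP_mono) (auto intro: hausdorff_pre_isometry)

lemma hausdorff_measure_mono: "A \<subseteq> B \<Longrightarrow> hausdorff_measure s A \<le> hausdorff_measure s B"
  unfolding hausdorff_measure_eq_SUP by (intro SUP_mono) (auto intro: hausdorff_pre_mono)

lemma hausdorff_measure_subadditive:
  "hausdorff_measure s (A \<union> B) \<le> hausdorff_measure s A + hausdorff_measure s B"
  unfolding hausdorff_measure_eq_SUP[of s "A \<union> B"]
proof (rule SUP_least)
  fix \<delta> :: real assume "\<delta> \<in> {0<..}"
  then have "hausdorff_pre s \<delta> A \<le> hausdorff_measure s A"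
    "hausdorff_pre s \<delta> B \<le> hausdorff_measure s B"
    unfolding hausdorff_measure_eq_SUP by (auto intro!: SUP_upper)
  then show "hausdorff_pre s \<delta> (A \<union> B) \<le> hausdorff_measure s A + hausdorff_measure s B"
    using hausdorff_pre_subadditive add_mono order_trans by blast
qed

text \<open>The premeasures grow as the scale shrinks, so both suprema can be taken along a common
  scale, and any scale below \<open>r\<close> separates the two sets.\<close>

lemma hausdorff_measure_separated:
  assumes sep: "\<And>a b. a \<in> A \<Longrightarrow> b \<in> B \<Longrightarrow> r \<le> dist a b" and r: "0 < r" and s: "0 < s"
  shows "hausdorff_measure s A + hausdorff_measure s B \<le> hausdorff_measure s (A \<union> B)"
proof -
  have "hausdorff_measure s A + hausdorff_measure s B
      = (SUP \<delta>\<in>{0<..}. hausdorff_pre s \<delta> A + hausdorff_pre s \<delta> B)"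
    unfolding hausdorff_measure_eq_SUP
  proof (rule SUP_add_directed_ennreal[symmetric])
    fix \<delta> \<delta>' :: real assume "\<delta> \<in> {0<..}" "\<delta>' \<in> {0<..}"
    then show "\<exists>k\<in>{0<..}. hausdorff_pre s \<delta> A + hausdorff_pre s \<delta>' B
        \<le> hausdorff_pre s k A + hausdorff_pre s k B"
      by (intro bexI[of _ "min \<delta> \<delta>'"] add_mono hausdorff_pre_antimono) auto
  qed
  also have "\<dots> \<le> hausdorff_measure s (A \<union> B)"
  proof (rule SUP_least)
    fix \<delta> :: real assume \<delta>: "\<delta> \<in> {0<..}"
    define \<delta>' where "\<delta>' = min \<delta> (r / 2)"
    have \<delta>': "0 < \<delta>'" "\<delta>' < r" "\<delta>' \<le> \<delta>" using \<delta> r by (auto simp: \<delta>'_def)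
    have "hausdorff_pre s \<delta> A + hausdorff_pre s \<delta> B \<le> hausdorff_pre s \<delta>' A + hausdorff_pre s \<delta>' B"
      using \<delta>' by (intro add_mono hausdorff_pre_antimono) auto
    also have "\<dots> \<le> hausdorff_pre s \<delta>' (A \<union> B)"
      using \<delta>' sep s by (intro hausdorff_pre_separated) (auto intro: less_le_trans)
    also have "\<dots> \<le> hausdorff_measure s (A \<union> B)"
      unfolding hausdorff_measure_eq_SUP using \<delta>' by (intro SUP_upper) auto
    finally show "hausdorff_pre s \<delta> A + hausdorff_pre s \<delta> B \<le> hausdorff_measure s (A \<union> B)" .
  qed
  finally show ?thesis .
qed

section \<open>Boxes in a coordinate hyperplane: scaling, finiteness and positivity\<close>

definition flat_box :: "'n \<Rightarrow> ('n \<Rightarrow> real) \<Rightarrow> (real^'n) set" where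
  "flat_box k l = {x. x $ k = 0 \<and> (\<forall>i. i \<noteq> k \<longrightarrow> 0 \<le> x $ i \<and> x $ i \<le> l i)}"

lemma flat_box_mono: "(\<And>i. l i \<le> l' i) \<Longrightarrow> flat_box k l \<subseteq> flat_box k l'"
  unfolding flat_box_def by (auto intro: order_trans)

lemma flat_box_split:
  assumes "i \<noteq> k" "0 \<le> x"
  shows "flat_box k (l(i := x + y)) \<subseteq>
    flat_box k (l(i := x)) \<union> (\<lambda>p. p + axis i x) ` flat_box k (l(i := y))"
proof
  fix p assume p: "p \<in> flat_box k (l(i := x + y))"
  show "p \<in> flat_box k (l(i := x)) \<union> (\<lambda>p. p + axis i x) ` flat_box k (l(i := y))"
  proof (cases "p $ i \<le> x")
    case True
    then show ?thesis using p by (auto simp: flat_box_def)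
  next
    case False
    have "p - axis i x \<in> flat_box k (l(i := y))"
      using p False assms by (auto simp: flat_box_def axis_def)
    then show ?thesis by (metis (no_types, lifting) UnI2 diff_add_cancel image_eqI)
  qed
qed

lemma hausdorff_pre_flat_box_split:
  assumes "i \<noteq> k" "0 \<le> x"
  shows "hausdorff_pre s \<delta> (flat_box k (l(i := x + y)))
    \<le> hausdorff_pre s \<delta> (flat_box k (l(i := x))) + hausdorff_pre s \<delta> (flat_box k (l(i := y)))"
proof -
  have "hausdorff_pre s \<delta> (flat_box k (l(i := x + y))) \<le>
     hausdorff_pre s \<delta> (flat_box k (l(i := x)) \<union> (\<lambda>p. p + axis i x) ` flat_box k (l(i := y)))"
    by (rule hausdorff_pre_mono[OF flat_box_split[OF assms]])
  also have "\<dots> \<le> hausdorff_pre s \<delta> (flat_box k (l(i := x)))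
      + hausdorff_pre s \<delta> ((\<lambda>p. p + axis i x) ` flat_box k (l(i := y)))"
    by (rule hausdorff_pre_subadditive)
  also have "\<dots> \<le> hausdorff_pre s \<delta> (flat_box k (l(i := x))) + hausdorff_pre s \<delta> (flat_box k (l(i := y)))"
    by (intro add_left_mono hausdorff_pre_isometry) simp
  finally show ?thesis .
qed

lemma hausdorff_measure_translation:
  fixes A :: "'a::real_normed_vector set"
  shows "hausdorff_measure s ((\<lambda>p. p + c) ` A) = hausdorff_measure s A"
proof (rule antisym)
  have "hausdorff_measure s ((\<lambda>p. p - c) ` (\<lambda>p. p + c) ` A) \<le> hausdorff_measure s ((\<lambda>p. p + c) ` A)"
    by (rule hausdorff_measure_isometry_le) (simp add: dist_norm)
  then show "hausdorff_measure s A \<le> hausdorff_measure s ((\<lambda>p. p + c) ` A)"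
    by (simp add: image_image)
qed (rule hausdorff_measure_isometry_le, simp)

lemma hausdorff_measure_flat_box:
  fixes l :: "'n::finite \<Rightarrow> real"
  assumes l: "\<And>i. 0 < l i" and s: "0 < s"
  shows "hausdorff_measure s (flat_box k l)
    = ennreal (\<Prod>i\<in>UNIV - {k}. l i) * hausdorff_measure s (flat_box k (\<lambda>_. 1))"
proof -
  let ?H = "\<lambda>l. hausdorff_measure s (flat_box k l)"
  have "?H l = ennreal (\<Prod>i\<in>UNIV - {k}. l i) * ?H (\<lambda>i. if i \<in> UNIV - {k} then 1 else l i)"
  proof (rule box_functional_eq_prod)
    fix l l' :: "'n \<Rightarrow> real" assume "\<And>i. l i \<le> l' i"
    then show "?H l \<le> ?H l'" by (intro hausdorff_measure_mono flat_box_mono)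
  next
    fix i and l :: "'n \<Rightarrow> real" and x y e :: real
    assume i: "i \<in> UNIV - {k}" and l: "\<And>i. 0 < l i" and xy: "0 < x" "0 < y" "0 < e"
    have "?H (l(i := x + y)) \<le> hausdorff_measure s
        (flat_box k (l(i := x)) \<union> (\<lambda>p. p + axis i x) ` flat_box k (l(i := y)))"
      using i xy by (intro hausdorff_measure_mono flat_box_split) auto
    also have "\<dots> \<le> ?H (l(i := x)) + ?H (l(i := y))"
      by (metis hausdorff_measure_subadditive hausdorff_measure_translation)
    also have "\<dots> \<le> ?H (l(i := x + e)) + ?H (l(i := y))"
      using xy by (intro add_right_mono hausdorff_measure_mono flat_box_mono) auto
    finally show "?H (l(i := x + y)) \<le> ?H (l(i := x + e)) + ?H (l(i := y))" .
    \<comment> \<open>Shifting the second box by \<open>x + e\<close> instead of \<open>x\<close>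
      leaves a gap of width \<open>e\<close>, so that the two pieces are at positive
      distance.\<close>
    have "?H (l(i := x)) + ?H (l(i := y))
       = ?H (l(i := x)) + hausdorff_measure s ((\<lambda>p. p + axis i (x + e)) ` flat_box k (l(i := y)))"
      by (simp add: hausdorff_measure_translation)
    also have "\<dots> \<le> hausdorff_measure s
        (flat_box k (l(i := x)) \<union> (\<lambda>p. p + axis i (x + e)) ` flat_box k (l(i := y)))"
    proof (rule hausdorff_measure_separated)
      fix a b assume "a \<in> flat_box k (l(i := x))" "b \<in> (\<lambda>p. p + axis i (x + e)) ` flat_box k (l(i := y))"
      then have "a $ i \<le> x" "x + e \<le> b $ i" using i by (auto simp: flat_box_def axis_def)
      then have "e \<le> b $ i - a $ i" by simp
      also have "\<dots> \<le> dist a b"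
        using component_le_norm_cart[of "b - a" i] by (simp add: dist_norm norm_minus_commute)
      finally show "e \<le> dist a b" .
    qed (use xy s in auto)
    also have "\<dots> \<le> ?H (l(i := x + y + e))"
    proof (intro hausdorff_measure_mono Un_least subsetI)
      fix p assume "p \<in> flat_box k (l(i := x))"
      moreover have "flat_box k (l(i := x)) \<subseteq> flat_box k (l(i := x + y + e))"
        using xy by (intro flat_box_mono) auto
      ultimately show "p \<in> flat_box k (l(i := x + y + e))" by blast
    next
      fix p assume "p \<in> (\<lambda>p. p + axis i (x + e)) ` flat_box k (l(i := y))"
      then show "p \<in> flat_box k (l(i := x + y + e))" using xy i
        by (auto simp: flat_box_def axis_def split: if_splits)
    qed
    finally show "?H (l(i := x)) + ?H (l(i := y)) \<le> ?H (l(i := x + y + e))" .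
  qed (use l in auto)
  also have "flat_box k (\<lambda>i. if i \<in> UNIV - {k} then 1 else l i) = flat_box k (\<lambda>_. 1)"
    by (auto simp: flat_box_def)
  finally show ?thesis .
qed

lemma hm_const_pos: "0 < s \<Longrightarrow> 0 < hm_const s"
  by (simp add: hm_const_def Gamma_real_pos)

text \<open>Cut the unit box into cubes of side \<open>1 / m\<close>. Their number is
  \<open>m\<close> to the power of the dimension of the measure, while each weighs at most a
  constant times the inverse of that power, so the bound is uniform in the scale.\<close>

lemma hausdorff_measure_flat_box_finite:
  fixes k :: "'n::finite"
  assumes d: "2 \<le> CARD('n)"
  shows "hausdorff_measure (real CARD('n) - 1) (flat_box k (\<lambda>_. 1)) < \<top>"
proof -
  define d where "d = CARD('n) - 1"
  define s where "s = real CARD('n) - 1"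
  have s: "0 < s" "s = real d" using d by (auto simp: s_def d_def)
  have "hausdorff_pre s \<delta> (flat_box k (\<lambda>_. 1)) \<le> ennreal (hm_const s * real CARD('n) powr s)"
    if \<delta>: "0 < \<delta>" for \<delta>
  proof -
    obtain m0 :: nat where m0: "real CARD('n) / \<delta> < real m0" using reals_Archimedean2 by blast
    define m where "m = Suc m0"
    have m: "0 < m" "real CARD('n) / real m \<le> \<delta>"
      using m0 \<delta> by (auto simp: m_def field_simps)
    let ?H = "\<lambda>l. hausdorff_pre s \<delta> (flat_box k l)"
    have mult: "?H (l(i := real (Suc j) * x)) \<le> of_nat (Suc j) * ?H (l(i := x))"
      if "i \<noteq> k" "0 \<le> x" for i l j x
    proof (induction j)
      case (Suc j)
      have "?H (l(i := real (Suc (Suc j)) * x)) = ?H (l(i := x + real (Suc j) * x))"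
        by (simp add: algebra_simps)
      also have "\<dots> \<le> ?H (l(i := x)) + ?H (l(i := real (Suc j) * x))"
        using that by (rule hausdorff_pre_flat_box_split)
      also have "\<dots> \<le> ?H (l(i := x)) + of_nat (Suc j) * ?H (l(i := x))"
        using Suc by (rule add_left_mono)
      also have "\<dots> = of_nat (Suc (Suc j)) * ?H (l(i := x))"
        by (simp only: of_nat_Suc distrib_right mult_1_left)
      finally show ?case .
    qed simp
    \<comment> \<open>One direction is subdivided at a time; \<open>T\<close> collects the
      directions that have full length 1.\<close>
    have "T \<subseteq> UNIV - {k} \<Longrightarrow> ?H (\<lambda>i. if i \<in> T then 1 else 1 / real m)
        \<le> of_nat m ^ card T * ?H (\<lambda>_. 1 / real m)" for T
    proof (induction T rule: infinite_finite_induct)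
      case (insert j T)
      let ?l = "\<lambda>i. if i \<in> T then 1 else 1 / real m"
      have "(\<lambda>i. if i \<in> insert j T then 1 else 1 / real m) = ?l(j := real (Suc m0) * (1 / real m))"
        by (auto simp: m_def)
      then have "?H (\<lambda>i. if i \<in> insert j T then 1 else 1 / real m)
          \<le> of_nat m * ?H (?l(j := 1 / real m))"
        using mult[of j "1 / real m" ?l m0] insert by (simp add: m_def)
      also have "?l(j := 1 / real m) = ?l" using insert by auto
      also have "of_nat m * ?H ?l \<le> of_nat m * (of_nat m ^ card T * ?H (\<lambda>_. 1 / real m))"
        using insert by (intro mult_left_mono) auto
      finally show ?case using insert by (simp add: mult_ac)
    qed auto
    from this[of "UNIV - {k}"]
    have "?H (\<lambda>i. if i \<in> UNIV - {k} then 1 else 1 / real m) \<le> of_nat m ^ d * ?H (\<lambda>_. 1 / real m)"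
      by (simp add: d_def)
    moreover have "flat_box k (\<lambda>i. if i \<in> UNIV - {k} then 1 else 1 / real m) = flat_box k (\<lambda>_. 1)"
      by (auto simp: flat_box_def)
    ultimately have 1: "?H (\<lambda>_. 1) \<le> of_nat m ^ d * ?H (\<lambda>_. 1 / real m)" by simp
    have nrm: "norm (x - y) \<le> real CARD('n) / real m"
      if "x \<in> flat_box k (\<lambda>_. 1 / real m)" "y \<in> flat_box k (\<lambda>_. 1 / real m)" for x y :: "real^'n"
    proof -
      have "\<bar>(x - y) $ i\<bar> \<le> 1 / real m" for i
      proof (cases "i = k")
        case False
        then have "0 \<le> x $ i" "x $ i \<le> 1 / real m" "0 \<le> y $ i" "y $ i \<le> 1 / real m"
          using that by (auto simp: flat_box_def)
        then show ?thesis unfolding vector_minus_component by linarith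
      qed (use that in \<open>simp add: flat_box_def\<close>)
      then have "(\<Sum>i\<in>UNIV. \<bar>(x - y) $ i\<bar>) \<le> (\<Sum>i\<in>(UNIV::'n set). 1 / real m)"
        by (intro sum_mono)
      then show ?thesis using norm_le_l1_cart[of "x - y"] by simp
    qed
    have diam: "diameter (flat_box k (\<lambda>_. 1 / real m) :: (real^'n) set) \<le> real CARD('n) / real m"
      using nrm by (intro diameter_le) auto
    have bdd: "bounded (flat_box k (\<lambda>_. 1 / real m) :: (real^'n) set)"
    proof -
      have "0 \<in> (flat_box k (\<lambda>_. 1 / real m) :: (real^'n) set)" by (auto simp: flat_box_def)
      then show ?thesis using nrm[of 0] unfolding bounded_def dist_norm by blast
    qed
    have "?H (\<lambda>_. 1 / real m) \<le> ennreal (hm_const s * (diameter (flat_box k (\<lambda>_. 1 / real m) :: (real^'n) set) / 2) powr s)"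
      using bdd diam m \<delta> s by (intro hausdorff_pre_le_single) auto
    also have "\<dots> \<le> ennreal (hm_const s * (real CARD('n) / real m) powr s)"
    proof (intro ennreal_leI mult_left_mono powr_mono2)
      show "diameter (flat_box k (\<lambda>_. 1 / real m) :: (real^'n) set) / 2 \<le> real CARD('n) / real m"
        using diam diameter_ge_0[OF bdd] by linarith
    qed (use diameter_ge_0[OF bdd] s hm_const_pos[of s] in auto)
    finally have "?H (\<lambda>_. 1) \<le> ennreal (real m ^ d) * ennreal (hm_const s * (real CARD('n) / real m) powr s)"
    proof -
      have "of_nat m ^ d = ennreal (real m ^ d)"
        by (simp add: ennreal_of_nat_eq_real_of_nat ennreal_power)
      then show "hausdorff_pre s \<delta> (flat_box k (\<lambda>_. 1 / real m) :: (real^'n) set)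
          \<le> ennreal (hm_const s * (real CARD('n) / real m) powr s) \<Longrightarrow> ?thesis"
        using 1 by (metis (no_types, lifting) mult_left_mono order_trans zero_le)
    qed
    also have "\<dots> = ennreal (real m ^ d * (hm_const s * (real CARD('n) / real m) powr s))"
      using hm_const_pos[OF s(1)] by (subst ennreal_mult) auto
    also have "real m ^ d * (hm_const s * (real CARD('n) / real m) powr s) = hm_const s * real CARD('n) powr s"
      using m s by (simp add: powr_divide powr_realpow field_simps)
    finally show ?thesis .
  qed
  then have "hausdorff_measure s (flat_box k (\<lambda>_. 1) :: (real^'n) set) \<le> ennreal (hm_const s * real CARD('n) powr s)"
    unfolding hausdorff_measure_eq_SUP by (intro SUP_least) auto
  then show ?thesis unfolding s_def using le_less_trans ennreal_less_top by blast
qed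

lemma emeasure_lborel_cbox_measure:
  "emeasure lborel (cbox a b) = ennreal (measure lborel (cbox a b))"
  using emeasure_lborel_cbox_finite[of a b] by (intro emeasure_eq_ennreal_measure) auto

lemma hausdorff_measure_flat_box_pos:
  fixes k :: "'n::finite"
  assumes d: "2 \<le> CARD('n)"
  shows "0 < hausdorff_measure (real CARD('n) - 1) (flat_box k (\<lambda>_. 1))"
proof -
  define d where "d = CARD('n) - 1"
  define s where "s = real CARD('n) - 1"
  have s: "0 < s" "s = real d" using d by (auto simp: s_def d_def)
  \<comment> \<open>A thickened covering set is a box with \<open>d\<close> sides of twice its
    diameter and one side 1, and twice the diameter is 4 times half the diameter. Dividing by
    \<open>hm_const s\<close> expresses its volume through the weights of the premeasure.\<close>
  define K where "K = 4 ^ d / hm_const s"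
  have K: "0 < K" using hm_const_pos[OF s(1)] by (simp add: K_def)
  have prod_upd: "(\<Prod>i\<in>UNIV. if i = k then 1 else c) = c ^ d" for c :: real
  proof -
    have "(\<Prod>i\<in>UNIV. if i = k then 1 else c) = (\<Prod>i\<in>UNIV - {k}. if i = k then 1 else c)"
      by (subst prod.remove[of _ k]) auto
    also have "\<dots> = (\<Prod>i\<in>UNIV - {k}. c)" by (intro prod.cong) auto
    finally show ?thesis by (simp add: d_def)
  qed
  \<comment> \<open>Thicken each covering set to height 1 and compare with the volume of the unit cube.\<close>
  have "ennreal (1 / K) \<le> hausdorff_pre s 1 (flat_box k (\<lambda>_. 1) :: (real^'n) set)"
    unfolding hausdorff_pre_def
  proof (rule INF_greatest, clarify)
    fix C :: "nat \<Rightarrow> (real^'n) set"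
    assume C: "flat_box k (\<lambda>_. 1) \<subseteq> \<Union>(range C)" "\<forall>i. bounded (C i) \<and> diameter (C i) \<le> 1"
    \<comment> \<open>Any point serves as centre because the half width of the box is the full
      diameter. The arbitrary value for an empty set is discarded by \<open>D\<close>.\<close>
    define p where "p i = (SOME x. x \<in> C i)" for i
    define D where "D i = (if C i = {} then {} else
        cbox (\<chi> j. if j = k then 0 else p i $ j - diameter (C i))
             (\<chi> j. if j = k then 1 else p i $ j + diameter (C i)))" for i
    have dist: "\<bar>x $ j - p i $ j\<bar> \<le> diameter (C i)" if "x \<in> C i" for x i j
    proof -
      have "p i \<in> C i" using that by (auto simp: p_def intro: someI)
      then have "dist x (p i) \<le> diameter (C i)" using that C(2) by (intro diameter_bounded_bound) auto
      then show ?thesis using component_le_norm_cart[of "x - p i" j] by (auto simp: dist_norm)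
    qed
    have "cbox 0 (\<chi> j. 1) \<subseteq> (\<Union>i. D i)"
    proof
      fix x :: "real^'n" assume x: "x \<in> cbox 0 (\<chi> j. 1)"
      define y where "y = (\<chi> j. if j = k then 0 else x $ j)"
      have "y \<in> flat_box k (\<lambda>_. 1)" using x by (auto simp: flat_box_def y_def mem_box_cart)
      then obtain i where i: "y \<in> C i" using C(1) by auto
      have "x \<in> D i"
      proof -
        have "p i $ j - diameter (C i) \<le> x $ j \<and> x $ j \<le> p i $ j + diameter (C i)" if "j \<noteq> k" for j
          using dist[OF i, of j] that by (simp add: y_def abs_le_iff)
        then show ?thesis using i x by (auto simp: D_def mem_box_cart)
      qed
      then show "x \<in> (\<Union>i. D i)" by auto
    qed
    then have "emeasure lborel (cbox 0 (\<chi> j. 1) :: (real^'n) set) \<le> emeasure lborel (\<Union>i. D i)"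
      by (intro emeasure_mono) (auto simp: D_def)
    also have "\<dots> \<le> (\<Sum>i. emeasure lborel (D i))"
      by (intro emeasure_subadditive_countably) (auto simp: D_def)
    also have "\<dots> \<le> (\<Sum>i. ennreal K * ennreal (hm_const s * (diameter (C i) / 2) powr s))"
    proof (intro suminf_le allI)
      fix i
      have dg: "0 \<le> diameter (C i)" using C(2) diameter_ge_0 by auto
      show "emeasure lborel (D i) \<le> ennreal K * ennreal (hm_const s * (diameter (C i) / 2) powr s)"
      proof (cases "C i = {}")
        case False
        let ?a = "\<chi> j. if j = k then 0 else p i $ j - diameter (C i)"
        let ?b = "\<chi> j. if j = k then 1 else p i $ j + diameter (C i)"
        have ne: "cbox ?a ?b \<noteq> {}" using dg by (auto simp: interval_ne_empty_cart)
        have "emeasure lborel (D i) = ennreal (measure lborel (cbox ?a ?b))"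
          using False by (simp add: D_def emeasure_lborel_cbox_measure)
        also have "measure lborel (cbox ?a ?b) = (\<Prod>j\<in>UNIV. if j = k then 1 else 2 * diameter (C i))"
          using ne by (subst content_cbox_cart) (simp, intro prod.cong refl, simp)
        also have "\<dots> = (2 * diameter (C i)) ^ d" by (rule prod_upd)
        also have "\<dots> = 4 ^ d * (diameter (C i) / 2) ^ d"
          by (subst power_mult_distrib[symmetric]) simp
        also have "(diameter (C i) / 2) ^ d = (diameter (C i) / 2) powr s"
          using dg s d by (cases "diameter (C i) = 0") (auto simp: powr_realpow)
        also have "4 ^ d * (diameter (C i) / 2) powr s = K * (hm_const s * (diameter (C i) / 2) powr s)"
          using hm_const_pos[OF s(1)] by (simp add: K_def)
        finally show ?thesis using K hm_const_pos[OF s(1)] by (simp add: ennreal_mult)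
      qed (simp add: D_def)
    qed auto
    also have "\<dots> = ennreal K * (\<Sum>i. ennreal (hm_const s * (diameter (C i) / 2) powr s))"
      by (rule ennreal_suminf_cmult)
    finally have le: "1 \<le> ennreal K * (\<Sum>i. ennreal (hm_const s * (diameter (C i) / 2) powr s))"
    proof -
      have ne: "(cbox 0 (\<chi> j. 1) :: (real^'n) set) \<noteq> {}" by (auto simp: interval_ne_empty_cart)
      have "emeasure lborel (cbox 0 (\<chi> j. 1) :: (real^'n) set) = ennreal (measure lborel (cbox 0 (\<chi> j. 1) :: (real^'n) set))"
        by (simp add: emeasure_lborel_cbox_measure)
      also have "\<dots> = 1" using ne by (subst content_cbox_cart) auto
      finally show "emeasure lborel (cbox 0 (\<chi> j. 1) :: (real^'n) set)
          \<le> ennreal K * (\<Sum>i. ennreal (hm_const s * (diameter (C i) / 2) powr s)) \<Longrightarrow> ?thesis" by simp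
    qed
    have "ennreal (1 / K) * 1 \<le> ennreal (1 / K) * (ennreal K * (\<Sum>i. ennreal (hm_const s * (diameter (C i) / 2) powr s)))"
      using le by (intro mult_left_mono) auto
    then show "ennreal (1 / K) \<le> (\<Sum>i. ennreal (hm_const s * (diameter (C i) / 2) powr s))"
      using K by (simp flip: mult.assoc ennreal_mult)
  qed
  also have "\<dots> \<le> hausdorff_measure s (flat_box k (\<lambda>_. 1) :: (real^'n) set)"
    unfolding hausdorff_measure_eq_SUP by (intro SUP_upper) auto
  finally show ?thesis using K unfolding s_def
    by (metis ennreal_less_zero_iff less_le_trans zero_less_divide_1_iff)
qed

section \<open>Orthonormal frames\<close>

definition frame :: "('n \<Rightarrow> real^'n) \<Rightarrow> bool" where
  "frame u \<longleftrightarrow> (\<forall>i j. u i \<bullet> u j = (if i = j then 1 else 0))"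

definition coord :: "('n \<Rightarrow> real^'n) \<Rightarrow> real^'n \<Rightarrow> real^'n" where
  "coord u x = (\<chi> i. x \<bullet> u i)"

definition of_coord :: "('n \<Rightarrow> real^'n) \<Rightarrow> real^'n \<Rightarrow> real^'n" where
  "of_coord u y = (\<Sum>i\<in>UNIV. y $ i *\<^sub>R u i)"

lemma frame_inner: "frame u \<Longrightarrow> u i \<bullet> u j = (if i = j then 1 else 0)"
  by (simp add: frame_def)

lemma of_coord_inner:
  fixes u :: "'n::finite \<Rightarrow> real^'n"
  assumes "frame u"
  shows "of_coord u y \<bullet> u i = y $ i"
proof -
  have "of_coord u y \<bullet> u i = (\<Sum>j\<in>UNIV. y $ j * (if j = i then 1 else 0))"
    by (simp add: of_coord_def inner_sum_left frame_inner[OF assms])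
  then show ?thesis by (simp add: if_distrib cong: if_cong)
qed

text \<open>An orthonormal family indexed by all of \<open>'n\<close> is complete: for the square
  matrix with these rows, a right inverse is also a left inverse.\<close>

lemma of_coord_coord:
  fixes u :: "'n::finite \<Rightarrow> real^'n"
  assumes "frame u"
  shows "of_coord u (coord u x) = x"
proof -
  define U :: "real^'n^'n" where "U = (\<chi> i. u i)"
  have row: "row i U = u i" for i by (simp add: U_def row_def vec_eq_iff)
  have "orthogonal_matrix U"
    unfolding orthogonal_matrix_orthonormal_rows
    by (simp add: row norm_eq_1 orthogonal_def frame_inner[OF assms])
  then have "Finite_Cartesian_Product.transpose U ** U = mat 1"
    by (simp add: orthogonal_matrix)
  then have "x = Finite_Cartesian_Product.transpose U *v (U *v x)"
    by (simp add: matrix_vector_mul_assoc)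
  also have "U *v x = coord u x"
    by (simp add: vec_eq_iff matrix_vector_mul_component coord_def U_def inner_commute)
  also have "Finite_Cartesian_Product.transpose U *v coord u x = of_coord u (coord u x)"
    by (simp add: matrix_mult_sum column_transpose row of_coord_def scalar_mult_eq_scaleR)
  finally show ?thesis by simp
qed

lemma coord_of_coord:
  fixes u :: "'n::finite \<Rightarrow> real^'n"
  assumes "frame u"
  shows "coord u (of_coord u y) = y"
  by (simp add: coord_def of_coord_inner[OF assms] vec_eq_iff)

lemma coord_diff: "coord u (x - y) = coord u x - coord u y"
  by (simp add: coord_def vec_eq_iff inner_diff_left)

lemma of_coord_diff: "of_coord u (x - y) = of_coord u x - of_coord u y"
  by (simp add: of_coord_def scaleR_diff_left sum_subtractf)

lemma norm_of_coord:
  fixes u :: "'n::finite \<Rightarrow> real^'n"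
  assumes "frame u"
  shows "norm (of_coord u y) = norm y"
proof -
  have "of_coord u y \<bullet> of_coord u y = (\<Sum>i\<in>UNIV. y $ i * (of_coord u y \<bullet> u i))"
    by (subst (2) of_coord_def) (simp add: inner_sum_right)
  also have "\<dots> = (\<Sum>i\<in>UNIV. y $ i * y $ i)" by (simp add: of_coord_inner[OF assms])
  also have "\<dots> = y \<bullet> y" by (simp add: inner_vec_def)
  finally show ?thesis by (simp add: norm_eq_sqrt_inner)
qed

lemma norm_coord:
  fixes u :: "'n::finite \<Rightarrow> real^'n"
  assumes "frame u"
  shows "norm (coord u x) = norm x"
  by (metis norm_of_coord of_coord_coord assms)

lemma frame_eqI:
  fixes u :: "'n::finite \<Rightarrow> real^'n"
  assumes "frame u" "\<And>i. x \<bullet> u i = y \<bullet> u i"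
  shows "x = y"
proof -
  have "coord u x = coord u y" by (simp add: coord_def assms(2))
  then show ?thesis by (metis of_coord_coord assms(1))
qed

lemma frame_norm: "frame u \<Longrightarrow> norm (u i) = 1"
  by (simp add: norm_eq_1 frame_inner)

lemma abs_inner_frame_le: "frame u \<Longrightarrow> \<bar>x \<bullet> u i\<bar> \<le> norm x"
  using Cauchy_Schwarz_ineq2[of x "u i"] by (simp add: frame_norm)

section \<open>Rotation invariance of Lebesgue measure\<close>

lemma coord_measurable [measurable]: "coord u \<in> borel_measurable borel"
  unfolding coord_def by (intro borel_measurable_continuous_onI continuous_intros)

lemma emeasure_coord_vimage_box:
  fixes u :: "'n::finite \<Rightarrow> real^'n"
  assumes u: "frame u"
  shows "emeasure lborel (coord u -` box p q) = emeasure lborel (coord u -` box 0 (q - p))"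
proof -
  let ?c = "- of_coord u p"
  have "(+) ?c -` (coord u -` box 0 (q - p)) = coord u -` box p q"
  proof (intro set_eqI)
    fix x
    show "x \<in> (+) ?c -` (coord u -` box 0 (q - p)) \<longleftrightarrow> x \<in> coord u -` box p q"
      by (simp add: mem_box_cart coord_diff coord_of_coord[OF u])
  qed
  moreover have "coord u -` box 0 (q - p) \<in> sets borel"
    using measurable_sets[OF coord_measurable[of u], of "box 0 (q - p)"] by simp
  ultimately have "emeasure (distr lborel borel ((+) ?c)) (coord u -` box 0 (q - p)) = emeasure lborel (coord u -` box p q)"
    by (subst emeasure_distr) auto
  then show ?thesis by (simp add: lborel_distr_plus)
qed

text \<open>The volume of the preimage of a box is additive in each side, hence a constant
  \<open>c\<close> times the product of the sides, and by uniqueness of Lebesgue measure the image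
  measure is a multiple of \<open>lborel\<close>. The unit ball is its own preimage and has finite
  positive volume, which forces the multiple to be 1.\<close>

lemma distr_coord_lborel:
  fixes u :: "'n::finite \<Rightarrow> real^'n"
  assumes u: "frame u"
  shows "distr lborel borel (coord u) = lborel"
proof -
  define f where "f l = emeasure lborel (coord u -` box 0 (\<chi> i. l i))" for l :: "'n \<Rightarrow> real"
  have meas: "coord u -` S \<in> sets borel" if "S \<in> sets borel" for S
    using measurable_sets[OF coord_measurable[of u], of S] that by simp
  have mb: "coord u -` box p q \<in> sets lborel" for p q using meas by simp
  have f_alt: "f l = emeasure lborel (coord u -` box p (p + (\<chi> i. l i)))" for l p
    unfolding f_def by (subst emeasure_coord_vimage_box[OF u, of p]) simp
  define c where "c = f (\<lambda>_. 1)"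
  have f_eq: "f l = ennreal (\<Prod>i\<in>UNIV. l i) * c" if "\<And>i. 0 < l i" for l
  proof -
    have "f l = ennreal (\<Prod>i\<in>UNIV. l i) * f (\<lambda>i. if i \<in> UNIV then 1 else l i)"
    proof (rule box_functional_eq_prod)
      fix l l' :: "'n \<Rightarrow> real" assume "\<And>i. l i \<le> l' i"
      then show "f l \<le> f l'"
        unfolding f_def by (intro emeasure_mono vimage_mono) (auto simp: mem_box_cart meas, meson less_le_trans)
    next
      fix i and l :: "'n \<Rightarrow> real" and x y e :: real
      assume l: "\<And>i. 0 < l i" and xy: "0 < x" "0 < y" "0 < e"
      let ?B = "\<lambda>z. box 0 (\<chi> j. (l(i := z)) j) :: (real^'n) set"
      let ?T = "\<lambda>s z. box (axis i s) (axis i s + (\<chi> j. (l(i := z)) j)) :: (real^'n) set"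
      have T: "emeasure lborel (coord u -` ?T s z) = f (l(i := z))" for s z
        by (rule f_alt[symmetric])
      \<comment> \<open>The boxes are open, so the first one is lengthened by \<open>e\<close> to
        catch the face where the coordinate equals \<open>x\<close>.\<close>
      have "?B (x + y) \<subseteq> ?B (x + e) \<union> ?T x y"
      proof
        fix p assume p: "p \<in> ?B (x + y)"
        show "p \<in> ?B (x + e) \<union> ?T x y"
        proof (cases "p $ i < x + e")
          case True
          then show ?thesis using p by (auto simp: mem_box_cart split: if_splits)
        next
          case False
          then have "x < p $ i" using xy by simp
          then show ?thesis using p by (auto simp: mem_box_cart axis_def split: if_splits)
        qed
      qed
      then have sub: "coord u -` ?B (x + y) \<subseteq> coord u -` ?B (x + e) \<union> coord u -` ?T x y" by blast
      have "f (l(i := x + y)) \<le> emeasure lborel (coord u -` ?B (x + e) \<union> coord u -` ?T x y)"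
        unfolding f_def by (rule emeasure_mono[OF sub]) (intro sets.Un mb)
      also have "\<dots> \<le> emeasure lborel (coord u -` ?B (x + e)) + emeasure lborel (coord u -` ?T x y)"
        by (intro emeasure_subadditive mb)
      finally show "f (l(i := x + y)) \<le> f (l(i := x + e)) + f (l(i := y))"
        unfolding T f_def .
      have "f (l(i := x)) + f (l(i := y)) = emeasure lborel (coord u -` ?B x) + emeasure lborel (coord u -` ?T x y)"
        unfolding T f_def ..
      also have "\<dots> = emeasure lborel (coord u -` ?B x \<union> coord u -` ?T x y)"
      proof (rule plus_emeasure)
        have "p $ i < x" if "p \<in> ?B x" for p using that by (simp add: mem_box_cart) (metis less_irrefl)
        moreover have "x < p $ i" if "p \<in> ?T x y" for p
          using that by (auto simp: mem_box_cart axis_def dest: spec[of _ i])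
        ultimately show "coord u -` ?B x \<inter> coord u -` ?T x y = {}" by force
      qed (rule mb)+
      also have "\<dots> \<le> f (l(i := x + y + e))"
        unfolding f_def
      proof (intro emeasure_mono)
        have "?B x \<union> ?T x y \<subseteq> ?B (x + y + e)"
        proof
          fix p assume "p \<in> ?B x \<union> ?T x y"
          then have "0 < p $ j \<and> p $ j < (if j = i then x + y + e else l j)" for j
            using xy l[of j] by (cases "j = i") (auto simp: mem_box_cart axis_def dest: spec[of _ j])
          then show "p \<in> ?B (x + y + e)" by (auto simp: mem_box_cart)
        qed
        then show "coord u -` ?B x \<union> coord u -` ?T x y \<subseteq> coord u -` ?B (x + y + e)" by blast
      qed (rule mb)
      finally show "f (l(i := x)) + f (l(i := y)) \<le> f (l(i := x + y + e))" .
    qed (use that in auto)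
    then show ?thesis by (simp add: c_def)
  qed
  have ball: "coord u -` ball 0 1 = ball 0 1" by (auto simp: norm_coord[OF u])
  have ball_sub: "ball 0 1 \<subseteq> box (- (\<chi> i. 1)) (- (\<chi> i. 1) + (\<chi> i. 2) :: real^'n)"
  proof
    fix x :: "real^'n" assume "x \<in> ball 0 1"
    then have "\<bar>x $ i\<bar> < 1" for i using component_le_norm_cart[of x i] by (simp add: le_less_trans)
    then show "x \<in> box (- (\<chi> i. 1)) (- (\<chi> i. 1) + (\<chi> i. 2))"
      by (auto simp: mem_box_cart abs_less_iff)
  qed
  have pos: "0 < emeasure lborel (ball 0 1 :: (real^'n) set)"
    using content_ball_pos[of 1 "0 :: real^'n"] by (simp add: measure_def zero_less_measure_iff enn2real_positive_iff)
  have "0 < c"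
  proof (rule ccontr)
    assume "\<not> 0 < c"
    then have "c = 0" by simp
    then have "f (\<lambda>_. 2) = 0" using f_eq[of "\<lambda>_. 2"] by simp
    moreover have "emeasure lborel (ball 0 1 :: (real^'n) set) \<le> f (\<lambda>_. 2)"
      unfolding f_alt[of "\<lambda>_. 2" "- (\<chi> i. 1)"] using ball ball_sub
      by (intro emeasure_mono) (auto simp: meas)
    ultimately show False using pos by simp
  qed
  have "c < \<top>"
  proof -
    have "coord u -` box 0 (\<chi> i. 1) \<subseteq> cball 0 (real CARD('n))"
    proof
      fix x assume "x \<in> coord u -` box 0 (\<chi> i. 1)"
      then have "\<bar>coord u x $ i\<bar> \<le> 1" for i by (auto simp: mem_box_cart abs_le_iff less_imp_le intro: order_trans[of _ 0])
      then have "(\<Sum>i\<in>UNIV. \<bar>coord u x $ i\<bar>) \<le> (\<Sum>i\<in>(UNIV::'n set). 1)" by (intro sum_mono)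
      then have "norm (coord u x) \<le> real CARD('n)" using norm_le_l1_cart[of "coord u x"] by simp
      then show "x \<in> cball 0 (real CARD('n))" by (simp add: norm_coord[OF u])
    qed
    then have "c \<le> emeasure lborel (cball 0 (real CARD('n)) :: (real^'n) set)"
      unfolding c_def f_def by (rule emeasure_mono) simp
    also have "\<dots> < \<top>" using emeasure_lborel_cball_finite by auto
    finally show ?thesis .
  qed
  then obtain r where r: "c = ennreal r" "0 < r"
    using \<open>0 < c\<close> by (cases c) auto
  \<comment> \<open>Agreement on boxes characterises \<open>lborel\<close>. Boxes with a side of
    length 0 are treated apart, because \<open>f_eq\<close> concerns positive sides.\<close>
  have lb: "lborel = scale_measure (ennreal (1 / r)) (distr lborel borel (coord u))"
  proof (rule lborel_eqI)
    fix p q :: "real^'n" assume le: "\<And>b. b \<in> Basis \<Longrightarrow> p \<bullet> b \<le> q \<bullet> b"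
    have pq: "p $ i \<le> q $ i" for i
      using le[of "axis i 1"] by (auto simp: Basis_vec_def inner_axis)
    have prod: "(\<Prod>b\<in>Basis. (q - p) \<bullet> b) = (\<Prod>i\<in>UNIV. (q - p) $ i)"
    proof -
      have "measure lborel (cbox p q) = (\<Prod>b\<in>Basis. q \<bullet> b - p \<bullet> b)"
        using pq by (intro content_cbox) (auto simp: Basis_vec_def inner_axis)
      moreover have "measure lborel (cbox p q) = (\<Prod>i\<in>UNIV. q $ i - p $ i)"
        using pq by (intro content_cbox_cart) (auto simp: interval_ne_empty_cart)
      ultimately show ?thesis by (simp add: inner_diff_left)
    qed
    have "emeasure lborel (coord u -` box p q) = ennreal (\<Prod>i\<in>UNIV. (q - p) $ i) * c"
    proof (cases "\<forall>i. p $ i < q $ i")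
      case True
      then have "f (($) (q - p)) = ennreal (\<Prod>i\<in>UNIV. (q - p) $ i) * c" by (intro f_eq) simp
      moreover have "(\<chi> i. (q - p) $ i) = q - p" by (simp add: vec_eq_iff)
      ultimately show ?thesis using emeasure_coord_vimage_box[OF u, of p q] unfolding f_def by metis
    next
      case False
      then obtain i where i: "p $ i = q $ i" using pq by (metis order_le_less)
      then have "box p q = {}" by (auto simp: interval_eq_empty_cart intro!: exI[of _ i])
      moreover have "(\<Prod>i\<in>UNIV. (q - p) $ i) = 0" using i by (intro prod_zero bexI[of _ i]) auto
      ultimately show ?thesis by (simp only: vimage_empty emeasure_empty ennreal_0 mult_zero_left)
    qed
    moreover have "ennreal (1 / r) * (z * c) = z" for z
      using r by (simp add: mult.commute[of z] flip: mult.assoc ennreal_mult)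
    ultimately show "emeasure (scale_measure (ennreal (1 / r)) (distr lborel borel (coord u))) (box p q)
        = (\<Prod>b\<in>Basis. (q - p) \<bullet> b)"
      by (simp add: emeasure_distr prod)
  qed simp
  have "emeasure lborel (ball 0 1 :: (real^'n) set) = ennreal (1 / r) * emeasure lborel (coord u -` ball 0 1)"
    by (subst (1) lb) (simp add: emeasure_distr)
  then have *: "emeasure lborel (ball 0 1 :: (real^'n) set) = ennreal (1 / r) * emeasure lborel (ball 0 1 :: (real^'n) set)"
    by (simp add: ball)
  have "1 / r = 1"
  proof -
    have "emeasure lborel (ball 0 1 :: (real^'n) set) < \<infinity>" by (rule emeasure_lborel_ball_finite)
    then obtain b where b: "emeasure lborel (ball 0 1 :: (real^'n) set) = ennreal b" "0 < b"
      using pos by (cases "emeasure lborel (ball 0 1 :: (real^'n) set)") auto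
    then have "ennreal b = ennreal (1 / r * b)" using * r by (simp flip: ennreal_mult)
    then have "b = 1 / r * b" using b r by (subst (asm) ennreal_inj) auto
    then show ?thesis using b r by (simp add: field_simps)
  qed
  then show ?thesis
    using lb by simp
qed

definition frame_box :: "('n \<Rightarrow> real^'n) \<Rightarrow> ('n \<Rightarrow> real) \<Rightarrow> ('n \<Rightarrow> real) \<Rightarrow> (real^'n) set" where
  "frame_box u a b = {x. \<forall>i. a i \<le> x \<bullet> u i \<and> x \<bullet> u i \<le> b i}"

lemma frame_box_vimage: "frame_box u a b = coord u -` cbox (\<chi> i. a i) (\<chi> i. b i)"
  by (auto simp: frame_box_def coord_def mem_box_cart)

lemma frame_box_sets [measurable]: "frame_box u a b \<in> sets borel"
  unfolding frame_box_vimage using measurable_sets[OF coord_measurable[of u], of "cbox (\<chi> i. a i) (\<chi> i. b i)"] by simp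

lemma emeasure_frame_box:
  fixes u :: "'n::finite \<Rightarrow> real^'n"
  assumes u: "frame u" and ab: "\<And>i. a i \<le> b i"
  shows "emeasure lborel (frame_box u a b) = ennreal (\<Prod>i\<in>UNIV. b i - a i)"
proof -
  have "emeasure lborel (frame_box u a b) = emeasure (distr lborel borel (coord u)) (cbox (\<chi> i. a i) (\<chi> i. b i))"
    by (subst emeasure_distr) (auto simp: frame_box_vimage)
  also have "\<dots> = ennreal (measure lborel (cbox (\<chi> i. a i) (\<chi> i. b i)))"
    by (simp add: distr_coord_lborel[OF u] emeasure_lborel_cbox_measure)
  also have "measure lborel (cbox (\<chi> i. a i) (\<chi> i. b i)) = (\<Prod>i\<in>UNIV. (\<chi> i. b i) $ i - (\<chi> i. a i) $ i)"
    using ab by (intro content_cbox_cart) (auto simp: interval_ne_empty_cart)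
  finally show ?thesis by simp
qed

lemma closed_frame_box: "closed (frame_box u a b)"
proof -
  have "frame_box u a b = (\<Inter>i. {x. a i \<le> u i \<bullet> x} \<inter> {x. u i \<bullet> x \<le> b i})"
    by (auto simp: frame_box_def inner_commute)
  then show ?thesis by (auto intro!: closed_INT closed_Int closed_halfspace_le closed_halfspace_ge)
qed

lemma convex_frame_box: "convex (frame_box u a b)"
proof -
  have "frame_box u a b = (\<Inter>i. {x. a i \<le> u i \<bullet> x} \<inter> {x. u i \<bullet> x \<le> b i})"
    by (auto simp: frame_box_def inner_commute)
  then show ?thesis by (auto intro!: convex_INT convex_Int convex_halfspace_le convex_halfspace_ge)
qed

lemma bounded_frame_box:
  fixes u :: "'n::finite \<Rightarrow> real^'n"
  assumes u: "frame u"
  shows "bounded (frame_box u a b)"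
proof -
  have "norm x \<le> (\<Sum>i\<in>UNIV. \<bar>a i\<bar> + \<bar>b i\<bar>)" if "x \<in> frame_box u a b" for x
  proof -
    have "norm x = norm (coord u x)" by (simp add: norm_coord[OF u])
    also have "\<dots> \<le> (\<Sum>i\<in>UNIV. \<bar>coord u x $ i\<bar>)" by (rule norm_le_l1_cart)
    also have "\<dots> \<le> (\<Sum>i\<in>UNIV. \<bar>a i\<bar> + \<bar>b i\<bar>)"
    proof (rule sum_mono)
      fix i
      have "a i \<le> x \<bullet> u i" "x \<bullet> u i \<le> b i" using that by (auto simp: frame_box_def)
      then show "\<bar>coord u x $ i\<bar> \<le> \<bar>a i\<bar> + \<bar>b i\<bar>" by (simp add: coord_def)
    qed
    finally show ?thesis .
  qed
  then show ?thesis unfolding bounded_iff by blast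
qed

section \<open>Hyperrectangles and their cylinders in frame coordinates\<close>

definition rect :: "('n \<Rightarrow> real^'n) \<Rightarrow> 'n \<Rightarrow> ('n \<Rightarrow> real) \<Rightarrow> ('n \<Rightarrow> real) \<Rightarrow> (real^'n) set" where
  "rect u k a l = {x. x \<bullet> u k = a k \<and> (\<forall>i. i \<noteq> k \<longrightarrow> a i \<le> x \<bullet> u i \<and> x \<bullet> u i \<le> a i + l i)}"

definition rect_cyl :: "('n \<Rightarrow> real^'n) \<Rightarrow> 'n \<Rightarrow> ('n \<Rightarrow> real) \<Rightarrow> ('n \<Rightarrow> real) \<Rightarrow> real \<Rightarrow> (real^'n) set" where
  "rect_cyl u k a l h = {x. \<bar>x \<bullet> u k - a k\<bar> \<le> h \<and> (\<forall>i. i \<noteq> k \<longrightarrow> a i \<le> x \<bullet> u i \<and> x \<bullet> u i \<le> a i + l i)}"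

lemma rect_cyl_frame_box:
  "rect_cyl u k a l h = frame_box u (a(k := a k - h)) (\<lambda>i. if i = k then a k + h else a i + l i)"
proof (intro set_eqI)
  fix x
  have "x \<in> frame_box u (a(k := a k - h)) (\<lambda>i. if i = k then a k + h else a i + l i) \<longleftrightarrow>
      (\<forall>i. if i = k then \<bar>x \<bullet> u k - a k\<bar> \<le> h else a i \<le> x \<bullet> u i \<and> x \<bullet> u i \<le> a i + l i)"
    unfolding frame_box_def mem_Collect_eq by (intro iff_allI) (auto simp: abs_le_iff)
  then show "x \<in> rect_cyl u k a l h \<longleftrightarrow>
      x \<in> frame_box u (a(k := a k - h)) (\<lambda>i. if i = k then a k + h else a i + l i)"
    by (auto simp: rect_cyl_def)
qed

lemma frame_ortho_offset:
  fixes u :: "'n::finite \<Rightarrow> real^'n"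
  assumes u: "frame u"
  shows "(c + (\<Sum>i\<in>S. s i *\<^sub>R u i)) \<bullet> u j = c \<bullet> u j + (if j \<in> S then s j else 0)"
proof -
  have "(\<Sum>i\<in>S. s i *\<^sub>R u i) \<bullet> u j = (\<Sum>i\<in>S. s i * (if i = j then 1 else 0))"
    by (simp add: inner_sum_left frame_inner[OF u])
  also have "\<dots> = (if j \<in> S then s j else 0)" by (simp add: if_distrib cong: if_cong)
  finally show ?thesis by (simp add: inner_add_left)
qed

text \<open>A hyperrectangle comes with a frame whose normal has an arbitrary index
  \<open>k0\<close> and either sign. Here the normal is moved to a prescribed index \<open>k\<close>
  and made equal to \<open>v\<close>, so that frames of different rectangles with the same normal
  can be compared.\<close>

lemma nd_hyperrect_rect:
  fixes v :: "real^'n" and k :: 'n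
  assumes A: "nd_hyperrect A" and v: "unit_normal A v"
  obtains u a l where "frame u" "u k = v" "\<And>i. 0 < l i" "A = rect u k a l"
proof -
  obtain c and u0 :: "'n \<Rightarrow> real^'n" and k0 l0 where u0: "\<forall>i j. u0 i \<bullet> u0 j = (if i = j then 1 else 0)"
    and l0': "\<forall>i. i \<noteq> k0 \<longrightarrow> 0 < (l0 i :: real)"
    and A_eq: "A = {c + (\<Sum>i\<in>UNIV - {k0}. s i *\<^sub>R u0 i) | s. \<forall>i. i \<noteq> k0 \<longrightarrow> 0 \<le> s i \<and> s i \<le> l0 i}"
    using A unfolding nd_hyperrect_def by blast
  from l0' have l0: "0 < l0 i" if "i \<noteq> k0" for i using that by blast
  have f0: "frame u0" using u0 by (simp add: frame_def)
  have perp: "v \<bullet> u0 i = 0" if "i \<noteq> k0" for i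
  proof -
    have "c \<in> A" unfolding A_eq
      using l0 by (auto intro!: exI[of _ "\<lambda>_. 0"] less_imp_le)
    moreover have "c + l0 i *\<^sub>R u0 i \<in> A" unfolding A_eq
    proof (intro CollectI exI[of _ "\<lambda>j. if j = i then l0 i else 0"] conjI allI impI)
      have "(\<Sum>j\<in>UNIV - {k0}. (if j = i then l0 i else 0) *\<^sub>R u0 j) = (\<Sum>j\<in>UNIV - {k0}. if j = i then l0 i *\<^sub>R u0 i else 0)"
        by (intro sum.cong) auto
      then show "c + l0 i *\<^sub>R u0 i = c + (\<Sum>j\<in>UNIV - {k0}. (if j = i then l0 i else 0) *\<^sub>R u0 j)"
        using that by simp
    qed (use l0 in \<open>auto intro: less_imp_le\<close>)
    ultimately have "(c + l0 i *\<^sub>R u0 i - c) \<bullet> v = 0" using v unfolding unit_normal_def by blast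
    then have "l0 i * (u0 i \<bullet> v) = 0" by simp
    then show ?thesis using l0[OF that] by (simp add: inner_commute)
  qed
  have v_eq: "v = (v \<bullet> u0 k0) *\<^sub>R u0 k0"
    by (rule frame_eqI[OF f0]) (auto simp: frame_inner[OF f0] perp)
  have sq: "(v \<bullet> u0 k0)\<^sup>2 = 1"
  proof -
    have "1 = norm v" using v by (simp add: unit_normal_def)
    also have "\<dots> = \<bar>v \<bullet> u0 k0\<bar>" by (subst v_eq) (simp add: frame_norm[OF f0])
    finally show ?thesis by (metis one_power2 power2_abs)
  qed
  have vv: "v \<bullet> v = 1" using v by (simp add: unit_normal_def norm_eq_1)
  \<comment> \<open>The transposition of \<open>k\<close> and \<open>k0\<close>. No sign has to be
    tracked, as \<open>v\<close> itself replaces the old normal vector.\<close>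
  define \<sigma> where "\<sigma> i = (if i = k then k0 else if i = k0 then k else i)" for i
  have \<sigma>: "\<sigma> (\<sigma> i) = i" "\<sigma> i = k0 \<longleftrightarrow> i = k" "\<sigma> k = k0" for i by (auto simp: \<sigma>_def)
  have \<sigma>_inj: "\<sigma> i = \<sigma> j \<longleftrightarrow> i = j" for i j by (metis \<sigma>(1))
  define u where "u i = (if i = k then v else u0 (\<sigma> i))" for i
  have u: "frame u"
    unfolding frame_def
  proof (intro allI)
    fix i j show "u i \<bullet> u j = (if i = j then 1 else 0)"
      using vv perp[of "\<sigma> i"] perp[of "\<sigma> j"] \<sigma>(2)[of i] \<sigma>(2)[of j]
      by (auto simp: u_def frame_inner[OF f0] \<sigma>_inj inner_commute)
  qed
  define a where "a i = c \<bullet> u i" for i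
  \<comment> \<open>The rectangle has no side in the direction \<open>k\<close>; the value 1 there
    lets positivity be stated for all indices.\<close>
  define l where "l i = (if i = k then 1 else l0 (\<sigma> i))" for i
  have l: "0 < l i" for i using l0 \<sigma>(2) by (auto simp: l_def)
  have "A = rect u k a l"
  proof (intro set_eqI iffI)
    fix x assume "x \<in> A"
    then obtain s where s: "\<And>i. i \<noteq> k0 \<Longrightarrow> 0 \<le> s i \<and> s i \<le> l0 i"
      and x: "x = c + (\<Sum>i\<in>UNIV - {k0}. s i *\<^sub>R u0 i)" unfolding A_eq by auto
    have "x \<bullet> v = c \<bullet> v"
    proof -
      have "(\<Sum>i\<in>UNIV - {k0}. s i *\<^sub>R u0 i) \<bullet> v = 0"
        unfolding inner_sum_left by (intro sum.neutral) (auto simp: perp inner_commute)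
      then show ?thesis by (simp add: x inner_add_left)
    qed
    moreover have "a i \<le> x \<bullet> u i \<and> x \<bullet> u i \<le> a i + l i" if "i \<noteq> k" for i
      using that s[of "\<sigma> i"] \<sigma>(2)[of i] by (simp add: x u_def a_def l_def frame_ortho_offset[OF f0])
    ultimately show "x \<in> rect u k a l" by (simp add: rect_def a_def u_def)
  next
    fix x assume x: "x \<in> rect u k a l"
    define s where "s i = (x - c) \<bullet> u0 i" for i
    have "0 \<le> s i \<and> s i \<le> l0 i" if "i \<noteq> k0" for i
    proof -
      have "\<sigma> i \<noteq> k" "u (\<sigma> i) = u0 i" "l (\<sigma> i) = l0 i" using that \<sigma> by (auto simp: u_def l_def) metis+
      then have "a (\<sigma> i) \<le> x \<bullet> u0 i" "x \<bullet> u0 i \<le> a (\<sigma> i) + l0 i" "a (\<sigma> i) = c \<bullet> u0 i"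
        using x unfolding rect_def a_def by force+
      then show ?thesis by (simp add: s_def inner_diff_left)
    qed
    moreover have "x = c + (\<Sum>i\<in>UNIV - {k0}. s i *\<^sub>R u0 i)"
    proof (rule frame_eqI[OF f0])
      fix i
      have "x \<bullet> v = c \<bullet> v" using x by (simp add: rect_def a_def u_def)
      then have "(v \<bullet> u0 k0) * (x \<bullet> u0 k0) = (v \<bullet> u0 k0) * (c \<bullet> u0 k0)"
        by (metis v_eq inner_scaleR_right)
      then have "x \<bullet> u0 k0 = c \<bullet> u0 k0" using sq by auto
      then show "x \<bullet> u0 i = (c + (\<Sum>i\<in>UNIV - {k0}. s i *\<^sub>R u0 i)) \<bullet> u0 i"
        by (simp add: frame_ortho_offset[OF f0] s_def inner_diff_left)
    qed
    ultimately show "x \<in> A" unfolding A_eq by blast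
  qed
  moreover have "u k = v" by (simp add: u_def)
  ultimately show thesis using that u l by blast
qed

lemma rect_scaleR:
  assumes "0 < n"
  shows "(\<lambda>x. n *\<^sub>R x) ` rect u k a l = rect u k (\<lambda>i. n * a i) (\<lambda>i. n * l i)"
proof (intro set_eqI iffI)
  fix x assume "x \<in> rect u k (\<lambda>i. n * a i) (\<lambda>i. n * l i)"
  then have "(1 / n) *\<^sub>R x \<in> rect u k a l"
    using assms by (simp add: rect_def field_simps)
  moreover have "x = n *\<^sub>R ((1 / n) *\<^sub>R x)" using assms by simp
  ultimately show "x \<in> (\<lambda>x. n *\<^sub>R x) ` rect u k a l" by blast
qed (use assms in \<open>auto simp: rect_def simp flip: distrib_left\<close>)

lemma cyl_rect:
  fixes u :: "'n::finite \<Rightarrow> real^'n"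
  assumes u: "frame u"
  shows "cyl (rect u k a l) h (u k) = rect_cyl u k a l h"
proof (intro set_eqI iffI)
  fix x assume "x \<in> cyl (rect u k a l) h (u k)"
  then show "x \<in> rect_cyl u k a l h"
    by (auto simp: cyl_def rect_def rect_cyl_def inner_add_left frame_inner[OF u])
next
  fix x assume x: "x \<in> rect_cyl u k a l h"
  define s where "s = x \<bullet> u k - a k"
  have "x - s *\<^sub>R u k \<in> rect u k a l"
    using x by (auto simp: s_def rect_cyl_def rect_def inner_diff_left frame_inner[OF u])
  moreover have "- h \<le> s" "s \<le> h" using x by (auto simp: s_def rect_cyl_def)
  moreover have "x = (x - s *\<^sub>R u k) + s *\<^sub>R u k" by simp
  ultimately show "x \<in> cyl (rect u k a l) h (u k)" unfolding cyl_def by blast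
qed

lemma hausdorff_measure_rect:
  fixes u :: "'n::finite \<Rightarrow> real^'n"
  assumes u: "frame u"
  shows "hausdorff_measure s (rect u k a l) = hausdorff_measure s (flat_box k l)"
proof (rule antisym)
  let ?f = "\<lambda>y. of_coord u y + of_coord u (\<chi> i. a i)"
  have co: "?f y \<bullet> u i = y $ i + a i" for y i by (simp add: inner_add_left of_coord_inner[OF u])
  have sub: "rect u k a l \<subseteq> ?f ` flat_box k l"
  proof
    fix x assume x: "x \<in> rect u k a l"
    define y where "y = coord u x - (\<chi> i. a i)"
    have "x = ?f y" by (rule frame_eqI[OF u]) (simp add: co[unfolded inner_add_left] y_def coord_def inner_add_left of_coord_inner[OF u])
    moreover have "y \<in> flat_box k l" using x by (auto simp: y_def coord_def flat_box_def rect_def)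
    ultimately show "x \<in> ?f ` flat_box k l" by blast
  qed
  have iso: "dist (?f x) (?f y) = dist x y" for x y
    by (simp add: dist_norm norm_of_coord[OF u] flip: of_coord_diff)
  show "hausdorff_measure s (rect u k a l) \<le> hausdorff_measure s (flat_box k l)"
    using hausdorff_measure_mono[OF sub] hausdorff_measure_isometry_le[of ?f, OF iso] order_trans by blast
  let ?g = "\<lambda>x. coord u x - (\<chi> i. a i)"
  have sub: "flat_box k l \<subseteq> ?g ` rect u k a l"
  proof
    fix y assume y: "y \<in> flat_box k l"
    have "y = ?g (?f y)" by (simp add: vec_eq_iff coord_def co)
    moreover have "?f y \<in> rect u k a l" using y by (auto simp: rect_def co flat_box_def)
    ultimately show "y \<in> ?g ` rect u k a l" by blast
  qed
  have iso: "dist (?g x) (?g y) = dist x y" for x y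
    by (simp add: dist_norm norm_coord[OF u] flip: coord_diff)
  show "hausdorff_measure s (flat_box k l) \<le> hausdorff_measure s (rect u k a l)"
    using hausdorff_measure_mono[OF sub] hausdorff_measure_isometry_le[of ?g, OF iso] order_trans by blast
qed

text \<open>By the isodiametric inequality this constant is 1, but only its positivity and its
  independence of the box matter: it cancels between area and nu.\<close>

definition hausdorff_ratio :: "'n::finite \<Rightarrow> real" where
  "hausdorff_ratio k = enn2real (hausdorff_measure (real CARD('n) - 1) (flat_box k (\<lambda>_. 1) :: (real^'n) set))"

lemma hausdorff_ratio_pos:
  assumes "2 \<le> CARD('n::finite)"
  shows "0 < hausdorff_ratio (k :: 'n)"
  unfolding hausdorff_ratio_def enn2real_positive_iff
  using hausdorff_measure_flat_box_finite[OF assms] hausdorff_measure_flat_box_pos[OF assms] by auto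

abbreviation face_vol :: "'n::finite \<Rightarrow> ('n \<Rightarrow> real) \<Rightarrow> real" where
  "face_vol k l \<equiv> (\<Prod>i\<in>UNIV - {k}. l i)"

lemma area_rect:
  fixes u :: "'n::finite \<Rightarrow> real^'n"
  assumes u: "frame u" and d: "2 \<le> CARD('n)" and l: "\<And>i. 0 < l i" and n: "0 < n"
  shows "area (rect u k a l) n = hausdorff_ratio k * face_vol k (\<lambda>i. real n * l i)"
proof -
  have "hausdorff_measure (real CARD('n) - 1) ((\<lambda>x. real n *\<^sub>R x) ` rect u k a l)
     = ennreal (face_vol k (\<lambda>i. real n * l i)) * hausdorff_measure (real CARD('n) - 1) (flat_box k (\<lambda>_. 1) :: (real^'n) set)"
    using n l d by (subst rect_scaleR) (auto simp: hausdorff_measure_rect[OF u] intro!: hausdorff_measure_flat_box)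
  moreover have "0 \<le> face_vol k (\<lambda>i. real n * l i)" using l by (intro prod_nonneg) (auto intro!: mult_nonneg_nonneg intro: less_imp_le)
  ultimately show ?thesis
    by (simp add: area_def hausdorff_ratio_def enn2real_mult)
qed

subsection \<open>The two components of a cut cylinder\<close>

text \<open>The sources of tau live on components picked by SOME. Describing them by the side of the
  level \<open>c\<close> fixes the choice.\<close>

definition bd_above :: "(real^'n) set \<Rightarrow> real^'n \<Rightarrow> real \<Rightarrow> (real^'n) set" where
  "bd_above K v c = {x \<in> K \<inter> Zd. c < x \<bullet> v \<and> (\<exists>y. {x, y} \<in> Ed \<and> y \<notin> K)}"

definition bd_below :: "(real^'n) set \<Rightarrow> real^'n \<Rightarrow> real \<Rightarrow> (real^'n) set" where
  "bd_below K v c = {x \<in> K \<inter> Zd. x \<bullet> v < c \<and> (\<exists>y. {x, y} \<in> Ed \<and> y \<notin> K)}"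

lemma path_avoiding_commute:
  fixes C :: "(real^'n) set"
  shows "path_avoiding C E F1 F2 = path_avoiding C E F2 F1"
proof -
  have "path_avoiding C E F2 F1" if path: "path_avoiding C E F1 F2" for F1 F2 :: "(real^'n) set"
  proof -
    let ?R = "{(x, y). {x, y} \<in> edges_in C - E}"
    obtain a b where "a \<in> F1" "b \<in> F2" "(a, b) \<in> ?R\<^sup>*"
      using path unfolding path_avoiding_def by blast
    moreover have "?R\<inverse> = ?R" by (auto simp: insert_commute)
    ultimately have "(b, a) \<in> ?R\<^sup>*" by (metis rtrancl_converseI)
    then show ?thesis unfolding path_avoiding_def using \<open>a \<in> F1\<close> \<open>b \<in> F2\<close> by blast
  qed
  then show ?thesis by blast
qed

text \<open>This absorbs the unspecified order of the two components in tau, and it turns phi, which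
  runs from bottom to top, into a flow whose first set lies above.\<close>

lemma maxflow_commute: "maxflow t F1 F2 C = maxflow t F2 F1 C"
  unfolding maxflow_def by (simp add: path_avoiding_commute[of C _ F1 F2])

text \<open>Both halves are convex, hence connected. A connected set that avoids the level
  \<open>c\<close> lies on one side of it, since the values of a linear form on it fill an
  interval.\<close>

lemma components_halves:
  fixes K :: "(real^'n) set"
  assumes K: "convex K" and ne: "{x \<in> K. c < x \<bullet> v} \<noteq> {}" "{x \<in> K. x \<bullet> v < c} \<noteq> {}"
  shows "components {x \<in> K. x \<bullet> v \<noteq> c} = {{x \<in> K. c < x \<bullet> v}, {x \<in> K. x \<bullet> v < c}}"
proof -
  let ?P = "{x \<in> K. c < x \<bullet> v}" and ?N = "{x \<in> K. x \<bullet> v < c}" and ?S = "{x \<in> K. x \<bullet> v \<noteq> c}"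
  have conn: "D \<subseteq> ?P \<or> D \<subseteq> ?N" if D: "connected D" "D \<subseteq> ?S" for D
  proof (rule ccontr)
    assume "\<not> ?thesis"
    then obtain x y where xy: "x \<in> D" "\<not> c < x \<bullet> v" "y \<in> D" "\<not> y \<bullet> v < c" using D(2) by blast
    have "connected ((\<lambda>x. x \<bullet> v) ` D)"
      using D(1) by (intro connected_continuous_image continuous_intros)
    then have "c \<in> (\<lambda>x. x \<bullet> v) ` D"
      using xy unfolding connected_iff_interval by (metis imageI linorder_not_less)
    then show False using D(2) by auto
  qed
  have cP: "connected ?P"
  proof -
    have "?P = K \<inter> {x. v \<bullet> x > c}" by (auto simp: inner_commute)
    then show ?thesis using K by (auto intro!: convex_connected convex_Int convex_halfspace_gt)
  qed
  have cN: "connected ?N"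
  proof -
    have "?N = K \<inter> {x. v \<bullet> x < c}" by (auto simp: inner_commute)
    then show ?thesis using K by (auto intro!: convex_connected convex_Int convex_halfspace_lt)
  qed
  show ?thesis
  proof (intro set_eqI iffI)
    fix C assume "C \<in> components ?S"
    then have C: "C \<noteq> {}" "C \<subseteq> ?S" "connected C"
      and mx: "\<And>D. D \<noteq> {} \<Longrightarrow> C \<subseteq> D \<Longrightarrow> D \<subseteq> ?S \<Longrightarrow> connected D \<Longrightarrow> D = C"
      unfolding in_components_maximal by blast+
    from conn[OF C(3,2)] show "C \<in> {?P, ?N}"
      using mx[OF ne(1) _ _ cP] mx[OF ne(2) _ _ cN] by auto
  next
    fix C assume "C \<in> {?P, ?N}"
    then consider "C = ?P" | "C = ?N" by blast
    then show "C \<in> components ?S"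
    proof cases
      case 1
      have "D = ?P" if "D \<noteq> {}" "?P \<subseteq> D" "D \<subseteq> ?S" "connected D" for D
        using conn[OF that(4,3)] that ne(1) by (auto; fastforce)
      then show ?thesis unfolding in_components_maximal 1 using ne(1) cP by auto
    next
      case 2
      have "D = ?N" if "D \<noteq> {}" "?N \<subseteq> D" "D \<subseteq> ?S" "connected D" for D
        using conn[OF that(4,3)] that ne(2) by (auto; fastforce)
      then show ?thesis unfolding in_components_maximal 2 using ne(2) cN by auto
    qed
  qed
qed

lemma rect_cyl_halves_nonempty:
  fixes u :: "'n::finite \<Rightarrow> real^'n"
  assumes u: "frame u" and l: "\<And>i. 0 < l i" and h: "0 < h"
  shows "{x \<in> rect_cyl u k a l h. a k < x \<bullet> u k} \<noteq> {}" "{x \<in> rect_cyl u k a l h. x \<bullet> u k < a k} \<noteq> {}"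
proof -
  let ?p = "\<lambda>s. of_coord u (\<chi> i. if i = k then a k + s else a i)"
  have "?p h \<in> {x \<in> rect_cyl u k a l h. a k < x \<bullet> u k}"
    using h l by (auto simp: rect_cyl_def of_coord_inner[OF u] less_imp_le)
  then show "{x \<in> rect_cyl u k a l h. a k < x \<bullet> u k} \<noteq> {}" by blast
  have "?p (- h) \<in> {x \<in> rect_cyl u k a l h. x \<bullet> u k < a k}"
    using h l by (auto simp: rect_cyl_def of_coord_inner[OF u] less_imp_le)
  then show "{x \<in> rect_cyl u k a l h. x \<bullet> u k < a k} \<noteq> {}" by blast
qed

lemma tau_rect:
  fixes u :: "'n::finite \<Rightarrow> real^'n"
  assumes u: "frame u" and l: "\<And>i. 0 < l i" and h: "0 < h"
  shows "tau (rect u k a l) h (u k) t = maxflow t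
    (bd_above (rect_cyl u k a l h) (u k) (a k)) (bd_below (rect_cyl u k a l h) (u k) (a k)) (rect_cyl u k a l h)"
proof -
  let ?K = "rect_cyl u k a l h"
  let ?P = "{x \<in> ?K. a k < x \<bullet> u k}" and ?N = "{x \<in> ?K. x \<bullet> u k < a k}"
  have "affine hull (rect u k a l) \<subseteq> {x. u k \<bullet> x = a k}"
    by (intro hull_minimal affine_hyperplane) (auto simp: rect_def inner_commute)
  moreover have "x \<in> affine hull (rect u k a l)" if "x \<in> ?K" "x \<bullet> u k = a k" for x
    using that by (intro hull_inc) (auto simp: rect_def rect_cyl_def)
  ultimately have minus: "?K - affine hull (rect u k a l) = {x \<in> ?K. x \<bullet> u k \<noteq> a k}"
    by (auto simp: inner_commute)
  have conv: "convex ?K" unfolding rect_cyl_frame_box by (rule convex_frame_box)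
  have ne: "?P \<noteq> {}" "?N \<noteq> {}" by (rule rect_cyl_halves_nonempty[OF u l h])+
  have comp: "components (?K - affine hull (rect u k a l)) = {?P, ?N}"
    unfolding minus by (rule components_halves[OF conv ne])
  define C1 where "C1 = (SOME X. X \<in> {?P, ?N})"
  define C2 where "C2 = (SOME X. X \<in> {?P, ?N} \<and> X \<noteq> C1)"
  define bd where "bd X = {x \<in> X \<inter> Zd. \<exists>y. {x, y} \<in> Ed \<and> y \<notin> ?K}" for X
  have tau_eq: "tau (rect u k a l) h (u k) t = maxflow t (bd C1) (bd C2) ?K"
    unfolding tau_def Let_def cyl_rect[OF u] comp C1_def C2_def bd_def ..
  have bd: "bd ?P = bd_above ?K (u k) (a k)" "bd ?N = bd_below ?K (u k) (a k)"
    by (auto simp: bd_def bd_above_def bd_below_def)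
  have "?P \<noteq> ?N" using ne by force
  moreover have "C1 \<in> {?P, ?N}" unfolding C1_def by (rule someI[of _ ?P]) simp
  ultimately have "\<exists>X. X \<in> {?P, ?N} \<and> X \<noteq> C1" by auto
  then have "C2 \<in> {?P, ?N} \<and> C2 \<noteq> C1" unfolding C2_def by (rule someI_ex)
  \<comment> \<open>It is not determined which half SOME picks first; the symmetry of the flow makes
    both outcomes equal.\<close>
  then consider "C1 = ?P" "C2 = ?N" | "C1 = ?N" "C2 = ?P"
    using \<open>C1 \<in> {?P, ?N}\<close> by auto
  then show ?thesis
    unfolding tau_eq by cases (simp_all only: bd maxflow_commute)
qed

section \<open>Edges and cuts\<close>

lemma Ed_iff: "{x, y} \<in> Ed \<longleftrightarrow> x \<in> Zd \<and> y \<in> Zd \<and> dist x y = 1"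
  unfolding Ed_def by (auto simp: doubleton_eq_iff dist_commute)

lemma EdE:
  assumes "e \<in> Ed"
  obtains x y where "e = {x, y}" "x \<in> Zd" "y \<in> Zd" "dist x y = 1"
  using assms unfolding Ed_def by blast

text \<open>Closedness recovers the endpoints from the open segment, and convexity gives the segment
  back from its endpoints. Afterwards an edge is treated as a two-point set of vertices.\<close>

lemma edges_in_eq:
  fixes K :: "(real^'n) set"
  assumes K: "closed K" "convex K"
  shows "edges_in K = {e \<in> Ed. e \<subseteq> K}"
proof (intro set_eqI iffI)
  fix e assume "e \<in> edges_in K"
  then obtain x y where e: "e \<in> Ed" "e = {x, y}" "open_segment x y \<subseteq> K"
    unfolding edges_in_def by blast
  then have "x \<noteq> y" by (auto simp: Ed_iff)
  then have "closed_segment x y \<subseteq> K"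
    using closure_mono[OF e(3)] K(1) by (simp add: closure_closed)
  then show "e \<in> {e \<in> Ed. e \<subseteq> K}" using e by auto
next
  fix e assume e: "e \<in> {e \<in> Ed. e \<subseteq> K}"
  then obtain x y where "e = {x, y}" by (auto elim: EdE)
  moreover have "open_segment x y \<subseteq> K"
    using e K(2) \<open>e = {x, y}\<close> by (metis (no_types, lifting) closed_segment_subset insert_subset mem_Collect_eq order_trans segment_open_subset_closed)
  ultimately show "e \<in> edges_in K" using e unfolding edges_in_def by blast
qed

lemma Zd_diff: "x \<in> Zd \<Longrightarrow> y \<in> Zd \<Longrightarrow> x - y \<in> Zd"
  and Zd_add: "x \<in> Zd \<Longrightarrow> y \<in> Zd \<Longrightarrow> x + y \<in> Zd"
  by (auto simp: Zd_def)

lemma finite_Zd_bounded: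
  fixes S :: "(real^'n) set"
  assumes "bounded S"
  shows "finite (S \<inter> Zd)"
proof -
  obtain B where B: "\<And>x. x \<in> S \<Longrightarrow> norm x \<le> B" using assms unfolding bounded_iff by blast
  have "S \<inter> Zd \<subseteq> (\<lambda>f. \<chi> i. of_int (f i)) ` (UNIV \<rightarrow>\<^sub>E {-\<lceil>B\<rceil>..\<lceil>B\<rceil>})"
  proof
    fix x assume x: "x \<in> S \<inter> Zd"
    have "\<exists>m. x $ i = of_int m" for i using x by (auto simp: Zd_def elim: Ints_cases)
    then obtain f where f: "\<And>i. x $ i = of_int (f i)" by metis
    have "f i \<in> {-\<lceil>B\<rceil>..\<lceil>B\<rceil>}" for i
    proof -
      have "\<bar>of_int (f i)\<bar> \<le> B" using component_le_norm_cart[of x i] B[of x] x f[of i] by simp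
      then have "of_int \<bar>f i\<bar> \<le> B" by simp
      then have "\<bar>f i\<bar> \<le> \<lceil>B\<rceil>" by linarith
      then show ?thesis by auto
    qed
    moreover have "x = (\<chi> i. of_int (f i))" using f by (simp add: vec_eq_iff)
    ultimately show "x \<in> (\<lambda>f. \<chi> i. of_int (f i)) ` (UNIV \<rightarrow>\<^sub>E {-\<lceil>B\<rceil>..\<lceil>B\<rceil>})"
      by (intro image_eqI[of _ _ f]) auto
  qed
  then show ?thesis by (rule finite_subset) (intro finite_imageI finite_PiE; simp)
qed

lemma finite_edges_subset:
  fixes K :: "(real^'n) set"
  assumes "bounded K"
  shows "finite {e \<in> Ed. e \<subseteq> K}"
proof (rule finite_subset)
  show "{e \<in> Ed. e \<subseteq> K} \<subseteq> (\<lambda>(x, y). {x, y}) ` ((K \<inter> Zd) \<times> (K \<inter> Zd))"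
    by (auto elim!: EdE)
  show "finite ((\<lambda>(x, y). {x, y}) ` ((K \<inter> Zd) \<times> (K \<inter> Zd)))"
    using finite_Zd_bounded[OF assms] by auto
qed

lemma finite_edges_in:
  "closed K \<Longrightarrow> convex K \<Longrightarrow> bounded K \<Longrightarrow> finite (edges_in K)"
  by (simp add: edges_in_eq finite_edges_subset)

lemma edges_in_subset_Ed: "edges_in K \<subseteq> Ed"
  by (auto simp: edges_in_def)

section \<open>Cuts as edge boundaries of vertex sets, and their minimum\<close>

text \<open>Vertex sets can be glued more easily than edge sets. Forwards, \<open>U\<close> is what
  can be reached from \<open>F1\<close> without using \<open>E\<close>; backwards, a path to
  \<open>F2\<close> would have to leave \<open>U\<close> through an edge of
  \<open>E\<close>.\<close>

lemma not_path_avoiding_iff: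
  fixes C :: "(real^'n) set"
  shows "\<not> path_avoiding C E F1 F2 \<longleftrightarrow>
    (\<exists>U. F1 \<subseteq> U \<and> F2 \<inter> U = {} \<and> (\<forall>x y. {x, y} \<in> edges_in C \<and> x \<in> U \<and> y \<notin> U \<longrightarrow> {x, y} \<in> E))"
    (is "?l \<longleftrightarrow> ?r")
proof
  let ?R = "{(x, y). {x, y} \<in> edges_in C - E}"
  assume l: ?l
  define U where "U = {x. \<exists>a\<in>F1. (a, x) \<in> ?R\<^sup>*}"
  have "{x, y} \<in> E" if "{x, y} \<in> edges_in C" "x \<in> U" "y \<notin> U" for x y
  proof (rule ccontr)
    assume "{x, y} \<notin> E"
    then have "(x, y) \<in> ?R" using that by auto
    then show False using that unfolding U_def by (auto intro: rtrancl_into_rtrancl)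
  qed
  moreover have "F1 \<subseteq> U" unfolding U_def by auto
  moreover have "F2 \<inter> U = {}" using l unfolding U_def path_avoiding_def by auto
  ultimately show ?r by blast
next
  let ?R = "{(x, y). {x, y} \<in> edges_in C - E}"
  assume ?r
  then obtain U where U: "F1 \<subseteq> U" "F2 \<inter> U = {}"
    and cut: "\<And>x y. {x, y} \<in> edges_in C \<Longrightarrow> x \<in> U \<Longrightarrow> y \<notin> U \<Longrightarrow> {x, y} \<in> E" by blast
  have "b \<in> U" if "(a, b) \<in> ?R\<^sup>*" "a \<in> U" for a b
    using that by (induction rule: rtrancl_induct) (use cut in auto)
  then show ?l using U unfolding path_avoiding_def by blast
qed

lemma maxflow_le:
  assumes t: "\<And>e. e \<in> Ed \<Longrightarrow> 0 \<le> t e" and E: "finite E" "E \<subseteq> edges_in C" "\<not> path_avoiding C E F1 F2"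
  shows "maxflow t F1 F2 C \<le> sum t E"
  unfolding maxflow_def
proof (rule cInf_lower)
  show "bdd_below {sum t E |E. finite E \<and> E \<subseteq> edges_in C \<and> \<not> path_avoiding C E F1 F2}"
    using t edges_in_subset_Ed[of C] by (intro bdd_belowI[of _ 0]) (auto intro!: sum_nonneg)
qed (use E in blast)

definition cuts :: "(real^'n) set \<Rightarrow> (real^'n) set \<Rightarrow> (real^'n) set \<Rightarrow> (real^'n) set set set" where
  "cuts F1 F2 C = {E. E \<subseteq> edges_in C \<and> \<not> path_avoiding C E F1 F2}"

lemma all_edges_cut:
  assumes "F1 \<inter> F2 = {}"
  shows "edges_in C \<in> cuts F1 F2 C"
  unfolding cuts_def by (auto simp: path_avoiding_def) (use assms in blast)

text \<open>Disjointness makes the full edge set a cut, so the infimum is over a finite nonempty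
  family. This rules out the arbitrary value of \<open>Inf {}\<close>, provides an optimal cut, and
  later gives measurability.\<close>

lemma maxflow_eq_Min:
  assumes fin: "finite (edges_in C)" and disj: "F1 \<inter> F2 = {}"
  shows "finite (cuts F1 F2 C)" "cuts F1 F2 C \<noteq> {}" "maxflow t F1 F2 C = Min (sum t ` cuts F1 F2 C)"
proof -
  show fc: "finite (cuts F1 F2 C)" unfolding cuts_def using fin by auto
  show ne: "cuts F1 F2 C \<noteq> {}" using all_edges_cut[OF disj] by blast
  have "{sum t E | E. finite E \<and> E \<subseteq> edges_in C \<and> \<not> path_avoiding C E F1 F2} = sum t ` cuts F1 F2 C"
    unfolding cuts_def using finite_subset[OF _ fin] by blast
  then show "maxflow t F1 F2 C = Min (sum t ` cuts F1 F2 C)"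
    unfolding maxflow_def using fc ne by (simp add: cInf_eq_Min)
qed

lemma maxflow_attained:
  assumes fin: "finite (edges_in C)" and disj: "F1 \<inter> F2 = {}"
  obtains E where "E \<subseteq> edges_in C" "\<not> path_avoiding C E F1 F2" "maxflow t F1 F2 C = sum t E"
proof -
  have "Min (sum t ` cuts F1 F2 C) \<in> sum t ` cuts F1 F2 C"
    using maxflow_eq_Min[OF assms] by (intro Min_in) auto
  then show thesis using that maxflow_eq_Min(3)[OF assms] unfolding cuts_def by auto
qed

lemma maxflow_nonneg:
  assumes fin: "finite (edges_in C)" and disj: "F1 \<inter> F2 = {}" and t: "\<And>e. e \<in> Ed \<Longrightarrow> 0 \<le> t e"
  shows "0 \<le> maxflow t F1 F2 C"
proof -
  obtain E where "E \<subseteq> edges_in C" "maxflow t F1 F2 C = sum t E"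
    using maxflow_attained[OF fin disj] by metis
  then show ?thesis using t edges_in_subset_Ed[of C] by (auto intro!: sum_nonneg)
qed

lemma maxflow_le_sum_all:
  assumes fin: "finite (edges_in C)" and disj: "F1 \<inter> F2 = {}" and t: "\<And>e. e \<in> Ed \<Longrightarrow> 0 \<le> t e"
  shows "maxflow t F1 F2 C \<le> sum t (edges_in C)"
  using all_edges_cut[OF disj, of C] by (intro maxflow_le t fin) (auto simp: cuts_def)

lemma maxflow_cong:
  assumes "\<And>e. e \<in> edges_in C \<Longrightarrow> t e = t' e"
  shows "maxflow t F1 F2 C = maxflow t' F1 F2 C"
proof -
  have "sum t E = sum t' E" if "E \<subseteq> edges_in C" for E
    using that assms by (intro sum.cong) auto
  then show ?thesis unfolding maxflow_def by (metis (no_types, lifting))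
qed

lemma bd_above_below_disjoint: "bd_above K v c \<inter> bd_below K v c = {}"
  by (auto simp: bd_above_def bd_below_def)

subsection \<open>Gluing the cuts of disjoint tiles\<close>

text \<open>The patches between the cut surfaces of the tiles: an edge inside one tile is left to
  the cut of that tile, and an edge far from the hyperplane is not crossed by the glued
  surface.\<close>

definition glue_edges :: "(real^'n) set \<Rightarrow> real^'n \<Rightarrow> real \<Rightarrow> real \<Rightarrow> (real^'n) set \<Rightarrow> (real^'n) set \<Rightarrow> (real^'n) set set" where
  "glue_edges K v c r W K0 = {e \<in> Ed. e \<subseteq> K \<and> (\<forall>x\<in>e. \<bar>x \<bullet> v - c\<bar> \<le> r) \<and> (\<forall>w\<in>W. \<not> e \<subseteq> (+) w ` K0)}"

lemma Ed_translate:
  assumes "w \<in> Zd"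
  shows "(+) w ` e \<in> Ed \<longleftrightarrow> e \<in> Ed"
proof
  assume "e \<in> Ed"
  then show "(+) w ` e \<in> Ed" using assms by (auto elim!: EdE simp: Ed_iff Zd_add)
next
  assume "(+) w ` e \<in> Ed"
  then obtain x y where xy: "(+) w ` e = {x, y}" "x \<in> Zd" "y \<in> Zd" "dist x y = 1" by (rule EdE)
  have "e = (\<lambda>p. p - w) ` (+) w ` e" by (simp add: image_image)
  then have "e = {x - w, y - w}" by (simp add: xy)
  then show "e \<in> Ed" using xy assms by (simp add: Ed_iff Zd_diff dist_norm)
qed

lemma sum_UN_le:
  fixes t :: "'a \<Rightarrow> real"
  assumes "finite W" "\<And>w. w \<in> W \<Longrightarrow> finite (G w)" "\<And>w e. w \<in> W \<Longrightarrow> e \<in> G w \<Longrightarrow> 0 \<le> t e"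
  shows "sum t (\<Union>w\<in>W. G w) \<le> (\<Sum>w\<in>W. sum t (G w))"
  using assms
proof (induction W rule: finite_induct)
  case (insert w W)
  have fin: "finite (G w)" "finite (\<Union>w\<in>W. G w)" using insert by auto
  have "0 \<le> sum t (G w \<inter> (\<Union>w\<in>W. G w))" using insert by (intro sum_nonneg) auto
  then have "sum t (G w \<union> (\<Union>w\<in>W. G w)) \<le> sum t (G w) + sum t (\<Union>w\<in>W. G w)"
    using sum.union_inter[OF fin, of t] by simp
  moreover have "sum t (\<Union>w\<in>W. G w) \<le> (\<Sum>w\<in>W. sum t (G w))" using insert by auto
  ultimately show ?case using insert by simp
qed simp

text \<open>Take optimal cuts in all tiles and the hyperplane at level \<open>c\<close> outside
  them. A tile vertex with a neighbour outside its tile belongs to the lateral or outer boundary of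
  the tile, where the cut is tied to the side of the tile's own level. As that level differs from
  \<open>c\<close> by at most \<open>R\<close>, the surfaces mismatch only within
  \<open>R + 1\<close> of \<open>c\<close>, and \<open>glue_edges\<close> repairs this.\<close>

lemma maxflow_le_glued:
  fixes v :: "real^'n" and K K0 :: "(real^'n) set"
  assumes v: "norm v = 1"
    and K: "closed K" "convex K" "bounded K" and K0: "closed K0" "convex K0" "bounded K0"
    and W: "finite W" "W \<subseteq> Zd"
    and lev: "\<And>w. w \<in> W \<Longrightarrow> \<bar>w \<bullet> v + c0 - c\<bar> \<le> R"
    and disj: "\<And>w w'. w \<in> W \<Longrightarrow> w' \<in> W \<Longrightarrow> w \<noteq> w' \<Longrightarrow> (+) w ` K0 \<inter> (+) w' ` K0 = {}"
    and F1: "\<And>x w. x \<in> F1 \<Longrightarrow> w \<in> W \<Longrightarrow> x \<notin> (+) w ` K0" "\<And>x. x \<in> F1 \<Longrightarrow> c < x \<bullet> v"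
    and F2: "\<And>x w. x \<in> F2 \<Longrightarrow> w \<in> W \<Longrightarrow> x \<notin> (+) w ` K0" "\<And>x. x \<in> F2 \<Longrightarrow> x \<bullet> v < c"
    and R: "0 \<le> R" and t: "\<And>e. e \<in> Ed \<Longrightarrow> 0 \<le> t e"
  shows "maxflow t F1 F2 K \<le>
     (\<Sum>w\<in>W. maxflow (\<lambda>e. t ((+) w ` e)) (bd_above K0 v c0) (bd_below K0 v c0) K0)
     + sum t (glue_edges K v c (R + 1) W K0)"
proof -
  let ?A = "bd_above K0 v c0" and ?B = "bd_below K0 v c0"
  let ?tw = "\<lambda>w e. t ((+) w ` e)"
  note fin0 = finite_edges_in[OF K0]
  have mem: "p \<in> (+) w ` K0 \<longleftrightarrow> p - w \<in> K0" for p w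
    by (metis (no_types, lifting) add.commute diff_add_cancel image_iff add_diff_cancel_left')
  have "\<exists>E S. E \<subseteq> edges_in K0 \<and> maxflow (?tw w) ?A ?B K0 = sum (?tw w) E \<and> ?A \<subseteq> S \<and> ?B \<inter> S = {}
     \<and> (\<forall>x y. {x, y} \<in> edges_in K0 \<and> x \<in> S \<and> y \<notin> S \<longrightarrow> {x, y} \<in> E)" for w
  proof -
    obtain E where E: "E \<subseteq> edges_in K0" "\<not> path_avoiding K0 E ?A ?B" "maxflow (?tw w) ?A ?B K0 = sum (?tw w) E"
      using maxflow_attained[OF fin0 bd_above_below_disjoint[of K0 v c0], where t = "?tw w"] by blast
    then show ?thesis using E(2)[unfolded not_path_avoiding_iff] by blast
  qed
  then have "\<forall>w. \<exists>E. \<exists>S. E \<subseteq> edges_in K0 \<and> maxflow (?tw w) ?A ?B K0 = sum (?tw w) E \<and> ?A \<subseteq> S \<and> ?B \<inter> S = {}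
     \<and> (\<forall>x y. {x, y} \<in> edges_in K0 \<and> x \<in> S \<and> y \<notin> S \<longrightarrow> {x, y} \<in> E)" by (rule allI)
  from choice[OF this] obtain E where "\<forall>w. \<exists>S. E w \<subseteq> edges_in K0 \<and> maxflow (?tw w) ?A ?B K0 = sum (?tw w) (E w) \<and> ?A \<subseteq> S \<and> ?B \<inter> S = {}
     \<and> (\<forall>x y. {x, y} \<in> edges_in K0 \<and> x \<in> S \<and> y \<notin> S \<longrightarrow> {x, y} \<in> E w)" ..
  from choice[OF this] obtain S where ES: "\<forall>w. E w \<subseteq> edges_in K0 \<and> maxflow (?tw w) ?A ?B K0 = sum (?tw w) (E w) \<and> ?A \<subseteq> S w \<and> ?B \<inter> S w = {}
     \<and> (\<forall>x y. {x, y} \<in> edges_in K0 \<and> x \<in> S w \<and> y \<notin> S w \<longrightarrow> {x, y} \<in> E w)" ..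
  then have E: "\<And>w. E w \<subseteq> edges_in K0" "\<And>w. maxflow (?tw w) ?A ?B K0 = sum (?tw w) (E w)"
    and S: "\<And>w. ?A \<subseteq> S w" "\<And>w. ?B \<inter> S w = {}"
    and cut: "\<And>w x y. {x, y} \<in> edges_in K0 \<Longrightarrow> x \<in> S w \<Longrightarrow> y \<notin> S w \<Longrightarrow> {x, y} \<in> E w"
    by blast+
  \<comment> \<open>The glued source side: inside a tile the translated source side
    \<open>S w\<close> of its optimal cut, outside all tiles the half space above
    \<open>c\<close>.\<close>
  define U where "U = {x. (\<exists>w\<in>W. x - w \<in> K0 \<and> x - w \<in> S w) \<or> ((\<forall>w\<in>W. x - w \<notin> K0) \<and> c < x \<bullet> v)}"
  define Err where "Err = glue_edges K v c (R + 1) W K0"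
  define G where "G w = image ((+) w) ` E w" for w
  define EE where "EE = {e \<in> edges_in K. e \<inter> U \<noteq> {} \<and> \<not> e \<subseteq> U}"
  have uniq: "x - w \<in> S w \<longleftrightarrow> x \<in> U" if xw: "w \<in> W" "x - w \<in> K0" for x w
  proof
    assume "x \<in> U"
    then obtain w' where w': "w' \<in> W" "x - w' \<in> K0" "x - w' \<in> S w'" using xw by (auto simp: U_def)
    have "w' = w"
    proof (rule ccontr)
      assume "w' \<noteq> w"
      then have "(+) w' ` K0 \<inter> (+) w ` K0 = {}" by (intro disj w'(1) xw(1))
      then show False using w'(2) xw(2) mem[of x w] mem[of x w'] by blast
    qed
    then show "x - w \<in> S w" using w' by simp
  qed (use xw in \<open>auto simp: U_def\<close>)
  \<comment> \<open>For an endpoint of an edge that no tile contains, membership in \<open>U\<close>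
    is decided by its height once this differs from \<open>c\<close> by more than \<open>R\<close>:
    inside a tile the vertex is then in \<open>bd_above\<close> or \<open>bd_below\<close> of the
    tile, outside it by definition of \<open>U\<close>.\<close>
  have status: "(R < p \<bullet> v - c \<longrightarrow> p \<in> U) \<and> (p \<bullet> v - c < - R \<longrightarrow> p \<notin> U)"
    if pq: "{p, q} \<in> Ed" and no: "\<And>w. w \<in> W \<Longrightarrow> \<not> (p - w \<in> K0 \<and> q - w \<in> K0)" for p q
  proof (cases "\<exists>w\<in>W. p - w \<in> K0")
    case True
    then obtain w where w: "w \<in> W" "p - w \<in> K0" by blast
    then have q: "q - w \<notin> K0" using no by blast
    have Z: "p \<in> Zd" "q \<in> Zd" "w \<in> Zd" "dist p q = 1" using pq w W by (auto simp: Ed_iff)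
    then have ed: "{p - w, q - w} \<in> Ed" "p - w \<in> Zd" by (auto simp: Ed_iff Zd_diff dist_norm)
    have lw: "\<bar>w \<bullet> v + c0 - c\<bar> \<le> R" by (rule lev[OF w(1)])
    have "R < p \<bullet> v - c \<Longrightarrow> p - w \<in> ?A"
      using w ed q lw unfolding bd_above_def by (auto simp: inner_diff_left)
    moreover have "p \<bullet> v - c < - R \<Longrightarrow> p - w \<in> ?B"
      using w ed q lw unfolding bd_below_def by (auto simp: inner_diff_left)
    ultimately show ?thesis using S[of w] uniq[OF w] by blast
  next
    case False
    then show ?thesis using R by (auto simp: U_def)
  qed
  have cross: "{x, y} \<in> Err \<union> (\<Union>w\<in>W. G w)"
    if xy: "{x, y} \<in> edges_in K" "x \<in> U" "y \<notin> U" for x y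
  proof (cases "\<exists>w\<in>W. x - w \<in> K0 \<and> y - w \<in> K0")
    case True
    then obtain w where w: "w \<in> W" "x - w \<in> K0" "y - w \<in> K0" by blast
    have "{x, y} \<in> Ed" "w \<in> Zd" using xy edges_in_subset_Ed w W by blast+
    then have "{x - w, y - w} \<in> edges_in K0"
      using w by (auto simp: edges_in_eq[OF K0(1,2)] Ed_iff Zd_diff dist_norm)
    then have "{x - w, y - w} \<in> E w" using cut uniq[OF w(1,2)] uniq[OF w(1,3)] xy by blast
    moreover have "{x, y} = (+) w ` {x - w, y - w}" by simp
    ultimately show ?thesis using w(1) unfolding G_def by blast
  next
    case False
    have ed: "{x, y} \<in> Ed" "{y, x} \<in> Ed" "{x, y} \<subseteq> K"
      using xy by (auto simp: edges_in_eq[OF K(1,2)] insert_commute)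
    have "\<bar>x \<bullet> v - y \<bullet> v\<bar> \<le> norm (x - y) * norm v"
      using Cauchy_Schwarz_ineq2[of "x - y" v] by (simp add: inner_diff_left)
    also have "\<dots> = 1" using ed(1) v by (simp add: Ed_iff dist_norm)
    finally have d: "\<bar>x \<bullet> v - y \<bullet> v\<bar> \<le> 1" .
    \<comment> \<open>The endpoint in \<open>U\<close> is not far below \<open>c\<close> and the
      other one is not far above. Heights along an edge change by at most 1, so both endpoints are
      within \<open>R + 1\<close> of \<open>c\<close>.\<close>
    have "- R \<le> x \<bullet> v - c" using status[OF ed(1)] False xy by force
    moreover have "y \<bullet> v - c \<le> R" using status[OF ed(2)] False xy by force
    ultimately have "\<forall>p\<in>{x, y}. \<bar>p \<bullet> v - c\<bar> \<le> R + 1" using d by auto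
    then have "{x, y} \<in> Err" using ed False unfolding Err_def glue_edges_def
      by (auto simp: mem)
    then show ?thesis by blast
  qed
  have EE_sub: "EE \<subseteq> Err \<union> (\<Union>w\<in>W. G w)"
  proof
    fix e assume "e \<in> EE"
    then obtain x y where e: "e \<in> edges_in K" "x \<in> e" "x \<in> U" "y \<in> e" "y \<notin> U" by (auto simp: EE_def)
    then have "e = {x, y}" using edges_in_subset_Ed by (auto elim!: EdE)
    then show "e \<in> Err \<union> (\<Union>w\<in>W. G w)" using cross e by blast
  qed
  have finE: "finite Err" unfolding Err_def glue_edges_def
    by (rule finite_subset[OF _ finite_edges_subset[OF K(3)]]) auto
  have finG: "finite (G w)" for w unfolding G_def using E(1) fin0 finite_subset by blast
  have GEd: "G w \<subseteq> Ed" if "w \<in> W" for w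
    using E(1)[of w] edges_in_subset_Ed[of K0] W(2) that Ed_translate unfolding G_def by blast
  have F1U: "F1 \<subseteq> U"
  proof
    fix x assume "x \<in> F1"
    then show "x \<in> U" using F1 unfolding mem U_def by blast
  qed
  have F2U: "F2 \<inter> U = {}"
  proof -
    have "x \<notin> U" if "x \<in> F2" for x
      using F2(1)[OF that] F2(2)[OF that] unfolding mem U_def by auto
    then show ?thesis by blast
  qed
  have "maxflow t F1 F2 K \<le> sum t EE"
  proof (rule maxflow_le[OF t])
    show "finite EE" using finite_edges_in[OF K] by (auto simp: EE_def)
    show "\<not> path_avoiding K EE F1 F2"
      unfolding not_path_avoiding_iff using F1U F2U by (intro exI[of _ U]) (auto simp: EE_def)
  qed (auto simp: EE_def)
  also have "\<dots> \<le> sum t (Err \<union> (\<Union>w\<in>W. G w))"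
    using EE_sub finE finG W(1) GEd by (intro sum_mono2 t) (auto simp: Err_def glue_edges_def)
  also have "\<dots> \<le> sum t Err + sum t (\<Union>w\<in>W. G w)"
  proof -
    have "0 \<le> sum t (Err \<inter> (\<Union>w\<in>W. G w))"
      by (intro sum_nonneg t) (auto simp: Err_def glue_edges_def)
    then show ?thesis using sum.union_inter[OF finE, of "\<Union>w\<in>W. G w" t] finG W(1) by simp
  qed
  also have "sum t (\<Union>w\<in>W. G w) \<le> (\<Sum>w\<in>W. sum t (G w))"
    using W(1) finG GEd t by (intro sum_UN_le) blast+
  also have "(\<Sum>w\<in>W. sum t (G w)) = (\<Sum>w\<in>W. maxflow (?tw w) ?A ?B K0)"
  proof (rule sum.cong[OF refl])
    fix w
    have "inj_on (image ((+) w)) (E w)" by (rule inj_on_subset[of _ UNIV]) (auto simp: inj_image_eq_iff inj_on_def)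
    then show "sum t (G w) = maxflow (?tw w) ?A ?B K0"
      unfolding G_def E(2) by (simp add: sum.reindex)
  qed
  finally show ?thesis unfolding Err_def by (simp add: add.commute)
qed

section \<open>Tiling a large rectangle by translates of a smaller one\<close>

text \<open>Tiles and large rectangle have different lateral axes but a common normal. Giving both a
  common height in that direction turns comparisons of face areas into comparisons of Lebesgue
  volume.\<close>

definition slab_box :: "('n \<Rightarrow> real^'n) \<Rightarrow> 'n \<Rightarrow> ('n \<Rightarrow> real) \<Rightarrow> ('n \<Rightarrow> real) \<Rightarrow> real \<Rightarrow> real \<Rightarrow> (real^'n) set" where
  "slab_box u k p q s t = {x. s \<le> x \<bullet> u k \<and> x \<bullet> u k \<le> t \<and> (\<forall>i. i \<noteq> k \<longrightarrow> p i \<le> x \<bullet> u i \<and> x \<bullet> u i \<le> q i)}"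

lemma slab_box_frame_box:
  "slab_box u k p q s t = frame_box u (\<lambda>i. if i = k then s else p i) (\<lambda>i. if i = k then t else q i)"
  by (auto simp: slab_box_def frame_box_def)

lemma slab_box_sets: "slab_box u k p q s t \<in> sets borel"
  unfolding slab_box_frame_box by (rule frame_box_sets)

lemma emeasure_slab_box:
  fixes u :: "'n::finite \<Rightarrow> real^'n"
  assumes u: "frame u" and pq: "\<And>i. i \<noteq> k \<Longrightarrow> p i \<le> q i" and st: "s \<le> t"
  shows "emeasure lborel (slab_box u k p q s t) = ennreal ((t - s) * face_vol k (\<lambda>i. q i - p i))"
proof -
  have "(\<Prod>i\<in>UNIV. (if i = k then t else q i) - (if i = k then s else p i)) = (t - s) * face_vol k (\<lambda>i. q i - p i)"
    by (subst prod.remove[of _ k]) (auto intro!: prod.cong)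
  then show ?thesis
    unfolding slab_box_frame_box using assms by (subst emeasure_frame_box) auto
qed

lemma emeasure_disjoint_family_const:
  assumes "finite I" "disjoint_family_on F I" "\<And>i. i \<in> I \<Longrightarrow> F i \<in> sets borel"
    "\<And>i. i \<in> I \<Longrightarrow> emeasure lborel (F i) = ennreal m" "0 \<le> m"
  shows "emeasure lborel (\<Union>i\<in>I. F i) = ennreal (real (card I) * m)"
proof -
  have "emeasure lborel (\<Union>i\<in>I. F i) = (\<Sum>i\<in>I. emeasure lborel (F i))"
    using assms by (intro sum_emeasure[symmetric]) auto
  also have "\<dots> = (\<Sum>i\<in>I. ennreal m)" using assms by (intro sum.cong) auto
  also have "\<dots> = ennreal (real (card I) * m)"
    using assms(5) by (simp add: ennreal_mult ennreal_of_nat_eq_real_of_nat)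
  finally show ?thesis .
qed

definition lattice_dirs :: "(real^'n) set" where
  "lattice_dirs = {b \<in> Zd. norm b = 1}"

lemma finite_lattice_dirs: "finite (lattice_dirs :: (real^'n) set)"
proof (rule finite_subset)
  show "lattice_dirs \<subseteq> cball 0 1 \<inter> (Zd :: (real^'n) set)" by (auto simp: lattice_dirs_def)
qed (intro finite_Zd_bounded bounded_cball)

text \<open>An upper bound for edges per unit of uncovered face area. Glue edges end within
  \<open>R + 1\<close> of the level, hence balls of radius 1/2 around their endpoints fit in a slab
  of height \<open>2 * (R + 2)\<close>. Dividing by the volume of a ball counts endpoints, and each
  endpoint meets at most \<open>card lattice_dirs\<close> edges.\<close>

definition glue_const :: "(real^'n) itself \<Rightarrow> real" where
  "glue_const _ = real (card (lattice_dirs :: (real^'n) set)) * (2 * (real CARD('n) + 2))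
     / measure lborel (ball 0 (1/2) :: (real^'n) set)"

lemma emeasure_half_ball:
  fixes x :: "real^'n"
  shows "emeasure lborel (ball x (1/2)) = ennreal (measure lborel (ball 0 (1/2) :: (real^'n) set))"
    and "0 < measure lborel (ball 0 (1/2) :: (real^'n) set)"
proof -
  have "emeasure lborel (ball x (1/2)) = ennreal (measure lborel (ball x (1/2)))"
    using emeasure_lborel_ball_finite[of x "1/2"] by (intro emeasure_eq_ennreal_measure) auto
  also have "measure lborel (ball x (1/2)) = measure lborel (ball 0 (1/2) :: (real^'n) set)"
    using content_ball_conv_unit_ball[of "1/2" x] content_ball_conv_unit_ball[of "1/2" "0 :: real^'n"] by simp
  finally show "emeasure lborel (ball x (1/2)) = ennreal (measure lborel (ball 0 (1/2) :: (real^'n) set))" .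
  show "0 < measure lborel (ball 0 (1/2) :: (real^'n) set)" by (rule content_ball_pos) simp
qed

lemma Zd_dist_ge_1:
  assumes "x \<in> Zd" "y \<in> Zd" "x \<noteq> (y :: real^'n)"
  shows "1 \<le> dist x y"
proof -
  obtain i where i: "x $ i \<noteq> y $ i" using assms(3) by (auto simp: vec_eq_iff)
  have "(x - y) $ i \<in> \<int>" using assms by (auto simp: Zd_def)
  then have "1 \<le> \<bar>(x - y) $ i\<bar>" using i by (intro Ints_nonzero_abs_ge1) auto
  also have "\<dots> \<le> dist x y" unfolding dist_norm by (rule component_le_norm_cart)
  finally show ?thesis .
qed

lemma card_glue_edges_le:
  fixes P :: "(real^'n) set"
  assumes P: "finite P" and sub: "\<Union> E \<subseteq> P" and E: "E \<subseteq> Ed"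
  shows "card E \<le> card P * card (lattice_dirs :: (real^'n) set)"
proof -
  have "E \<subseteq> (\<lambda>(x, b). {x, x + b}) ` (P \<times> lattice_dirs)"
  proof
    fix e assume e: "e \<in> E"
    then obtain x y where xy: "e = {x, y}" "x \<in> Zd" "y \<in> Zd" "dist x y = 1" using E EdE by blast
    have "x \<in> P" "y - x \<in> lattice_dirs"
      using xy e sub by (auto simp: lattice_dirs_def Zd_diff dist_norm norm_minus_commute)
    then show "e \<in> (\<lambda>(x, b). {x, x + b}) ` (P \<times> lattice_dirs)"
      using xy by (intro image_eqI[of _ _ "(x, y - x)"]) auto
  qed
  then have "card E \<le> card (P \<times> (lattice_dirs :: (real^'n) set))"
    using P finite_lattice_dirs by (meson card_image_le card_mono finite_SigmaI finite_imageI order_trans)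
  then show ?thesis by (simp add: card_cartesian_product)
qed

definition lattice_floor :: "real^'n \<Rightarrow> real^'n" where
  "lattice_floor y = (\<chi> i. of_int \<lfloor>y $ i\<rfloor>)"

lemma lattice_floor: "lattice_floor y \<in> Zd" "norm (lattice_floor y - (y :: real^'n)) \<le> real CARD('n)"
proof -
  show "lattice_floor y \<in> Zd" by (simp add: lattice_floor_def Zd_def)
  have "\<bar>(lattice_floor y - y) $ i\<bar> \<le> 1" for i
    unfolding lattice_floor_def vector_minus_component vec_lambda_beta by linarith
  then have "(\<Sum>i\<in>UNIV. \<bar>(lattice_floor y - y) $ i\<bar>) \<le> (\<Sum>i\<in>(UNIV :: 'n set). 1)" by (intro sum_mono)
  then show "norm (lattice_floor y - y) \<le> real CARD('n)"
    using norm_le_l1_cart[of "lattice_floor y - y"] by simp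
qed

text \<open>Cells aligned with the frame of the tile are laid on a periodic grid, and each cell
  inside the large rectangle receives one tile, moved by a rounded lattice vector. The numbers of
  tiles and of glue edges are then bounded by comparing volumes. \<open>D\<close> bounds the extent
  of a cell in every direction, so cells are lost only within \<open>D\<close> of the rim.\<close>

lemma tiling:
  fixes u u' :: "'n::finite \<Rightarrow> real^'n" and a l a' l' :: "'n \<Rightarrow> real" and k :: 'n
  defines "R \<equiv> real CARD('n)"
  defines "D \<equiv> (\<Sum>i\<in>UNIV - {k}. l i + 2 * R + 1)"
  assumes u: "frame u" "frame u'" and uk: "u k = v" "u' k = v"
    and l: "\<And>i. 2 * R + 4 \<le> l i" and l': "\<And>i. 2 * D + 4 \<le> l' i" and H: "2 * R + 1 \<le> H"
  obtains W where "finite W" "W \<subseteq> Zd"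
    "\<And>w. w \<in> W \<Longrightarrow> \<bar>w \<bullet> v + a k - c\<bar> \<le> R"
    "\<And>w w'. w \<in> W \<Longrightarrow> w' \<in> W \<Longrightarrow> w \<noteq> w' \<Longrightarrow> (+) w ` rect_cyl u k a l H \<inter> (+) w' ` rect_cyl u k a l H = {}"
    "\<And>w x i. w \<in> W \<Longrightarrow> x \<in> (+) w ` rect_cyl u k a l H \<Longrightarrow> i \<noteq> k \<Longrightarrow> a' i + 2 \<le> x \<bullet> u' i \<and> x \<bullet> u' i \<le> a' i + l' i - 2"
    "real (card W) * face_vol k l \<le> face_vol k l'"
    "\<And>h'. real (card (glue_edges (rect_cyl u' k a' l' h') v c (R + 1) W (rect_cyl u k a l H))) \<le>
       glue_const TYPE(real^'n) * (face_vol k (\<lambda>i. l' i + 2)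
         - face_vol k (\<lambda>i. l' i - 2 * D - 4) * face_vol k (\<lambda>i. (l i - 2 * R - 4) / (l i + 2 * R + 1)))"
proof -
  \<comment> \<open>The period of the grid: a side of the tile, room \<open>R\<close> at both ends
    for the rounding, and 1 more so that tiles in adjacent cells cannot touch.\<close>
  define p where "p i = l i + 2 * R + 1" for i
  have R: "1 \<le> R" unfolding R_def by (simp add: Suc_leI)
  have l0: "0 < l i" for i using l[of i] R by linarith
  have p: "0 < p i" for i using l0[of i] R by (simp add: p_def)
  have D0: "0 \<le> D" unfolding D_def using p by (intro sum_nonneg) (auto simp: p_def less_imp_le)
  have l'0: "0 < l' i" for i using l'[of i] D0 by linarith
  let ?K0 = "rect_cyl u k a l H"
  define A where "A z i = a i - R + real_of_int (z i) * p i" for z :: "'n \<Rightarrow> int" and i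
  define cell where "cell z = {x. \<forall>i. i \<noteq> k \<longrightarrow> A z i \<le> x \<bullet> u i \<and> x \<bullet> u i \<le> A z i + p i}" for z
  \<comment> \<open>The margin 2 exceeds the length of an edge, so a vertex of the large cylinder
    with a neighbour beyond its lateral sides lies in no tile.\<close>
  define pr where "pr = {x. \<forall>i. i \<noteq> k \<longrightarrow> a' i + 2 \<le> x \<bullet> u' i \<and> x \<bullet> u' i \<le> a' i + l' i - 2}"
  \<comment> \<open>Indices are integer functions on all coordinates; fixing the normal one to 0
    makes each cell occur once.\<close>
  define Z where "Z = {z. z k = 0 \<and> cell z \<subseteq> pr}"
  \<comment> \<open>The ideal translation, which would put the tile exactly at level
    \<open>c\<close> and centre its rounding range in the cell. The lattice vector
    \<open>w z\<close> differs from it by at most \<open>R\<close> in norm.\<close>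
  define y where "y z = of_coord u (\<chi> i. if i = k then c - a k else real_of_int (z i) * p i)" for z
  define w where "w z = lattice_floor (y z)" for z
  have near: "\<bar>(w z - y z) \<bullet> u i\<bar> \<le> R" for z i
    using abs_inner_frame_le[OF u(1), of "w z - y z" i] lattice_floor(2)[of "y z"]
    unfolding w_def R_def by linarith
  have yk: "y z \<bullet> v = c - a k" for z
    unfolding y_def uk(1)[symmetric] by (simp add: of_coord_inner[OF u(1)])
  have yi: "y z \<bullet> u i = real_of_int (z i) * p i" if "i \<noteq> k" for z i
    using that unfolding y_def by (simp add: of_coord_inner[OF u(1)])
  have lev: "\<bar>w z \<bullet> v + a k - c\<bar> \<le> R" for z
    using near[of z k] yk[of z] by (simp add: uk inner_diff_left)
  have mem: "x \<in> (+) q ` ?K0 \<longleftrightarrow> x - q \<in> ?K0" for x q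
    by (metis (no_types, lifting) add.commute diff_add_cancel image_iff add_diff_cancel_left')
  have tile: "A z i \<le> x \<bullet> u i \<and> x \<bullet> u i \<le> A z i + l i + 2 * R" if "x \<in> (+) (w z) ` ?K0" "i \<noteq> k" for x z i
  proof -
    have "a i \<le> (x - w z) \<bullet> u i" "(x - w z) \<bullet> u i \<le> a i + l i"
      using that unfolding mem by (auto simp: rect_cyl_def)
    then show ?thesis using near[of z i] yi[OF that(2), of z] by (auto simp: inner_diff_left A_def)
  qed
  have tile_cell: "(+) (w z) ` ?K0 \<subseteq> cell z" for z
    using tile by (fastforce simp: cell_def p_def)
  have sep: "z = z'" if zz: "z \<in> Z" "z' \<in> Z"
    and x: "\<And>i. i \<noteq> k \<Longrightarrow> A z i \<le> x i \<and> x i < A z i + p i" "\<And>i. i \<noteq> k \<Longrightarrow> A z' i \<le> x i \<and> x i < A z' i + p i" for z z' x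
  proof
    fix i show "z i = z' i"
    proof (cases "i = k")
      case True
      then show ?thesis using zz by (simp add: Z_def)
    next
      case False
      have *: "\<not> m < n" if "a i - R + real_of_int n * p i \<le> x i" "x i < a i - R + real_of_int m * p i + p i" for m n :: int
      proof
        assume "m < n"
        then have "real_of_int m + 1 \<le> real_of_int n" by linarith
        then have "(real_of_int m + 1) * p i \<le> real_of_int n * p i" using p[of i] by (intro mult_right_mono) auto
        then show False using that by (simp add: algebra_simps)
      qed
      show ?thesis using *[of "z i" "z' i"] *[of "z' i" "z i"] x[OF False] by (simp add: A_def)
    qed
  qed
  have tile_disj: "z = z'" if "z \<in> Z" "z' \<in> Z" "x \<in> (+) (w z) ` ?K0" "x \<in> (+) (w z') ` ?K0" for z z' x
    by (rule sep[OF that(1,2), of "\<lambda>i. x \<bullet> u i"]) (use tile[OF that(3)] tile[OF that(4)] in \<open>fastforce simp: p_def\<close>)+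
  \<comment> \<open>A witness that tiles are nonempty. Together with their disjointness it shows
    that different cells give different lattice vectors, so tiles can be counted by cells.\<close>
  define x0 where "x0 = of_coord u (\<chi> i. a i)"
  have x0: "x0 \<in> ?K0"
    using H R l0 by (auto simp: x0_def rect_cyl_def of_coord_inner[OF u(1)] less_imp_le)
  have inj_w: "inj_on w Z"
  proof (rule inj_onI)
    fix z z' assume zz: "z \<in> Z" "z' \<in> Z" "w z = w z'"
    have "w z + x0 \<in> (+) (w z) ` ?K0" using x0 by blast
    then show "z = z'" using tile_disj[OF zz(1,2)] zz(3) by metis
  qed
  define W where "W = w ` Z"
  have W_Zd: "W \<subseteq> Zd" unfolding W_def w_def using lattice_floor(1) by blast
  have tile_pr: "a' i + 2 \<le> x \<bullet> u' i \<and> x \<bullet> u' i \<le> a' i + l' i - 2"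
    if q: "q \<in> W" "x \<in> (+) q ` ?K0" "i \<noteq> k" for q x i
  proof -
    obtain z where z: "z \<in> Z" "q = w z" using q(1) by (auto simp: W_def)
    then have "x \<in> pr" using q(2) tile_cell[of z] by (auto simp: Z_def)
    then show ?thesis using q(3) by (simp add: pr_def)
  qed
  have finW: "finite W"
  proof -
    let ?B = "slab_box u' k a' (\<lambda>i. a' i + l' i) (c - R - H) (c + R + H)"
    have "W \<subseteq> (\<lambda>x. x - x0) ` ?B \<inter> Zd"
    proof
      fix q assume q: "q \<in> W"
      have m: "q + x0 \<in> (+) q ` ?K0" using x0 by blast
      obtain z where "q = w z" using q by (auto simp: W_def)
      then have "\<bar>(q + x0) \<bullet> v - c\<bar> \<le> R + H"
        using lev[of z] x0 by (auto simp: rect_cyl_def uk inner_add_left)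
      then have "q + x0 \<in> ?B" using tile_pr[OF q m] unfolding slab_box_def uk by fastforce
      then show "q \<in> (\<lambda>x. x - x0) ` ?B \<inter> Zd" using q W_Zd by force
    qed
    moreover have "bounded ((\<lambda>x. x - x0) ` ?B)"
      unfolding slab_box_frame_box by (intro bounded_translation_minus bounded_frame_box u(2))
    ultimately show ?thesis using finite_Zd_bounded finite_subset by blast
  qed
  have finZ: "finite Z" using finW inj_w unfolding W_def by (simp add: finite_image_iff)
  have cardW: "card W = card Z" unfolding W_def by (rule card_image[OF inj_w])
  have disjZ: "disjoint_family_on (\<lambda>z. slab_box u k (\<lambda>i. A z i + r i) (\<lambda>i. A z i + s i) b1 b2) Z"
    if rs: "\<And>i. 0 \<le> r i" "\<And>i. s i < p i" for r s b1 b2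
    unfolding disjoint_family_on_def
  proof (intro ballI impI)
    fix z z' assume zz: "z \<in> Z" "z' \<in> Z" "z \<noteq> z'"
    show "slab_box u k (\<lambda>i. A z i + r i) (\<lambda>i. A z i + s i) b1 b2
        \<inter> slab_box u k (\<lambda>i. A z' i + r i) (\<lambda>i. A z' i + s i) b1 b2 = {}"
    proof (rule ccontr)
      assume "\<not> ?thesis"
      then obtain x where x: "x \<in> slab_box u k (\<lambda>i. A z i + r i) (\<lambda>i. A z i + s i) b1 b2"
        "x \<in> slab_box u k (\<lambda>i. A z' i + r i) (\<lambda>i. A z' i + s i) b1 b2" by blast
      have aux: "\<And>q. A q i + r i \<le> x \<bullet> u i \<Longrightarrow> x \<bullet> u i \<le> A q i + s i \<Longrightarrow> A q i \<le> x \<bullet> u i \<and> x \<bullet> u i < A q i + p i" for i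
        using rs(1)[of i] rs(2)[of i] by (meson add_left_mono add_le_same_cancel1 le_add_same_cancel1 le_less_trans add_strict_left_mono order_trans)
      have "z = z'"
        by (rule sep[OF zz(1,2), of "\<lambda>i. x \<bullet> u i"]) (use x aux in \<open>auto simp: slab_box_def\<close>)
      then show False using zz(3) by simp
    qed
  qed
  have slab_sub: "slab_box u k (\<lambda>i. A z i + r i) (\<lambda>i. A z i + s i) b1 b2 \<subseteq>
      slab_box u' k (\<lambda>i. a' i + 2) (\<lambda>i. a' i + l' i - 2) b1 b2"
    if "z \<in> Z" and rs: "\<And>i. 0 \<le> r i" "\<And>i. s i \<le> p i" for z r s b1 b2
  proof
    fix x assume x: "x \<in> slab_box u k (\<lambda>i. A z i + r i) (\<lambda>i. A z i + s i) b1 b2"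
    have "A z i \<le> x \<bullet> u i \<and> x \<bullet> u i \<le> A z i + p i" if "i \<noteq> k" for i
      using x that rs(1)[of i] rs(2)[of i] by (auto simp: slab_box_def dest!: spec[of _ i])
    then have "x \<in> pr" using \<open>z \<in> Z\<close> by (auto simp: Z_def cell_def)
    then show "x \<in> slab_box u' k (\<lambda>i. a' i + 2) (\<lambda>i. a' i + l' i - 2) b1 b2"
      using x by (auto simp: slab_box_def pr_def uk)
  qed
  have card_upper: "real (card Z) * face_vol k l \<le> face_vol k l'"
  proof -
    let ?F = "\<lambda>z. slab_box u k (\<lambda>i. A z i + 0) (\<lambda>i. A z i + l i) 0 1"
    have tot: "emeasure lborel (\<Union>z\<in>Z. ?F z) = ennreal (real (card Z) * face_vol k l)"
    proof (rule emeasure_disjoint_family_const[OF finZ])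
      show "disjoint_family_on ?F Z" using R by (intro disjZ) (auto simp: p_def)
      show "emeasure lborel (?F z) = ennreal (face_vol k l)" for z
        using l0 by (subst emeasure_slab_box[OF u(1)]) (auto intro: less_imp_le)
    qed (use l0 in \<open>auto intro!: slab_box_sets prod_nonneg intro: less_imp_le\<close>)
    have "(\<Union>z\<in>Z. ?F z) \<subseteq> slab_box u' k a' (\<lambda>i. a' i + l' i) 0 1"
    proof (intro UN_least)
      fix z assume "z \<in> Z"
      then have "?F z \<subseteq> slab_box u' k (\<lambda>i. a' i + 2) (\<lambda>i. a' i + l' i - 2) 0 1"
        using R by (intro slab_sub) (auto simp: p_def)
      also have "\<dots> \<subseteq> slab_box u' k a' (\<lambda>i. a' i + l' i) 0 1" by (fastforce simp: slab_box_def)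
      finally show "?F z \<subseteq> slab_box u' k a' (\<lambda>i. a' i + l' i) 0 1" .
    qed
    then have "emeasure lborel (\<Union>z\<in>Z. ?F z) \<le> emeasure lborel (slab_box u' k a' (\<lambda>i. a' i + l' i) 0 1)"
      by (intro emeasure_mono) (auto intro: slab_box_sets)
    also have "\<dots> = ennreal (face_vol k l')"
      using l'0 by (subst emeasure_slab_box[OF u(2)]) (auto intro: less_imp_le)
    finally have "ennreal (real (card Z) * face_vol k l) \<le> ennreal (face_vol k l')" unfolding tot .
    moreover have "0 \<le> face_vol k l'" using l'0 by (intro prod_nonneg) (auto intro: less_imp_le)
    ultimately show ?thesis by (simp add: ennreal_le_iff)
  qed
  \<comment> \<open>A point at distance more than \<open>D\<close> from the rim lies in a cell that
    is contained in \<open>pr\<close>; hence the admissible cells cover the shrunken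
    rectangle.\<close>
  have card_lower: "face_vol k (\<lambda>i. l' i - 2 * D - 4) \<le> real (card Z) * face_vol k p"
  proof -
    let ?F = "\<lambda>z. slab_box u k (A z) (\<lambda>i. A z i + p i) 0 1"
    let ?S = "slab_box u' k (\<lambda>i. a' i + D + 2) (\<lambda>i. a' i + l' i - D - 2) 0 1"
    have sub: "?S \<subseteq> (\<Union>z\<in>Z. ?F z)"
    proof
      fix x assume x: "x \<in> ?S"
      define z where "z i = (if i = k then 0 else \<lfloor>(x \<bullet> u i - a i + R) / p i\<rfloor>)" for i
      have xz: "A z i \<le> x \<bullet> u i \<and> x \<bullet> u i \<le> A z i + p i" if "i \<noteq> k" for i
      proof -
        have "real_of_int (z i) \<le> (x \<bullet> u i - a i + R) / p i" "(x \<bullet> u i - a i + R) / p i \<le> real_of_int (z i) + 1"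
          using that by (simp_all add: z_def)
        then show ?thesis using p[of i] by (simp add: A_def field_simps)
      qed
      have "q \<in> pr" if q: "q \<in> cell z" for q
        unfolding pr_def
      proof (intro CollectI allI impI)
        fix i assume i: "i \<noteq> k"
        \<comment> \<open>A side direction of the large rectangle is expanded in the frame of the
          tile. The normal term vanishes because both frames share the vector \<open>v\<close>, so
          only the d - 1 sides of the cell contribute to \<open>D\<close>.\<close>
        have "(q - x) \<bullet> u' i = of_coord u (coord u (q - x)) \<bullet> u' i"
          by (simp add: of_coord_coord[OF u(1)])
        also have "\<dots> = (\<Sum>j\<in>UNIV. ((q - x) \<bullet> u j) * (u j \<bullet> u' i))"
          by (simp add: of_coord_def coord_def inner_sum_left)
        also have "\<dots> = (\<Sum>j\<in>UNIV - {k}. ((q - x) \<bullet> u j) * (u j \<bullet> u' i))"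
          using frame_inner[OF u(2), of k i] i uk by (subst sum.remove[of _ k]) auto
        finally have "\<bar>(q - x) \<bullet> u' i\<bar> \<le> (\<Sum>j\<in>UNIV - {k}. \<bar>((q - x) \<bullet> u j) * (u j \<bullet> u' i)\<bar>)"
          by simp
        also have "\<dots> \<le> (\<Sum>j\<in>UNIV - {k}. p j)"
        proof (rule sum_mono)
          fix j assume j: "j \<in> UNIV - {k}"
          then have "A z j \<le> q \<bullet> u j \<and> q \<bullet> u j \<le> A z j + p j" using q by (auto simp: cell_def)
          then have "\<bar>(q - x) \<bullet> u j\<bar> \<le> p j" using xz[of j] j by (auto simp: inner_diff_left abs_le_iff)
          moreover have "\<bar>u j \<bullet> u' i\<bar> \<le> 1"
            using abs_inner_frame_le[OF u(2), of "u j" i] by (simp add: frame_norm[OF u(1)])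
          ultimately have "\<bar>(q - x) \<bullet> u j\<bar> * \<bar>u j \<bullet> u' i\<bar> \<le> p j * 1" using p[of j] by (intro mult_mono) auto
          then show "\<bar>((q - x) \<bullet> u j) * (u j \<bullet> u' i)\<bar> \<le> p j" by (simp add: abs_mult)
        qed
        finally have "\<bar>(q - x) \<bullet> u' i\<bar> \<le> D" by (simp add: D_def p_def)
        moreover have "a' i + D + 2 \<le> x \<bullet> u' i" "x \<bullet> u' i \<le> a' i + l' i - D - 2"
          using x i by (auto simp: slab_box_def)
        ultimately show "a' i + 2 \<le> q \<bullet> u' i \<and> q \<bullet> u' i \<le> a' i + l' i - 2"
          by (auto simp: inner_diff_left)
      qed
      then have "z \<in> Z" by (auto simp: Z_def z_def)
      moreover have "x \<in> ?F z" using x xz by (auto simp: slab_box_def uk)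
      ultimately show "x \<in> (\<Union>z\<in>Z. ?F z)" by blast
    qed
    have "ennreal (face_vol k (\<lambda>i. l' i - 2 * D - 4)) = emeasure lborel ?S"
      using l' by (subst emeasure_slab_box[OF u(2)]) (auto simp: algebra_simps)
    also have "\<dots> \<le> emeasure lborel (\<Union>z\<in>Z. ?F z)"
      using finZ by (intro emeasure_mono[OF sub]) (auto intro: slab_box_sets)
    also have "\<dots> \<le> (\<Sum>z\<in>Z. emeasure lborel (?F z))"
      using finZ by (intro emeasure_subadditive_finite) (auto intro: slab_box_sets)
    also have "\<dots> = (\<Sum>z\<in>Z. ennreal (face_vol k p))"
      using p by (intro sum.cong refl, subst emeasure_slab_box[OF u(1)]) (auto intro: less_imp_le)
    also have "\<dots> = ennreal (real (card Z) * face_vol k p)"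
      using p by (simp add: ennreal_mult prod_nonneg less_imp_le ennreal_of_nat_eq_real_of_nat)
    finally show ?thesis
      using p by (subst (asm) ennreal_le_iff) (auto intro!: mult_nonneg_nonneg prod_nonneg intro: less_imp_le)
  qed
  have glue: "real (card (glue_edges (rect_cyl u' k a' l' h') v c (R + 1) W ?K0)) \<le>
       glue_const TYPE(real^'n) * (face_vol k (\<lambda>i. l' i + 2)
         - face_vol k (\<lambda>i. l' i - 2 * D - 4) * face_vol k (\<lambda>i. (l i - 2 * R - 4) / (l i + 2 * R + 1)))" for h'
  proof -
    let ?E = "glue_edges (rect_cyl u' k a' l' h') v c (R + 1) W ?K0"
    \<comment> \<open>However the rounding falls, the tile covers the range from
      \<open>A z i + 2 * R\<close> to \<open>A z i + l i\<close>. The core is one unit deeper at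
      both ends, so an edge starting there stays in the tile. The boxes \<open>?G\<close> below are
      another unit deeper and avoid the balls around points outside the core.\<close>
    let ?core = "\<lambda>z. {x. \<forall>i. i \<noteq> k \<longrightarrow> A z i + (2 * R + 1) \<le> x \<bullet> u i \<and> x \<bullet> u i \<le> A z i + (l i - 1)}"
    define \<beta> where "\<beta> = measure lborel (ball 0 (1/2) :: (real^'n) set)"
    have \<beta>: "0 < \<beta>" unfolding \<beta>_def by (rule emeasure_half_ball(2))
    \<comment> \<open>Contains all endpoints of glue edges. The balls of radius 1/2 around its
      points are disjoint from each other and from the boxes \<open>?G\<close>, so the volume left
      over by these boxes bounds their number.\<close>
    define P where "P = {x \<in> Zd \<inter> rect_cyl u' k a' l' h'. \<bar>x \<bullet> v - c\<bar> \<le> R + 1 \<and> (\<forall>z\<in>Z. x \<notin> ?core z)}"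
    have "bounded (rect_cyl u' k a' l' h')"
      unfolding rect_cyl_frame_box by (rule bounded_frame_box[OF u(2)])
    then have finP: "finite P"
      by (rule finite_subset[OF _ finite_Zd_bounded, rotated]) (auto simp: P_def)
    have EP: "\<Union> ?E \<subseteq> P"
    proof
      fix x assume "x \<in> \<Union> ?E"
      then obtain e where e: "e \<in> ?E" "x \<in> e" by blast
      then have eE: "e \<in> Ed" "e \<subseteq> rect_cyl u' k a' l' h'" "\<forall>x\<in>e. \<bar>x \<bullet> v - c\<bar> \<le> R + 1"
        "\<forall>q\<in>W. \<not> e \<subseteq> (+) q ` ?K0" unfolding glue_edges_def by auto
      have "x \<notin> ?core z" if z: "z \<in> Z" for z
      proof
        assume x: "x \<in> ?core z"
        have "e \<subseteq> (+) (w z) ` ?K0"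
        proof
          fix q assume q: "q \<in> e"
          have "norm (q - x) \<le> 1" using eE(1) q e(2) by (auto elim!: EdE simp: dist_norm norm_minus_commute)
          then have d: "\<bar>(q - x) \<bullet> u i\<bar> \<le> 1" for i using abs_inner_frame_le[OF u(1), of "q - x" i] by linarith
          \<comment> \<open>The glue slab has half height \<open>R + 1\<close> and the level of a
            tile is off by at most \<open>R\<close>. This is where \<open>2 * R + 1 \<le> H\<close>
            comes from.\<close>
          have "\<bar>(q - w z) \<bullet> u k - a k\<bar> \<le> H"
            using lev[of z] eE(3) q H unfolding uk inner_diff_left by fastforce
          moreover have "a i \<le> (q - w z) \<bullet> u i \<and> (q - w z) \<bullet> u i \<le> a i + l i" if "i \<noteq> k" for i
          proof -
            have "A z i + (2 * R + 1) \<le> x \<bullet> u i" "x \<bullet> u i \<le> A z i + (l i - 1)" using x that by auto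
            then show ?thesis using d[of i] near[of z i] yi[OF that, of z]
              by (auto simp: A_def inner_diff_left abs_le_iff)
          qed
          ultimately show "q \<in> (+) (w z) ` ?K0" unfolding mem by (simp add: rect_cyl_def)
        qed
        then show False using eE(4) z by (auto simp: W_def)
      qed
      then show "x \<in> P" using e(2) eE by (auto simp: P_def elim!: EdE)
    qed
    have cardE: "real (card ?E) \<le> real (card P) * real (card (lattice_dirs :: (real^'n) set))"
      using card_glue_edges_le[OF finP EP] by (metis (no_types, lifting) glue_edges_def mem_Collect_eq of_nat_le_iff of_nat_mult subsetI)
    let ?lo = "c - R - 2" and ?hi = "c + R + 2"
    let ?big = "slab_box u' k (\<lambda>i. a' i - 1) (\<lambda>i. a' i + l' i + 1) ?lo ?hi"
    let ?G = "\<lambda>z. slab_box u k (\<lambda>i. A z i + (2 * R + 2)) (\<lambda>i. A z i + (l i - 2)) ?lo ?hi"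
    let ?V = "(2 * R + 4) * face_vol k (\<lambda>i. l i - 2 * R - 4)"
    have V0: "0 \<le> ?V" using l R by (intro mult_nonneg_nonneg prod_nonneg) (auto simp: algebra_simps)
    have Ptot: "emeasure lborel (\<Union>x\<in>P. ball x (1/2)) = ennreal (real (card P) * \<beta>)"
    proof (rule emeasure_disjoint_family_const[OF finP])
      show "disjoint_family_on (\<lambda>x. ball x (1/2)) P"
        unfolding disjoint_family_on_def
      proof (intro ballI impI)
        fix x q assume xq: "x \<in> P" "q \<in> P" "x \<noteq> q"
        then have "1 \<le> dist x q" by (intro Zd_dist_ge_1) (auto simp: P_def)
        then show "ball x (1/2) \<inter> ball q (1/2) = {}" by (intro disjoint_ballI) auto
      qed
    qed (use \<beta> emeasure_half_ball(1) in \<open>auto simp: \<beta>_def\<close>)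
    have Gtot: "emeasure lborel (\<Union>z\<in>Z. ?G z) = ennreal (real (card Z) * ?V)"
    proof (rule emeasure_disjoint_family_const[OF finZ])
      show "disjoint_family_on ?G Z" using R by (intro disjZ) (auto simp: p_def)
      show "emeasure lborel (?G z) = ennreal ?V" for z
        using l R by (subst emeasure_slab_box[OF u(1)]) (auto simp: algebra_simps)
    qed (use V0 in \<open>auto intro: slab_box_sets\<close>)
    have dis: "(\<Union>x\<in>P. ball x (1/2)) \<inter> (\<Union>z\<in>Z. ?G z) = {}"
    proof -
      have False if "x \<in> P" "q \<in> ball x (1/2)" "z \<in> Z" "q \<in> ?G z" for x q z
      proof -
        have "x \<in> ?core z"
        proof (intro CollectI allI impI)
          fix i assume i: "i \<noteq> k"
          have "A z i + (2 * R + 2) \<le> q \<bullet> u i" "q \<bullet> u i \<le> A z i + (l i - 2)"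
            using that(4) i by (auto simp: slab_box_def)
          moreover have "\<bar>(x - q) \<bullet> u i\<bar> \<le> 1"
            using abs_inner_frame_le[OF u(1), of "x - q" i] that(2) by (simp add: dist_norm)
          ultimately show "A z i + (2 * R + 1) \<le> x \<bullet> u i \<and> x \<bullet> u i \<le> A z i + (l i - 1)"
            by (auto simp: inner_diff_left abs_le_iff)
        qed
        then show False using that(1,3) by (auto simp: P_def)
      qed
      then show ?thesis by blast
    qed
    have sub: "(\<Union>x\<in>P. ball x (1/2)) \<union> (\<Union>z\<in>Z. ?G z) \<subseteq> ?big"
    proof (intro Un_least UN_least)
      fix x assume x: "x \<in> P"
      show "ball x (1/2) \<subseteq> ?big"
      proof
        fix q assume q: "q \<in> ball x (1/2)"
        have d: "\<bar>(x - q) \<bullet> u' i\<bar> \<le> 1" for i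
          using abs_inner_frame_le[OF u(2), of "x - q" i] q by (simp add: dist_norm)
        have "\<bar>x \<bullet> v - c\<bar> \<le> R + 1" using x by (simp add: P_def)
        then have "?lo \<le> q \<bullet> u' k \<and> q \<bullet> u' k \<le> ?hi" using d[of k] by (auto simp: uk inner_diff_left abs_le_iff)
        moreover have "a' i - 1 \<le> q \<bullet> u' i \<and> q \<bullet> u' i \<le> a' i + l' i + 1" if "i \<noteq> k" for i
        proof -
          have "a' i \<le> x \<bullet> u' i" "x \<bullet> u' i \<le> a' i + l' i" using x that by (auto simp: P_def rect_cyl_def)
          then show ?thesis using d[of i] by (auto simp: inner_diff_left abs_le_iff)
        qed
        ultimately show "q \<in> ?big" by (auto simp: slab_box_def)
      qed
    next
      fix z assume "z \<in> Z"
      then have "?G z \<subseteq> slab_box u' k (\<lambda>i. a' i + 2) (\<lambda>i. a' i + l' i - 2) ?lo ?hi"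
        using R by (intro slab_sub) (auto simp: p_def)
      also have "\<dots> \<subseteq> ?big" by (fastforce simp: slab_box_def)
      finally show "?G z \<subseteq> ?big" .
    qed
    have "ennreal (real (card P) * \<beta>) + ennreal (real (card Z) * ?V)
       = emeasure lborel ((\<Union>x\<in>P. ball x (1/2)) \<union> (\<Union>z\<in>Z. ?G z))"
      unfolding Ptot[symmetric] Gtot[symmetric] using finP finZ
      by (intro plus_emeasure dis) (auto intro: slab_box_sets)
    also have "\<dots> \<le> emeasure lborel ?big" by (intro emeasure_mono sub) (simp add: slab_box_sets)
    also have "\<dots> = ennreal ((2 * R + 4) * face_vol k (\<lambda>i. l' i + 2))"
    proof (subst emeasure_slab_box[OF u(2)])
      show "a' i - 1 \<le> a' i + l' i + 1" for i using l'0[of i] by simp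
    qed (use R in \<open>auto simp: algebra_simps\<close>)
    finally have "ennreal (real (card P) * \<beta> + real (card Z) * ?V) \<le> ennreal ((2 * R + 4) * face_vol k (\<lambda>i. l' i + 2))"
      using \<beta> V0 by (subst ennreal_plus) auto
    moreover have "0 \<le> (2 * R + 4) * face_vol k (\<lambda>i. l' i + 2)"
    proof (intro mult_nonneg_nonneg prod_nonneg ballI)
      fix i show "0 \<le> l' i + 2" using l'0[of i] by simp
    qed (use R in simp)
    ultimately have "real (card P) * \<beta> + real (card Z) * ?V \<le> (2 * R + 4) * face_vol k (\<lambda>i. l' i + 2)"
      by (simp add: ennreal_le_iff)
    then have 1: "real (card P) * \<beta> \<le> (2 * R + 4) * (face_vol k (\<lambda>i. l' i + 2) - real (card Z) * face_vol k (\<lambda>i. l i - 2 * R - 4))"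
      by (simp add: algebra_simps)
    have pp: "0 < face_vol k p" using p by (intro prod_pos) auto
    have 2: "face_vol k (\<lambda>i. l' i - 2 * D - 4) * face_vol k (\<lambda>i. (l i - 2 * R - 4) / (l i + 2 * R + 1))
        \<le> real (card Z) * face_vol k (\<lambda>i. l i - 2 * R - 4)"
    proof -
      have "face_vol k (\<lambda>i. (l i - 2 * R - 4) / (l i + 2 * R + 1)) = face_vol k (\<lambda>i. l i - 2 * R - 4) / face_vol k p"
        by (simp add: prod_dividef p_def)
      moreover have "face_vol k (\<lambda>i. l' i - 2 * D - 4) * face_vol k (\<lambda>i. l i - 2 * R - 4)
          \<le> real (card Z) * face_vol k p * face_vol k (\<lambda>i. l i - 2 * R - 4)"
        using card_lower l by (intro mult_right_mono prod_nonneg) (auto simp: algebra_simps)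
      ultimately show ?thesis using pp by (simp add: field_simps)
    qed
    let ?X = "face_vol k (\<lambda>i. l' i + 2) - face_vol k (\<lambda>i. l' i - 2 * D - 4) * face_vol k (\<lambda>i. (l i - 2 * R - 4) / (l i + 2 * R + 1))"
    have "real (card P) * \<beta> \<le> (2 * R + 4) * ?X"
      using 1 2 R by (smt (verit) mult_left_mono)
    then have "real (card P) \<le> (2 * R + 4) * ?X / \<beta>" using \<beta> by (simp add: field_simps)
    then have "real (card P) * real (card (lattice_dirs :: (real^'n) set)) \<le> (2 * R + 4) * ?X / \<beta> * real (card (lattice_dirs :: (real^'n) set))"
      by (intro mult_right_mono) auto
    also have "\<dots> = glue_const TYPE(real^'n) * ?X"
    proof -
      have "(2 * R + 4) * x / \<beta> * n = n * (2 * (R + 2)) / \<beta> * x" for x n by simp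
      then show ?thesis unfolding glue_const_def \<beta>_def R_def .
    qed
    finally show ?thesis using cardE by linarith
  qed
  show thesis
  proof (rule that[of W])
    show "\<bar>q \<bullet> v + a k - c\<bar> \<le> R" if "q \<in> W" for q using that lev by (auto simp: W_def)
    show "(+) q ` ?K0 \<inter> (+) q' ` ?K0 = {}" if qq: "q \<in> W" "q' \<in> W" "q \<noteq> q'" for q q'
      using tile_disj qq unfolding W_def by blast
    show "real (card W) * face_vol k l \<le> face_vol k l'" using card_upper cardW by simp
  qed (use finW W_Zd tile_pr glue in blast)+
qed

section \<open>Exponential moments\<close>

lemma exp_minus_one_le:
  fixes x :: real
  shows "exp x - 1 \<le> x * exp x"
proof -
  have "1 - x \<le> exp (- x)" using exp_ge_add_one_self[of "- x"] by simp
  then have "(1 - x) * exp x \<le> exp (- x) * exp x" by (intro mult_right_mono) auto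
  then show ?thesis by (simp add: algebra_simps flip: exp_add)
qed

text \<open>Half of the exponent \<open>g\<close> absorbs the factor \<open>x\<close>, the other
  half dominates \<open>exp (\<theta> * x)\<close>. The outcome is linear in \<open>\<theta>\<close>
  with an integrable factor that does not depend on it.\<close>

lemma exp_minus_one_le_scaled:
  fixes x :: real
  assumes x: "0 \<le> x" and \<theta>: "0 < \<theta>" "\<theta> \<le> g / 2"
  shows "exp (\<theta> * x) - 1 \<le> \<theta> * (2 / g * exp (g * x))"
proof -
  have g: "0 < g" using \<theta> by simp
  have "exp (\<theta> * x) - 1 \<le> \<theta> * (x * exp (\<theta> * x))"
    using exp_minus_one_le[of "\<theta> * x"] by (simp add: mult_ac)
  also have "\<dots> \<le> \<theta> * (2 / g * exp (g / 2 * x) * exp (g / 2 * x))"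
  proof (intro mult_left_mono mult_mono)
    have "g / 2 * x \<le> exp (g / 2 * x)" using exp_ge_add_one_self[of "g / 2 * x"] by linarith
    then show "x \<le> 2 / g * exp (g / 2 * x)" using g by (simp add: field_simps)
    show "exp (\<theta> * x) \<le> exp (g / 2 * x)"
      unfolding exp_le_cancel_iff by (rule mult_right_mono[OF \<theta>(2) x])
  qed (use x \<theta> g in auto)
  also have "2 / g * exp (g / 2 * x) * exp (g / 2 * x) = 2 / g * exp (g * x)"
    by (simp flip: exp_add)
  finally show ?thesis .
qed

text \<open>The exponential moment has derivative \<open>expectation Y\<close> at 0, by dominated
  convergence of the difference quotients. Hence for small \<open>\<theta>\<close> it is at most 1
  plus \<open>\<theta>\<close> times any larger slope, which is below the exponential.\<close>

lemma (in prob_space) small_exponential_moment: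
  fixes Y :: "'a \<Rightarrow> real"
  assumes Y: "Y \<in> borel_measurable M" "AE \<omega> in M. 0 \<le> Y \<omega>"
    and int: "integrable M (\<lambda>\<omega>. exp (g * Y \<omega>))" and g: "0 < g" and \<epsilon>: "0 < \<epsilon>"
  shows "integrable M Y" "0 \<le> expectation Y"
    "\<exists>\<theta>0>0. \<forall>\<theta>. 0 < \<theta> \<and> \<theta> \<le> \<theta>0 \<longrightarrow>
       (\<integral>\<^sup>+\<omega>. ennreal (exp (\<theta> * Y \<omega>)) \<partial>M) \<le> ennreal (exp (\<theta> * (expectation Y + \<epsilon>)))"
proof -
  show intY: "integrable M Y"
  proof (rule Bochner_Integration.integrable_bound)
    show "integrable M (\<lambda>\<omega>. 1 / g * exp (g * Y \<omega>))" using int by simp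
    show "AE \<omega> in M. norm (Y \<omega>) \<le> norm (1 / g * exp (g * Y \<omega>))"
      using Y(2)
    proof eventually_elim
      case (elim \<omega>)
      have "g * Y \<omega> \<le> exp (g * Y \<omega>)" using exp_ge_add_one_self[of "g * Y \<omega>"] by linarith
      then show ?case using elim g by (simp add: field_simps)
    qed
  qed (rule Y)
  show "0 \<le> expectation Y" using Y(2) by (intro integral_nonneg_AE) auto
  define f where "f \<theta> \<omega> = (exp (\<theta> * Y \<omega>) - 1) / \<theta>" for \<theta> \<omega>
  have intexp: "integrable M (\<lambda>\<omega>. exp (\<theta> * Y \<omega>))" if "0 < \<theta>" "\<theta> \<le> g" for \<theta>
  proof (rule Bochner_Integration.integrable_bound[OF int])
    show "AE \<omega> in M. norm (exp (\<theta> * Y \<omega>)) \<le> norm (exp (g * Y \<omega>))"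
      using Y(2) by eventually_elim (use that in \<open>auto intro: mult_right_mono\<close>)
  qed (use Y in measurable)
  have "((\<lambda>\<theta>. expectation (f \<theta>)) \<longlongrightarrow> expectation Y) (at_right 0)"
  proof (rule tendsto_at_right_sequentially[where b = "g / 2"])
    show "0 < g / 2" using g by simp
    fix S :: "nat \<Rightarrow> real"
    assume S: "\<And>n. 0 < S n" "\<And>n. S n < g / 2" "decseq S" "S \<longlonglongrightarrow> 0"
    show "(\<lambda>n. expectation (f (S n))) \<longlonglongrightarrow> expectation Y"
    proof (rule integral_dominated_convergence)
      show "integrable M (\<lambda>\<omega>. 2 / g * exp (g * Y \<omega>))" using int by simp
      show "AE \<omega> in M. (\<lambda>n. f (S n) \<omega>) \<longlonglongrightarrow> Y \<omega>"
      proof (rule AE_I2)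
        fix \<omega>
        have "((\<lambda>\<theta>. exp (\<theta> * Y \<omega>)) has_field_derivative Y \<omega>) (at 0)"
          by (auto intro!: derivative_eq_intros)
        then have "(\<lambda>h. (exp (h * Y \<omega>) - 1) / h) \<midarrow>0\<rightarrow> Y \<omega>"
          unfolding DERIV_def by simp
        then show "(\<lambda>n. f (S n) \<omega>) \<longlonglongrightarrow> Y \<omega>"
          unfolding f_def
          by (rule filterlim_compose) (use S in \<open>auto simp: filterlim_at intro!: always_eventually\<close>, metis less_irrefl)
      qed
      show "AE \<omega> in M. norm (f (S n) \<omega>) \<le> 2 / g * exp (g * Y \<omega>)" for n
        using Y(2)
      proof eventually_elim
        case (elim \<omega>)
        have "0 \<le> exp (S n * Y \<omega>) - 1" using elim S(1)[of n] by simp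
        moreover have "exp (S n * Y \<omega>) - 1 \<le> S n * (2 / g * exp (g * Y \<omega>))"
          using elim S(1,2)[of n] by (intro exp_minus_one_le_scaled) auto
        ultimately show ?case using S(1)[of n] by (simp add: f_def divide_le_eq mult_ac)
      qed
      show "f (S n) \<in> borel_measurable M" for n unfolding f_def using Y by measurable
    qed (rule Y)
  qed
  then have "\<forall>\<^sub>F \<theta> in at_right 0. expectation (f \<theta>) < expectation Y + \<epsilon>"
    using \<epsilon> by (intro order_tendstoD) auto
  then obtain b where b: "0 < b" "\<And>\<theta>. 0 < \<theta> \<Longrightarrow> \<theta> < b \<Longrightarrow> expectation (f \<theta>) < expectation Y + \<epsilon>"
    unfolding eventually_at_right_field by auto
  show "\<exists>\<theta>0>0. \<forall>\<theta>. 0 < \<theta> \<and> \<theta> \<le> \<theta>0 \<longrightarrow>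
       (\<integral>\<^sup>+\<omega>. ennreal (exp (\<theta> * Y \<omega>)) \<partial>M) \<le> ennreal (exp (\<theta> * (expectation Y + \<epsilon>)))"
  proof (intro exI[of _ "min (b / 2) g"] conjI allI impI)
    show "0 < min (b / 2) g" using b g by simp
    fix \<theta> assume \<theta>: "0 < \<theta> \<and> \<theta> \<le> min (b / 2) g"
    have i: "integrable M (\<lambda>\<omega>. exp (\<theta> * Y \<omega>))" using \<theta> by (intro intexp) auto
    have "expectation (f \<theta>) < expectation Y + \<epsilon>" using \<theta> b by auto
    moreover have "expectation (f \<theta>) = (expectation (\<lambda>\<omega>. exp (\<theta> * Y \<omega>)) - 1) / \<theta>"
      unfolding f_def using i by (simp add: prob_space)
    ultimately have "expectation (\<lambda>\<omega>. exp (\<theta> * Y \<omega>)) \<le> 1 + \<theta> * (expectation Y + \<epsilon>)"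
      using \<theta> by (simp add: divide_less_eq mult_ac)
    also have "\<dots> \<le> exp (\<theta> * (expectation Y + \<epsilon>))" by (rule exp_ge_add_one_self)
    finally have "expectation (\<lambda>\<omega>. exp (\<theta> * Y \<omega>)) \<le> exp (\<theta> * (expectation Y + \<epsilon>))" .
    then show "(\<integral>\<^sup>+\<omega>. ennreal (exp (\<theta> * Y \<omega>)) \<partial>M) \<le> ennreal (exp (\<theta> * (expectation Y + \<epsilon>)))"
      using i by (subst nn_integral_eq_integral) (auto intro: ennreal_leI)
  qed
qed

lemma maxflow_measurable:
  assumes fin: "finite (edges_in K)" and disj: "F1 \<inter> F2 = {}"
    and X: "\<And>e. e \<in> edges_in K \<Longrightarrow> (\<lambda>x. X x e) \<in> borel_measurable N"
  shows "(\<lambda>x. maxflow (X x) F1 F2 K) \<in> borel_measurable N"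
  unfolding maxflow_eq_Min(3)[OF fin disj]
proof (rule borel_measurable_Min)
  show "finite (cuts F1 F2 K)" by (rule maxflow_eq_Min(1)[OF fin disj])
  fix E assume "E \<in> cuts F1 F2 K"
  then show "(\<lambda>x. sum (X x) E) \<in> borel_measurable N"
    using X by (intro borel_measurable_sum) (auto simp: cuts_def)
qed

section \<open>The i.i.d. capacities: translation invariance and independence\<close>

locale fpp = prob_space M for M :: "'w measure" +
  fixes t :: "(real^'n) set \<Rightarrow> 'w \<Rightarrow> real" and F :: "real measure" and \<gamma> :: real
  assumes indep: "indep_vars (\<lambda>_. borel) t Ed"
    and distr_t: "\<And>e. e \<in> Ed \<Longrightarrow> distr M borel (t e) = F"
    and F_nonneg: "AE x in F. 0 \<le> x"
    and \<gamma>: "0 < \<gamma>" and F_exp: "integrable F (\<lambda>x. exp (\<gamma> * x))"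
begin

lemma t_meas: "e \<in> Ed \<Longrightarrow> t e \<in> borel_measurable M"
  using indep by (auto simp: indep_vars_def)

lemma Ed_nonempty: "(Ed :: (real^'n) set set) \<noteq> {}"
proof -
  obtain i :: 'n where True by blast
  have "0 \<in> (Zd :: (real^'n) set)" "axis i 1 \<in> (Zd :: (real^'n) set)" by (auto simp: Zd_def axis_def)
  then have "{0, axis i 1} \<in> (Ed :: (real^'n) set set)" by (simp add: Ed_iff)
  then show ?thesis by blast
qed

lemma sets_F: "sets F = sets borel" "prob_space F"
proof -
  obtain e :: "(real^'n) set" where e: "e \<in> Ed" using Ed_nonempty by blast
  show "sets F = sets borel" using distr_t[OF e] by (metis sets_distr)
  show "prob_space F" using prob_space_distr[OF t_meas[OF e]] distr_t[OF e] by simp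
qed

text \<open>There are countably many edges, so a single null set serves all of them.\<close>

lemma t_nonneg: "AE \<omega> in M. \<forall>e\<in>Ed. 0 \<le> t e \<omega>"
proof -
  have "(Ed :: (real^'n) set set) \<subseteq> (\<Union>n::nat. {e \<in> Ed. e \<subseteq> cball 0 (real n)})"
  proof
    fix e :: "(real^'n) set" assume e: "e \<in> Ed"
    then obtain x y where xy: "e = {x, y}" by (rule EdE)
    obtain n :: nat where "max (norm x) (norm y) \<le> real n" using real_arch_simple by blast
    then have "e \<subseteq> cball 0 (real n)" unfolding xy by simp
    then have "e \<in> {e \<in> Ed. e \<subseteq> cball 0 (real n)}" using e by blast
    then show "e \<in> (\<Union>n::nat. {e \<in> Ed. e \<subseteq> cball 0 (real n)})" by blast
  qed
  moreover have "countable (\<Union>n::nat. {e \<in> Ed. e \<subseteq> cball (0 :: real^'n) (real n)})"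
    by (rule countable_UN) (auto intro!: countable_finite finite_edges_subset)
  ultimately have "countable (Ed :: (real^'n) set set)" by (rule countable_subset)
  moreover have "AE \<omega> in M. 0 \<le> t e \<omega>" if e: "e \<in> Ed" for e
  proof -
    have "AE x in distr M borel (t e). 0 \<le> x" unfolding distr_t[OF e] by (rule F_nonneg)
    then show ?thesis by (subst (asm) AE_distr_iff) (use t_meas[OF e] in auto)
  qed
  ultimately show ?thesis by (simp add: AE_ball_countable)
qed

text \<open>The cost charged per glue edge. It comes from \<open>exp_minus_one_le_scaled\<close>
  and, by \<open>mgf_t\<close>, bounds the normalised log moment of one capacity for all positive
  \<open>\<theta>\<close> up to \<open>\<gamma> / 2\<close>.\<close>

definition \<beta> :: real where "\<beta> = 2 / \<gamma> * (\<integral>x. exp (\<gamma> * x) \<partial>F)"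

lemma \<beta>_nonneg: "0 \<le> \<beta>"
  unfolding \<beta>_def using \<gamma> by simp

lemma integrable_exp_t: "e \<in> Ed \<Longrightarrow> integrable M (\<lambda>\<omega>. exp (\<gamma> * t e \<omega>))"
  using F_exp distr_t[of e] t_meas[of e] integrable_distr_eq[of "t e" M borel "\<lambda>x. exp (\<gamma> * x)"] by auto

lemma mgf_t:
  assumes e: "e \<in> Ed" and \<theta>: "0 < \<theta>" "\<theta> \<le> \<gamma> / 2"
  shows "(\<integral>\<^sup>+\<omega>. ennreal (exp (\<theta> * t e \<omega>)) \<partial>M) \<le> ennreal (exp (\<theta> * \<beta>))"
proof -
  have int: "integrable M (\<lambda>\<omega>. 1 + \<theta> * (2 / \<gamma> * exp (\<gamma> * t e \<omega>)))"
    using integrable_exp_t[OF e] by simp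
  have ex: "expectation (\<lambda>\<omega>. exp (\<gamma> * t e \<omega>)) = (\<integral>x. exp (\<gamma> * x) \<partial>F)"
    using distr_t[OF e] integral_distr[OF t_meas[OF e], of "\<lambda>x. exp (\<gamma> * x)"] by simp
  have "(\<integral>\<^sup>+\<omega>. ennreal (exp (\<theta> * t e \<omega>)) \<partial>M) \<le> (\<integral>\<^sup>+\<omega>. ennreal (1 + \<theta> * (2 / \<gamma> * exp (\<gamma> * t e \<omega>))) \<partial>M)"
  proof (rule nn_integral_mono_AE)
    show "AE \<omega> in M. ennreal (exp (\<theta> * t e \<omega>)) \<le> ennreal (1 + \<theta> * (2 / \<gamma> * exp (\<gamma> * t e \<omega>)))"
      using t_nonneg
    proof eventually_elim
      case (elim \<omega>)
      then show ?case using exp_minus_one_le_scaled[of "t e \<omega>" \<theta> \<gamma>] e \<theta> by (intro ennreal_leI) auto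
    qed
  qed
  also have "\<dots> = ennreal (expectation (\<lambda>\<omega>. 1 + \<theta> * (2 / \<gamma> * exp (\<gamma> * t e \<omega>))))"
    using \<theta> \<gamma> by (intro nn_integral_eq_integral int) auto
  also have "expectation (\<lambda>\<omega>. 1 + \<theta> * (2 / \<gamma> * exp (\<gamma> * t e \<omega>))) = 1 + \<theta> * \<beta>"
    using integrable_exp_t[OF e] by (simp add: \<beta>_def ex prob_space)
  also have "ennreal (1 + \<theta> * \<beta>) \<le> ennreal (exp (\<theta> * \<beta>))"
    by (intro ennreal_leI exp_ge_add_one_self)
  finally show ?thesis .
qed

text \<open>Any injective relabelling of edges leaves the joint law a power of \<open>F\<close>.
  Lattice translation is the case of interest.\<close>

lemma distr_config:
  assumes s: "inj_on s G" "s ` G \<subseteq> Ed"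
  shows "distr M (PiM G (\<lambda>_. borel)) (\<lambda>\<omega>. \<lambda>e\<in>G. t (s e) \<omega>) = PiM G (\<lambda>_. F)"
proof -
  have "distr M (PiM Ed (\<lambda>_. borel)) (\<lambda>\<omega>. \<lambda>e\<in>Ed. t e \<omega>) = PiM Ed (\<lambda>e. distr M borel (t e))"
    using indep_vars_iff_distr_eq_PiM'[OF Ed_nonempty, of t "\<lambda>_. borel"] t_meas indep by blast
  also have "\<dots> = PiM Ed (\<lambda>_. F)" by (intro PiM_cong) (auto simp: distr_t)
  finally have E: "distr M (PiM Ed (\<lambda>_. borel)) (\<lambda>\<omega>. \<lambda>e\<in>Ed. t e \<omega>) = PiM Ed (\<lambda>_. F)" .
  have m1: "(\<lambda>\<omega>. \<lambda>e\<in>Ed. t e \<omega>) \<in> measurable M (PiM Ed (\<lambda>_. borel))"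
    using t_meas by (intro measurable_restrict) auto
  have m2: "(\<lambda>\<omega>. \<lambda>e\<in>G. \<omega> (s e)) \<in> measurable (PiM Ed (\<lambda>_. borel)) (PiM G (\<lambda>_. borel))"
    using s(2) by (intro measurable_restrict measurable_component_singleton) auto
  have "PiM G (\<lambda>_. F) = distr (PiM Ed (\<lambda>_. F)) (PiM G (\<lambda>_. F)) (\<lambda>\<omega>. \<lambda>e\<in>G. \<omega> (s e))"
    using distr_PiM_reindex[of Ed "\<lambda>_. F" s G] s sets_F by (simp add: image_subset_iff_funcset)
  also have "\<dots> = distr (PiM Ed (\<lambda>_. F)) (PiM G (\<lambda>_. borel)) (\<lambda>\<omega>. \<lambda>e\<in>G. \<omega> (s e))"
    by (intro distr_cong sets_PiM_cong refl) (simp add: sets_F)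
  also have "\<dots> = distr M (PiM G (\<lambda>_. borel)) ((\<lambda>\<omega>. \<lambda>e\<in>G. \<omega> (s e)) \<circ> (\<lambda>\<omega>. \<lambda>e\<in>Ed. t e \<omega>))"
    unfolding E[symmetric] by (rule distr_distr[OF m2 m1])
  also have "(\<lambda>\<omega>. \<lambda>e\<in>G. \<omega> (s e)) \<circ> (\<lambda>\<omega>. \<lambda>e\<in>Ed. t e \<omega>) = (\<lambda>\<omega>. \<lambda>e\<in>G. t (s e) \<omega>)"
    using s(2) by (auto simp: fun_eq_iff)
  finally show ?thesis by (rule sym)
qed

text \<open>Both sides are integrals over the same product measure on the edges of \<open>K\<close>,
  one through the translation and one through the identity relabelling.\<close>

lemma nn_integral_translate:
  fixes K :: "(real^'n) set"
  assumes w: "w \<in> Zd" and fin: "finite (edges_in K)" and disj: "F1 \<inter> F2 = {}" and \<Phi>: "\<Phi> \<in> borel_measurable borel"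
  shows "(\<integral>\<^sup>+\<omega>. \<Phi> (maxflow (\<lambda>e. t ((+) w ` e) \<omega>) F1 F2 K) \<partial>M) = (\<integral>\<^sup>+\<omega>. \<Phi> (maxflow (\<lambda>e. t e \<omega>) F1 F2 K) \<partial>M)"
proof -
  define N where "N = PiM (edges_in K) (\<lambda>_. borel :: real measure)"
  have mf: "(\<lambda>f. maxflow f F1 F2 K) \<in> borel_measurable N"
    unfolding N_def by (intro maxflow_measurable fin disj measurable_component_singleton)
  have gen: "(\<integral>\<^sup>+\<omega>. \<Phi> (maxflow (\<lambda>e. t (s e) \<omega>) F1 F2 K) \<partial>M)
      = (\<integral>\<^sup>+f. \<Phi> (maxflow f F1 F2 K) \<partial>PiM (edges_in K) (\<lambda>_. F))"
    if s: "inj_on s (edges_in K)" "s ` edges_in K \<subseteq> Ed" for s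
  proof -
    have "(\<lambda>\<omega>. \<lambda>e\<in>edges_in K. t (s e) \<omega>) \<in> measurable M N"
      unfolding N_def using s(2) t_meas by (intro measurable_restrict) auto
    then have "(\<integral>\<^sup>+f. \<Phi> (maxflow f F1 F2 K) \<partial>distr M N (\<lambda>\<omega>. \<lambda>e\<in>edges_in K. t (s e) \<omega>))
      = (\<integral>\<^sup>+\<omega>. \<Phi> (maxflow (\<lambda>e\<in>edges_in K. t (s e) \<omega>) F1 F2 K) \<partial>M)"
      using \<Phi> mf by (intro nn_integral_distr) auto
    also have "\<dots> = (\<integral>\<^sup>+\<omega>. \<Phi> (maxflow (\<lambda>e. t (s e) \<omega>) F1 F2 K) \<partial>M)"
      by (intro nn_integral_cong arg_cong[where f = \<Phi>] maxflow_cong) simp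
    finally show ?thesis using distr_config[OF s] unfolding N_def by simp
  qed
  have "inj_on ((`) ((+) w)) (edges_in K)" by (auto simp: inj_on_def inj_image_eq_iff)
  moreover have "(`) ((+) w) ` edges_in K \<subseteq> Ed"
    using Ed_translate[OF w] edges_in_subset_Ed[of K] by blast
  ultimately show ?thesis using gen[of "\<lambda>e. (+) w ` e"] gen[of "\<lambda>e. e"] edges_in_subset_Ed[of K] by simp
qed

text \<open>Each tile flow reads the edges of its own tile and each glue edge reads itself. These
  blocks are disjoint, hence independent, and the moment factorises; translation invariance replaces
  each tile by the one at the origin.\<close>

lemma mgf_tiles:
  fixes K :: "(real^'n) set"
  assumes W: "finite W" "W \<subseteq> Zd" and Err: "finite Err" "Err \<subseteq> Ed"
    and fin: "finite (edges_in K)" and disj: "F1 \<inter> F2 = {}"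
    and dW: "\<And>w w'. w \<in> W \<Longrightarrow> w' \<in> W \<Longrightarrow> w \<noteq> w' \<Longrightarrow> (`) ((+) w) ` edges_in K \<inter> (`) ((+) w') ` edges_in K = {}"
    and dE: "\<And>w. w \<in> W \<Longrightarrow> (`) ((+) w) ` edges_in K \<inter> Err = {}"
    and \<theta>: "0 < \<theta>" "\<theta> \<le> \<gamma> / 2"
    and m: "(\<integral>\<^sup>+\<omega>. ennreal (exp (\<theta> * maxflow (\<lambda>e. t e \<omega>) F1 F2 K)) \<partial>M) \<le> ennreal (exp (\<theta> * m))"
  shows "(\<integral>\<^sup>+\<omega>. ennreal (exp (\<theta> * ((\<Sum>w\<in>W. maxflow (\<lambda>e. t ((+) w ` e) \<omega>) F1 F2 K) + (\<Sum>e\<in>Err. t e \<omega>)))) \<partial>M)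
     \<le> ennreal (exp (\<theta> * (real (card W) * m + real (card Err) * \<beta>)))"
proof -
  \<comment> \<open>Tiles and glue edges are indexed together by a sum type, so that independence of
    all factors is one statement about disjoint blocks \<open>G i\<close>.\<close>
  define I where "I = Inl ` W \<union> Inr ` Err"
  define G where "G i = (case i of Inl w \<Rightarrow> (`) ((+) w) ` edges_in K | Inr e \<Rightarrow> {e})" for i :: "(real^'n) + (real^'n) set"
  define Y :: "(real^'n) + (real^'n) set \<Rightarrow> ((real^'n) set \<Rightarrow> real) \<Rightarrow> ennreal" where "Y i f = (case i of Inl w \<Rightarrow> ennreal (exp (\<theta> * maxflow (\<lambda>e. f ((+) w ` e)) F1 F2 K))
      | Inr e \<Rightarrow> ennreal (exp (\<theta> * f e)))" for i f
  have finI: "finite I" using W Err by (auto simp: I_def)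
  have G_Ed: "G i \<subseteq> Ed" if "i \<in> I" for i
  proof (cases i)
    case (Inl w)
    then have "w \<in> Zd" using that W by (auto simp: I_def)
    then show ?thesis unfolding G_def Inl using Ed_translate edges_in_subset_Ed[of K] by auto
  qed (use that Err in \<open>auto simp: I_def G_def\<close>)
  have dG: "disjoint_family_on G I"
    unfolding disjoint_family_on_def
  proof (intro ballI impI)
    fix i j assume ij: "i \<in> I" "j \<in> I" "i \<noteq> j"
    show "G i \<inter> G j = {}"
    proof (cases i; cases j)
      fix w w' assume "i = Inl w" "j = Inl w'"
      then show ?thesis using dW[of w w'] ij by (auto simp: I_def G_def)
    next
      fix w e assume "i = Inl w" "j = Inr e"
      then show ?thesis using dE[of w] ij by (auto simp: I_def G_def)
    next
      fix w e assume "i = Inr e" "j = Inl w"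
      then show ?thesis using dE[of w] ij by (auto simp: I_def G_def)
    next
      fix e e' assume "i = Inr e" "j = Inr e'"
      then show ?thesis using ij by (auto simp: G_def)
    qed
  qed
  have ind: "indep_vars (\<lambda>_. borel) (\<lambda>i \<omega>. Y i (restrict (\<lambda>e. t e \<omega>) (G i))) I"
  proof (rule indep_vars_compose2[OF indep_vars_restrict[OF indep G_Ed dG]])
    fix i assume i: "i \<in> I"
    show "Y i \<in> borel_measurable (PiM (G i) (\<lambda>_. borel))"
    proof (cases i)
      case (Inl w)
      have "(\<lambda>f. maxflow (\<lambda>e. f ((+) w ` e)) F1 F2 K) \<in> borel_measurable (PiM (G i) (\<lambda>_. borel))"
        unfolding Inl G_def by (intro maxflow_measurable fin disj measurable_component_singleton) auto
      then show ?thesis unfolding Y_def Inl by simp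
    next
      case (Inr e)
      have "(\<lambda>f. f e) \<in> borel_measurable (PiM (G i) (\<lambda>_. borel :: real measure))"
        unfolding Inr G_def by (intro measurable_component_singleton) auto
      then show ?thesis unfolding Y_def Inr by simp
    qed
  qed
  have Yr: "Y i (restrict (\<lambda>e. t e \<omega>) (G i)) = Y i (\<lambda>e. t e \<omega>)" for i \<omega>
  proof (cases i)
    case (Inl w)
    have "maxflow (\<lambda>e. restrict (\<lambda>e. t e \<omega>) (G i) ((+) w ` e)) F1 F2 K = maxflow (\<lambda>e. t ((+) w ` e) \<omega>) F1 F2 K"
      by (intro maxflow_cong) (auto simp: Inl G_def)
    then show ?thesis by (simp add: Y_def Inl)
  qed (simp add: Y_def G_def)
  have exp_eq: "ennreal (exp (\<theta> * ((\<Sum>w\<in>W. maxflow (\<lambda>e. t ((+) w ` e) \<omega>) F1 F2 K) + (\<Sum>e\<in>Err. t e \<omega>))))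
     = (\<Prod>i\<in>I. Y i (restrict (\<lambda>e. t e \<omega>) (G i)))" for \<omega>
  proof -
    have "(\<Prod>i\<in>I. Y i (restrict (\<lambda>e. t e \<omega>) (G i))) = (\<Prod>i\<in>Inl ` W. Y i (\<lambda>e. t e \<omega>)) * (\<Prod>i\<in>Inr ` Err. Y i (\<lambda>e. t e \<omega>))"
      unfolding Yr I_def using W Err by (intro prod.union_disjoint) auto
    also have "\<dots> = ennreal (\<Prod>w\<in>W. exp (\<theta> * maxflow (\<lambda>e. t ((+) w ` e) \<omega>) F1 F2 K)) * ennreal (\<Prod>e\<in>Err. exp (\<theta> * t e \<omega>))"
      by (simp add: prod.reindex Y_def prod_ennreal)
    also have "\<dots> = ennreal (exp (\<Sum>w\<in>W. \<theta> * maxflow (\<lambda>e. t ((+) w ` e) \<omega>) F1 F2 K) * exp (\<Sum>e\<in>Err. \<theta> * t e \<omega>))"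
      using W Err by (simp add: exp_sum ennreal_mult prod_nonneg)
    also have "\<dots> = ennreal (exp (\<theta> * ((\<Sum>w\<in>W. maxflow (\<lambda>e. t ((+) w ` e) \<omega>) F1 F2 K) + (\<Sum>e\<in>Err. t e \<omega>))))"
      by (simp add: exp_add[symmetric] sum_distrib_left distrib_left)
    finally show ?thesis by simp
  qed
  have "(\<integral>\<^sup>+\<omega>. ennreal (exp (\<theta> * ((\<Sum>w\<in>W. maxflow (\<lambda>e. t ((+) w ` e) \<omega>) F1 F2 K) + (\<Sum>e\<in>Err. t e \<omega>)))) \<partial>M)
     = (\<Prod>i\<in>I. \<integral>\<^sup>+\<omega>. Y i (restrict (\<lambda>e. t e \<omega>) (G i)) \<partial>M)"
    unfolding exp_eq by (rule indep_vars_nn_integral[OF finI ind]) simp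
  also have "\<dots> = (\<Prod>i\<in>Inl ` W. \<integral>\<^sup>+\<omega>. Y i (\<lambda>e. t e \<omega>) \<partial>M) * (\<Prod>i\<in>Inr ` Err. \<integral>\<^sup>+\<omega>. Y i (\<lambda>e. t e \<omega>) \<partial>M)"
    unfolding Yr I_def using W Err by (intro prod.union_disjoint) auto
  also have "\<dots> \<le> (\<Prod>w\<in>W. ennreal (exp (\<theta> * m))) * (\<Prod>e\<in>Err. ennreal (exp (\<theta> * \<beta>)))"
  proof (intro mult_mono)
    have "(\<integral>\<^sup>+\<omega>. Y (Inl w) (\<lambda>e. t e \<omega>) \<partial>M) \<le> ennreal (exp (\<theta> * m))" if "w \<in> W" for w
    proof -
      have "w \<in> Zd" using that W by blast
      from nn_integral_translate[OF this fin disj, of "\<lambda>x. ennreal (exp (\<theta> * x))"] m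
      show ?thesis by (simp add: Y_def)
    qed
    then show "(\<Prod>i\<in>Inl ` W. \<integral>\<^sup>+\<omega>. Y i (\<lambda>e. t e \<omega>) \<partial>M) \<le> (\<Prod>w\<in>W. ennreal (exp (\<theta> * m)))"
      unfolding prod.reindex[OF inj_Inl] comp_def by (rule prod_mono_ennreal)
    have "(\<integral>\<^sup>+\<omega>. Y (Inr e) (\<lambda>e. t e \<omega>) \<partial>M) \<le> ennreal (exp (\<theta> * \<beta>))" if "e \<in> Err" for e
      using mgf_t[of e \<theta>] that Err \<theta> by (auto simp: Y_def)
    then show "(\<Prod>i\<in>Inr ` Err. \<integral>\<^sup>+\<omega>. Y i (\<lambda>e. t e \<omega>) \<partial>M) \<le> (\<Prod>e\<in>Err. ennreal (exp (\<theta> * \<beta>)))"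
      unfolding prod.reindex[OF inj_Inr] comp_def by (rule prod_mono_ennreal)
  qed auto
  also have "\<dots> = ennreal (exp (\<theta> * (real (card W) * m + real (card Err) * \<beta>)))"
    by (simp add: ennreal_power exp_of_nat_mult[symmetric] distrib_left exp_add mult_ac ennreal_mult)
  finally show ?thesis .
qed

end

section \<open>Exponential moment of a flow through stacked tilings\<close>

text \<open>The count from \<open>tiling\<close> as a function of the two side-length vectors. It
  becomes negligible against the face of the large rectangle when first \<open>l'\<close> and then
  \<open>l\<close> grows.\<close>

definition glue_bound :: "'n::finite \<Rightarrow> ('n \<Rightarrow> real) \<Rightarrow> ('n \<Rightarrow> real) \<Rightarrow> real" where
  "glue_bound k l l' = glue_const TYPE(real^'n) * (face_vol k (\<lambda>i. l' i + 2)
     - face_vol k (\<lambda>i. l' i - 2 * (\<Sum>i\<in>UNIV - {k}. l i + 2 * real CARD('n) + 1) - 4)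
       * face_vol k (\<lambda>i. (l i - 2 * real CARD('n) - 4) / (l i + 2 * real CARD('n) + 1)))"

context fpp
begin

text \<open>The flow is at most the sum of finitely many capacities, and some capacity is at least
  the sum over their number plus one. So a small exponential of the flow is dominated by a sum of
  single exponentials.\<close>

lemma maxflow_exp_integrable:
  fixes K :: "(real^'n) set"
  assumes fin: "finite (edges_in K)" and disj: "F1 \<inter> F2 = {}"
  shows "\<exists>g>0. integrable M (\<lambda>\<omega>. exp (g * maxflow (\<lambda>e. t e \<omega>) F1 F2 K))"
proof (intro exI conjI)
  let ?m = "card (edges_in K)"
  \<comment> \<open>The summand 1 keeps the quotient positive if \<open>K\<close> contains no
    edge.\<close>
  let ?g = "\<gamma> / (real ?m + 1)"
  show g: "0 < ?g" using \<gamma> by simp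
  have EdK: "e \<in> Ed" if "e \<in> edges_in K" for e using that edges_in_subset_Ed[of K] by blast
  show "integrable M (\<lambda>\<omega>. exp (?g * maxflow (\<lambda>e. t e \<omega>) F1 F2 K))"
  proof (rule Bochner_Integration.integrable_bound)
    show "integrable M (\<lambda>\<omega>. 1 + (\<Sum>e\<in>edges_in K. exp (\<gamma> * t e \<omega>)))"
      using EdK integrable_exp_t by (intro Bochner_Integration.integrable_add Bochner_Integration.integrable_sum) auto
    have "(\<lambda>\<omega>. maxflow (\<lambda>e. t e \<omega>) F1 F2 K) \<in> borel_measurable M"
      using EdK t_meas by (intro maxflow_measurable fin disj) auto
    then show "(\<lambda>\<omega>. exp (?g * maxflow (\<lambda>e. t e \<omega>) F1 F2 K)) \<in> borel_measurable M" by simp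
    show "AE \<omega> in M. norm (exp (?g * maxflow (\<lambda>e. t e \<omega>) F1 F2 K)) \<le> norm (1 + (\<Sum>e\<in>edges_in K. exp (\<gamma> * t e \<omega>)))"
      using t_nonneg
    proof eventually_elim
      case (elim \<omega>)
      have tn: "0 \<le> t e \<omega>" if "e \<in> edges_in K" for e using elim EdK that by blast
      let ?S = "\<Sum>e\<in>edges_in K. t e \<omega>" and ?T = "\<Sum>e\<in>edges_in K. exp (\<gamma> * t e \<omega>)"
      have S0: "0 \<le> ?S" and T0: "0 \<le> ?T" using tn by (auto intro: sum_nonneg)
      have "maxflow (\<lambda>e. t e \<omega>) F1 F2 K \<le> ?S"
        using elim by (intro maxflow_le_sum_all fin disj) auto
      then have "exp (?g * maxflow (\<lambda>e. t e \<omega>) F1 F2 K) \<le> exp (?g * ?S)"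
        unfolding exp_le_cancel_iff using g by (intro mult_left_mono) auto
      also have "\<dots> \<le> 1 + ?T"
      proof (cases "edges_in K = {}")
        case False
        have "\<exists>e\<in>edges_in K. ?S / (real ?m + 1) \<le> t e \<omega>"
        proof (rule ccontr)
          assume neg: "\<not> (\<exists>e\<in>edges_in K. ?S / (real ?m + 1) \<le> t e \<omega>)"
          then have "?S \<le> real ?m * (?S / (real ?m + 1))"
            by (intro sum_bounded_above) auto
          then have "?S * (real ?m + 1) \<le> real ?m * ?S" by (simp add: field_simps)
          then have "?S = 0" using S0 by (simp add: algebra_simps)
          then show False using neg False tn by auto
        qed
        then obtain e where e: "e \<in> edges_in K" "?S / (real ?m + 1) \<le> t e \<omega>" by blast
        have "?g * ?S \<le> \<gamma> * t e \<omega>" using mult_left_mono[OF e(2), of \<gamma>] \<gamma> by simp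
        then have "exp (?g * ?S) \<le> exp (\<gamma> * t e \<omega>)" by simp
        also have "\<dots> \<le> ?T" using e(1) fin by (intro member_le_sum) auto
        finally show ?thesis by simp
      qed simp
      finally show ?case using T0 by simp
    qed
  qed
qed

text \<open>Every level in \<open>C\<close> carries its own tiling and gives its own upper bound for
  the same flow. Levels more than \<open>2 * (R + H)\<close> apart use disjoint edges, so the sum of
  these bounds is a sum of independent terms. A single level serves tau, a stack of levels serves
  phi.\<close>

lemma stacked_tilings:
  fixes u u' :: "'n \<Rightarrow> real^'n" and a l a' l' :: "'n \<Rightarrow> real" and k :: 'n and H :: real
  defines "R \<equiv> real CARD('n)"
  defines "K0 \<equiv> rect_cyl u k a l H"
  assumes u: "frame u" "frame u'" and uk: "u k = v" "u' k = v"
    and l: "\<And>i. 2 * R + 4 \<le> l i" and l': "\<And>i. 2 * (\<Sum>i\<in>UNIV - {k}. l i + 2 * R + 1) + 4 \<le> l' i"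
    and H: "2 * R + 1 \<le> H"
    and \<theta>: "0 < \<theta>" "\<theta> \<le> \<gamma> / 2"
    and m: "(\<integral>\<^sup>+\<omega>. ennreal (exp (\<theta> * maxflow (\<lambda>e. t e \<omega>) (bd_above K0 v (a k)) (bd_below K0 v (a k)) K0)) \<partial>M)
        \<le> ennreal (exp (\<theta> * m))" "0 \<le> m"
    and C: "finite C" "\<And>c c'. c \<in> C \<Longrightarrow> c' \<in> C \<Longrightarrow> c \<noteq> c' \<Longrightarrow> 2 * (R + H) < \<bar>c - c'\<bar>"
    and F1: "\<And>x c. x \<in> F1 \<Longrightarrow> c \<in> C \<Longrightarrow> c < x \<bullet> v \<and>
        \<not> (\<bar>x \<bullet> v - c\<bar> \<le> R + H \<and> (\<forall>i. i \<noteq> k \<longrightarrow> a' i + 2 \<le> x \<bullet> u' i \<and> x \<bullet> u' i \<le> a' i + l' i - 2))"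
    and F2: "\<And>x c. x \<in> F2 \<Longrightarrow> c \<in> C \<Longrightarrow> x \<bullet> v < c \<and>
        \<not> (\<bar>x \<bullet> v - c\<bar> \<le> R + H \<and> (\<forall>i. i \<noteq> k \<longrightarrow> a' i + 2 \<le> x \<bullet> u' i \<and> x \<bullet> u' i \<le> a' i + l' i - 2))"
  shows "(\<integral>\<^sup>+\<omega>. ennreal (exp (\<theta> * (real (card C) * maxflow (\<lambda>e. t e \<omega>) F1 F2 (rect_cyl u' k a' l' h')))) \<partial>M)
     \<le> ennreal (exp (\<theta> * (real (card C) * (face_vol k l' / face_vol k l * m + glue_bound k l l' * \<beta>))))"
proof -
  let ?K = "rect_cyl u' k a' l' h'"
  let ?A = "bd_above K0 v (a k)" and ?B = "bd_below K0 v (a k)"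
  have R: "1 \<le> R" unfolding R_def by (simp add: Suc_leI)
  have l0: "0 < l i" for i using l[of i] R by linarith
  have v: "norm v = 1" using frame_norm[OF u(1), of k] uk by simp
  have K: "closed ?K" "convex ?K" "bounded ?K"
    unfolding rect_cyl_frame_box by (rule closed_frame_box convex_frame_box bounded_frame_box[OF u(2)])+
  have K0: "closed K0" "convex K0" "bounded K0"
    unfolding K0_def rect_cyl_frame_box by (rule closed_frame_box convex_frame_box bounded_frame_box[OF u(1)])+
  note fin0 = finite_edges_in[OF K0]
  have "\<forall>c. \<exists>W. finite W \<and> W \<subseteq> Zd \<and> (\<forall>w\<in>W. \<bar>w \<bullet> v + a k - c\<bar> \<le> R) \<and>
     (\<forall>w\<in>W. \<forall>w'\<in>W. w \<noteq> w' \<longrightarrow> (+) w ` K0 \<inter> (+) w' ` K0 = {}) \<and>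
     (\<forall>w\<in>W. \<forall>x\<in>(+) w ` K0. \<forall>i. i \<noteq> k \<longrightarrow> a' i + 2 \<le> x \<bullet> u' i \<and> x \<bullet> u' i \<le> a' i + l' i - 2) \<and>
     real (card W) * face_vol k l \<le> face_vol k l' \<and>
     real (card (glue_edges ?K v c (R + 1) W K0)) \<le> glue_bound k l l'" (is "\<forall>c. \<exists>W. ?P c W")
  proof
    fix c
    show "\<exists>W. ?P c W"
      by (rule tiling[where c = c and a = a and a' = a' and l = l and l' = l',
            OF u uk l[unfolded R_def] l'[unfolded R_def] H[unfolded R_def]])
        (unfold K0_def R_def glue_bound_def, rule exI, intro conjI ballI allI impI; blast)
  qed
  from choice[OF this] obtain W where W: "\<forall>c. ?P c (W c)" ..
  define Err where "Err c = glue_edges ?K v c (R + 1) (W c) K0" for c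
  have level: "\<bar>x \<bullet> v - c\<bar> \<le> R + H" if "w \<in> W c" "x \<in> (+) w ` K0" for w x c
  proof -
    have "\<bar>w \<bullet> v + a k - c\<bar> \<le> R" using W that(1) by blast
    then show ?thesis using that(2) by (auto simp: K0_def rect_cyl_def uk inner_add_left)
  qed
  have ErrEd: "Err c \<subseteq> Ed" for c by (auto simp: Err_def glue_edges_def)
  have Err_fin: "finite (Err c)" for c
    unfolding Err_def glue_edges_def by (rule finite_subset[OF _ finite_edges_subset[OF K(3)]]) auto
  have Err_level: "\<bar>x \<bullet> v - c\<bar> \<le> R + H" if "e \<in> Err c" "x \<in> e" for e x c
    using that H R unfolding Err_def glue_edges_def by fastforce
  have no_level: False if "c \<in> C" "c' \<in> C" "c \<noteq> c'" "\<bar>x - c\<bar> \<le> R + H" "\<bar>x - c'\<bar> \<le> R + H" for c c' x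
  proof -
    have "\<bar>c - c'\<bar> \<le> \<bar>x - c'\<bar> + \<bar>x - c\<bar>"
      using abs_triangle_ineq4[of "x - c'" "x - c"] by simp
    also have "\<dots> \<le> (R + H) + (R + H)" by (rule add_mono[OF that(5,4)])
    finally show False using C(2)[OF that(1-3)] by simp
  qed
  have edge_ne: "e \<noteq> {}" if "e \<in> Ed" for e :: "(real^'n) set" using that by (auto elim: EdE)
  \<comment> \<open>Nonempty tiles force the sets \<open>W c\<close> of different levels to be
    disjoint, so sums over \<open>WW\<close> split by level.\<close>
  define x0 where "x0 = of_coord u (\<chi> i. a i)"
  have x0: "x0 \<in> K0"
    using H R l0 by (auto simp: x0_def K0_def rect_cyl_def of_coord_inner[OF u(1)] less_imp_le)
  have Wdisj: "W c \<inter> W c' = {}" if cc: "c \<in> C" "c' \<in> C" "c \<noteq> c'" for c c'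
  proof -
    have False if w: "w \<in> W c" "w \<in> W c'" for w
    proof -
      have "w + x0 \<in> (+) w ` K0" using x0 by blast
      then show False using no_level[OF cc, of "(w + x0) \<bullet> v"] level w by blast
    qed
    then show ?thesis by blast
  qed
  have Errdisj: "Err c \<inter> Err c' = {}" if cc: "c \<in> C" "c' \<in> C" "c \<noteq> c'" for c c'
  proof -
    have False if e: "e \<in> Err c" "e \<in> Err c'" for e
    proof -
      obtain x where x: "x \<in> e" using edge_ne e(1) ErrEd by blast
      show False using no_level[OF cc, of "x \<bullet> v"] Err_level e x by blast
    qed
    then show ?thesis by blast
  qed
  define WW where "WW = (\<Union>c\<in>C. W c)"
  define EE where "EE = (\<Union>c\<in>C. Err c)"
  have edge_K0: "e \<noteq> {} \<and> e \<subseteq> K0" if "e \<in> edges_in K0" for e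
    using that edge_ne by (auto simp: edges_in_eq[OF K0(1,2)])
  have tiles_disj: "(`) ((+) w) ` edges_in K0 \<inter> (`) ((+) w') ` edges_in K0 = {}"
    if ww: "w \<in> WW" "w' \<in> WW" "w \<noteq> w'" for w w'
  proof -
    obtain c c' where c: "c \<in> C" "w \<in> W c" "c' \<in> C" "w' \<in> W c'" using ww(1,2) unfolding WW_def by blast
    have dd: "(+) w ` K0 \<inter> (+) w' ` K0 = {}"
    proof (cases "c = c'")
      case True
      then show ?thesis using W c ww(3) by blast
    next
      case False
      have False if "x \<in> (+) w ` K0" "x \<in> (+) w' ` K0" for x
        using no_level[OF c(1,3) False, of "x \<bullet> v"] level[OF c(2) that(1)] level[OF c(4) that(2)] by blast
      then show ?thesis by blast
    qed
    have False if e: "e \<in> (`) ((+) w) ` edges_in K0" "e \<in> (`) ((+) w') ` edges_in K0" for e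
    proof -
      have "e \<noteq> {}" "e \<subseteq> (+) w ` K0" "e \<subseteq> (+) w' ` K0" using e edge_K0 by blast+
      then show False using dd by blast
    qed
    then show ?thesis by blast
  qed
  have tiles_Err: "(`) ((+) w) ` edges_in K0 \<inter> EE = {}" if ww: "w \<in> WW" for w
  proof -
    obtain c where c: "c \<in> C" "w \<in> W c" using ww unfolding WW_def by blast
    have False if e: "e \<in> (`) ((+) w) ` edges_in K0" "e \<in> EE" for e
    proof -
      have ee: "e \<noteq> {}" "e \<subseteq> (+) w ` K0" using e edge_K0 by blast+
      obtain c' where c': "c' \<in> C" "e \<in> Err c'" using e(2) unfolding EE_def by blast
      show False
      proof (cases "c = c'")
        case True
        then show False using c' c ee(2) unfolding Err_def glue_edges_def by blast
      next
        case False
        obtain x where x: "x \<in> e" using ee(1) by blast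
        then show False using no_level[OF c(1) c'(1) False, of "x \<bullet> v"] level[OF c(2)] Err_level[OF c'(2) x] ee(2) by blast
      qed
    qed
    then show ?thesis by blast
  qed
  have finWW: "finite WW" and finEE: "finite EE"
    unfolding WW_def EE_def using C(1) W Err_fin by auto
  have WWZ: "WW \<subseteq> Zd" unfolding WW_def using W by blast
  have EEd: "EE \<subseteq> Ed" unfolding EE_def using ErrEd by blast
  have flow: "real (card C) * maxflow (\<lambda>e. t e \<omega>) F1 F2 ?K \<le>
      (\<Sum>w\<in>WW. maxflow (\<lambda>e. t ((+) w ` e) \<omega>) ?A ?B K0) + (\<Sum>e\<in>EE. t e \<omega>)"
    if tn: "\<forall>e\<in>Ed. 0 \<le> t e \<omega>" for \<omega>
  proof -
    have one: "maxflow (\<lambda>e. t e \<omega>) F1 F2 ?K \<le>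
      (\<Sum>w\<in>W c. maxflow (\<lambda>e. t ((+) w ` e) \<omega>) ?A ?B K0) + (\<Sum>e\<in>Err c. t e \<omega>)" if c: "c \<in> C" for c
      unfolding Err_def
    proof (rule maxflow_le_glued[OF v K K0])
      show "finite (W c)" "W c \<subseteq> Zd" using W by blast+
      show "\<bar>w \<bullet> v + a k - c\<bar> \<le> R" if "w \<in> W c" for w using W that by blast
      show "(+) w ` K0 \<inter> (+) w' ` K0 = {}" if "w \<in> W c" "w' \<in> W c" "w \<noteq> w'" for w w' using W that by blast
      have in_tile: "\<bar>x \<bullet> v - c\<bar> \<le> R + H \<and> (\<forall>i. i \<noteq> k \<longrightarrow> a' i + 2 \<le> x \<bullet> u' i \<and> x \<bullet> u' i \<le> a' i + l' i - 2)"
        if "w \<in> W c" "x \<in> (+) w ` K0" for w x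
        using level[OF that] W that by blast
      show "x \<notin> (+) w ` K0" if "x \<in> F1" "w \<in> W c" for x w using in_tile[OF that(2), of x] F1[OF that(1) c] by blast
      show "x \<notin> (+) w ` K0" if "x \<in> F2" "w \<in> W c" for x w using in_tile[OF that(2), of x] F2[OF that(1) c] by blast
      show "c < x \<bullet> v" if "x \<in> F1" for x using F1[OF that c] by blast
      show "x \<bullet> v < c" if "x \<in> F2" for x using F2[OF that c] by blast
    qed (use R tn in auto)
    \<comment> \<open>The flow is repeated once per level and each copy is bounded by a different
      tiling.\<close>
    have "real (card C) * maxflow (\<lambda>e. t e \<omega>) F1 F2 ?K = (\<Sum>c\<in>C. maxflow (\<lambda>e. t e \<omega>) F1 F2 ?K)" by simp
    also have "\<dots> \<le> (\<Sum>c\<in>C. (\<Sum>w\<in>W c. maxflow (\<lambda>e. t ((+) w ` e) \<omega>) ?A ?B K0) + (\<Sum>e\<in>Err c. t e \<omega>))"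
      by (intro sum_mono one)
    also have "\<dots> = (\<Sum>w\<in>WW. maxflow (\<lambda>e. t ((+) w ` e) \<omega>) ?A ?B K0) + (\<Sum>e\<in>EE. t e \<omega>)"
      unfolding WW_def EE_def sum.distrib using C(1) W Err_fin Wdisj Errdisj
      by (subst (1 2) sum.UNION_disjoint) auto
    finally show ?thesis .
  qed
  have P: "0 < face_vol k l" using l0 by (intro prod_pos) auto
  have cardWW: "real (card WW) \<le> real (card C) * (face_vol k l' / face_vol k l)"
  proof -
    have "real (card WW) = (\<Sum>c\<in>C. real (card (W c)))"
      unfolding WW_def using C(1) W Wdisj by (subst card_UN_disjoint) auto
    also have "\<dots> \<le> (\<Sum>c\<in>C. face_vol k l' / face_vol k l)"
      using W P by (intro sum_mono) (simp add: field_simps)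
    finally show ?thesis by simp
  qed
  have cardEE: "real (card EE) \<le> real (card C) * glue_bound k l l'"
  proof -
    have "real (card EE) = (\<Sum>c\<in>C. real (card (Err c)))"
      unfolding EE_def using C(1) Err_fin Errdisj by (subst card_UN_disjoint) auto
    also have "\<dots> \<le> (\<Sum>c\<in>C. glue_bound k l l')"
      using W by (intro sum_mono) (simp add: Err_def)
    finally show ?thesis by simp
  qed
  have "(\<integral>\<^sup>+\<omega>. ennreal (exp (\<theta> * (real (card C) * maxflow (\<lambda>e. t e \<omega>) F1 F2 ?K))) \<partial>M) \<le>
     (\<integral>\<^sup>+\<omega>. ennreal (exp (\<theta> * ((\<Sum>w\<in>WW. maxflow (\<lambda>e. t ((+) w ` e) \<omega>) ?A ?B K0) + (\<Sum>e\<in>EE. t e \<omega>)))) \<partial>M)"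
  proof (rule nn_integral_mono_AE)
    show "AE \<omega> in M. ennreal (exp (\<theta> * (real (card C) * maxflow (\<lambda>e. t e \<omega>) F1 F2 ?K)))
        \<le> ennreal (exp (\<theta> * ((\<Sum>w\<in>WW. maxflow (\<lambda>e. t ((+) w ` e) \<omega>) ?A ?B K0) + (\<Sum>e\<in>EE. t e \<omega>))))"
      using t_nonneg
    proof eventually_elim
      case (elim \<omega>)
      then show ?case using mult_left_mono[OF flow[OF elim], of \<theta>] \<theta>(1) by (intro ennreal_leI) simp
    qed
  qed
  also have "\<dots> \<le> ennreal (exp (\<theta> * (real (card WW) * m + real (card EE) * \<beta>)))"
    by (rule mgf_tiles[OF finWW WWZ finEE EEd fin0 bd_above_below_disjoint tiles_disj tiles_Err \<theta> m(1)])
  also have "\<dots> \<le> ennreal (exp (\<theta> * (real (card C) * (face_vol k l' / face_vol k l * m + glue_bound k l l' * \<beta>))))"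
  proof -
    have "real (card WW) * m + real (card EE) * \<beta>
        \<le> real (card C) * (face_vol k l' / face_vol k l) * m + real (card C) * glue_bound k l l' * \<beta>"
      using cardWW cardEE m(2) \<beta>_nonneg by (intro add_mono mult_right_mono) auto
    also have "\<dots> = real (card C) * (face_vol k l' / face_vol k l * m + glue_bound k l l' * \<beta>)"
      by (simp add: algebra_simps)
    finally show ?thesis using \<theta>(1) by (intro ennreal_leI) simp
  qed
  finally show ?thesis .
qed

end

section \<open>Comparison of flows at two scales\<close>

lemma affine_ratio_tendsto_1:
  fixes l c d :: real
  assumes "0 < l"
  shows "(\<lambda>n. (real n * l + c) / (real n * l + d)) \<longlonglongrightarrow> 1"
proof -
  have top: "filterlim (\<lambda>n. d + l * real n) at_top sequentially"
    using assms by (intro filterlim_tendsto_add_at_top[OF tendsto_const]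
        filterlim_tendsto_pos_mult_at_top[OF tendsto_const] filterlim_real_sequentially)
  have "(\<lambda>n. 1 + (c - d) / (d + l * real n)) \<longlonglongrightarrow> 1 + 0"
    by (intro tendsto_add tendsto_const tendsto_divide_0[OF tendsto_const] filterlim_at_top_imp_at_infinity top)
  moreover have "\<forall>\<^sub>F n in sequentially. 1 + (c - d) / (d + l * real n) = (real n * l + c) / (real n * l + d)"
    using filterlim_at_top_dense[THEN iffD1, OF top, rule_format, of 0]
    by eventually_elim (simp add: field_simps)
  ultimately show ?thesis by (simp add: tendsto_cong)
qed

lemma prod_tendsto_1:
  fixes f :: "'a \<Rightarrow> nat \<Rightarrow> real"
  assumes "\<And>i. i \<in> S \<Longrightarrow> (\<lambda>n. f i n) \<longlonglongrightarrow> 1"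
  shows "(\<lambda>n. \<Prod>i\<in>S. f i n) \<longlonglongrightarrow> 1"
  using tendsto_prod[of S f "\<lambda>_. 1" sequentially] assms by simp

text \<open>The order of limits matters. For a fixed tile the rim terms vanish relative to the face
  as \<open>N\<close> grows, leaving the fraction of a cell outside its core; this fraction tends to
  0 only as the tile grows.\<close>

lemma glue_bound_eventually:
  fixes l :: "'n::finite \<Rightarrow> real"
  assumes l: "\<And>i. 0 < l i" and \<epsilon>: "0 < \<epsilon>"
  shows "\<forall>\<^sub>F n in sequentially. \<forall>l'. (\<forall>i. 0 < l' i) \<longrightarrow> (\<forall>\<^sub>F N in sequentially.
     glue_bound k (\<lambda>i. real n * l i) (\<lambda>i. real N * l' i) \<le> \<epsilon> * face_vol k (\<lambda>i. real N * l' i))"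
proof -
  let ?G = "glue_const TYPE(real^'n)" and ?R = "real CARD('n)"
  let ?D = "\<lambda>n. \<Sum>i\<in>UNIV - {k}. real n * l i + 2 * ?R + 1"
  \<comment> \<open>The fraction of a cell's face that is covered by the box \<open>?G\<close> of
    \<open>tiling\<close>.\<close>
  define q where "q n = face_vol k (\<lambda>i. (real n * l i - 2 * ?R - 4) / (real n * l i + 2 * ?R + 1))" for n
  have "(\<lambda>n. (real n * l i - 2 * ?R - 4) / (real n * l i + 2 * ?R + 1)) \<longlonglongrightarrow> 1" for i
    using affine_ratio_tendsto_1[OF l[of i], of "- 2 * ?R - 4" "2 * ?R + 1"] by (simp add: algebra_simps)
  then have "q \<longlonglongrightarrow> 1" unfolding q_def[abs_def] by (intro prod_tendsto_1)
  then have "(\<lambda>n. ?G * (1 - 1 * q n)) \<longlonglongrightarrow> ?G * (1 - 1 * 1)" by (intro tendsto_intros)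
  then have "\<forall>\<^sub>F n in sequentially. ?G * (1 - 1 * q n) < \<epsilon>" using \<epsilon> by (intro order_tendstoD) auto
  then show ?thesis
  proof (eventually_elim, intro allI impI)
    fix n and l' :: "'n \<Rightarrow> real" assume n: "?G * (1 - 1 * q n) < \<epsilon>" and "\<forall>i. 0 < l' i"
    then have l': "0 < l' i" for i by blast
    have "(\<lambda>N. \<Prod>i\<in>UNIV - {k}. (real N * l' i + 2) / (real N * l' i)) \<longlonglongrightarrow> 1"
      using affine_ratio_tendsto_1[OF l', of _ 2 0] by (intro prod_tendsto_1) simp
    moreover have "(\<lambda>N. \<Prod>i\<in>UNIV - {k}. (real N * l' i - 2 * ?D n - 4) / (real N * l' i)) \<longlonglongrightarrow> 1"
      using affine_ratio_tendsto_1[OF l', of _ "- 2 * ?D n - 4" 0] by (intro prod_tendsto_1) (simp add: algebra_simps)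
    ultimately have "(\<lambda>N. ?G * ((\<Prod>i\<in>UNIV - {k}. (real N * l' i + 2) / (real N * l' i))
        - (\<Prod>i\<in>UNIV - {k}. (real N * l' i - 2 * ?D n - 4) / (real N * l' i)) * q n)) \<longlonglongrightarrow> ?G * (1 - 1 * q n)"
      by (intro tendsto_intros)
    then have "\<forall>\<^sub>F N in sequentially. ?G * ((\<Prod>i\<in>UNIV - {k}. (real N * l' i + 2) / (real N * l' i))
        - (\<Prod>i\<in>UNIV - {k}. (real N * l' i - 2 * ?D n - 4) / (real N * l' i)) * q n) < \<epsilon>"
      using n by (rule order_tendstoD)
    then show "\<forall>\<^sub>F N in sequentially.
       glue_bound k (\<lambda>i. real n * l i) (\<lambda>i. real N * l' i) \<le> \<epsilon> * face_vol k (\<lambda>i. real N * l' i)"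
      using eventually_gt_at_top[of 0]
    proof eventually_elim
      case (elim N)
      let ?P = "face_vol k (\<lambda>i. real N * l' i)"
      have P: "0 < ?P" using l' elim by (intro prod_pos) auto
      have "glue_bound k (\<lambda>i. real n * l i) (\<lambda>i. real N * l' i) = ?G * ((\<Prod>i\<in>UNIV - {k}. (real N * l' i + 2) / (real N * l' i))
        - (\<Prod>i\<in>UNIV - {k}. (real N * l' i - 2 * ?D n - 4) / (real N * l' i)) * q n) * ?P"
      proof -
        have "G * (x - y * z) = G * (x / p - y / p * z) * p" if "0 < p" for G x y z p :: real
          using that by (simp add: field_simps)
        from this[OF P] show ?thesis unfolding prod_dividef glue_bound_def q_def .
      qed
      also have "\<dots> \<le> \<epsilon> * ?P" using elim P by (intro mult_right_mono) auto
      finally show ?case .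
    qed
  qed
qed

lemma face_vol_at_top:
  fixes l :: "'n::finite \<Rightarrow> real"
  assumes d: "2 \<le> CARD('n)" and l: "\<And>i. 0 < l i"
  shows "filterlim (\<lambda>N. face_vol k (\<lambda>i. real N * l i)) at_top sequentially"
proof (rule filterlim_at_top_mono)
  have P: "0 < face_vol k l" using l by (intro prod_pos) auto
  show "filterlim (\<lambda>N. face_vol k l * real N) at_top sequentially"
    by (rule filterlim_tendsto_pos_mult_at_top[OF tendsto_const P filterlim_real_sequentially])
  show "\<forall>\<^sub>F N in sequentially. face_vol k l * real N \<le> face_vol k (\<lambda>i. real N * l i)"
    using eventually_gt_at_top[of 0]
  proof eventually_elim
    case (elim N)
    have "real N ^ 1 \<le> real N ^ (CARD('n) - 1)" using elim d by (intro power_increasing) auto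
    then show ?case using P by (simp add: prod.distrib mult.commute)
  qed
qed

context fpp
begin

abbreviation tau_scaled :: "('n \<Rightarrow> real^'n) \<Rightarrow> 'n \<Rightarrow> ('n \<Rightarrow> real) \<Rightarrow> ('n \<Rightarrow> real) \<Rightarrow> (nat \<Rightarrow> real) \<Rightarrow> nat \<Rightarrow> 'w \<Rightarrow> real" where
  "tau_scaled u k a l h n \<omega> \<equiv> tau (rect u k (\<lambda>i. real n * a i) (\<lambda>i. real n * l i)) (h n) (u k) (\<lambda>e. t e \<omega>)"

abbreviation phi_scaled :: "('n \<Rightarrow> real^'n) \<Rightarrow> 'n \<Rightarrow> ('n \<Rightarrow> real) \<Rightarrow> ('n \<Rightarrow> real) \<Rightarrow> (nat \<Rightarrow> real) \<Rightarrow> nat \<Rightarrow> 'w \<Rightarrow> real" where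
  "phi_scaled u k a l h n \<omega> \<equiv> phi (rect u k (\<lambda>i. real n * a i) (\<lambda>i. real n * l i)) (h n) (u k) (\<lambda>e. t e \<omega>)"

text \<open>Normalised by the product of the side lengths; the Hausdorff constant is divided out
  only in \<open>nu_eq\<close>.\<close>

definition mean_tau :: "('n \<Rightarrow> real^'n) \<Rightarrow> 'n \<Rightarrow> ('n \<Rightarrow> real) \<Rightarrow> ('n \<Rightarrow> real) \<Rightarrow> (nat \<Rightarrow> real) \<Rightarrow> nat \<Rightarrow> real" where
  "mean_tau u k a l h n = expectation (tau_scaled u k a l h n) / face_vol k (\<lambda>i. real n * l i)"

lemma tau_basic:
  fixes u :: "'n \<Rightarrow> real^'n" and k :: 'n and a l :: "'n \<Rightarrow> real" and H :: real
  assumes u: "frame u" and l: "\<And>i. 0 < l i" and H: "0 < H"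
  defines "Y \<equiv> \<lambda>\<omega>. tau (rect u k a l) H (u k) (\<lambda>e. t e \<omega>)"
  shows "Y \<in> borel_measurable M" "AE \<omega> in M. 0 \<le> Y \<omega>" "\<exists>g>0. integrable M (\<lambda>\<omega>. exp (g * Y \<omega>))"
proof -
  let ?K = "rect_cyl u k a l H"
  have K: "closed ?K" "convex ?K" "bounded ?K"
    unfolding rect_cyl_frame_box by (rule closed_frame_box convex_frame_box bounded_frame_box[OF u])+
  note fin = finite_edges_in[OF K] and disj = bd_above_below_disjoint[of ?K "u k" "a k"]
  have Y_eq: "Y = (\<lambda>\<omega>. maxflow (\<lambda>e. t e \<omega>) (bd_above ?K (u k) (a k)) (bd_below ?K (u k) (a k)) ?K)"
    unfolding Y_def tau_rect[where l = l, OF u l H] ..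
  show "Y \<in> borel_measurable M"
    unfolding Y_eq using edges_in_subset_Ed[of ?K] t_meas by (intro maxflow_measurable fin disj) auto
  show "AE \<omega> in M. 0 \<le> Y \<omega>"
    using t_nonneg unfolding Y_eq by eventually_elim (intro maxflow_nonneg fin disj; blast)
  show "\<exists>g>0. integrable M (\<lambda>\<omega>. exp (g * Y \<omega>))"
    unfolding Y_eq by (rule maxflow_exp_integrable[OF fin disj])
qed

lemma tau_integrable:
  fixes u :: "'n \<Rightarrow> real^'n"
  assumes u: "frame u" and l: "\<And>i. 0 < l i" and H: "0 < H"
  shows "integrable M (\<lambda>\<omega>. tau (rect u k a l) H (u k) (\<lambda>e. t e \<omega>))"
    "0 \<le> expectation (\<lambda>\<omega>. tau (rect u k a l) H (u k) (\<lambda>e. t e \<omega>))"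
proof -
  note Y = tau_basic[where k = k and a = a and l = l, OF assms]
  obtain g where g: "0 < g" "integrable M (\<lambda>\<omega>. exp (g * tau (rect u k a l) H (u k) (\<lambda>e. t e \<omega>)))"
    using Y(3) by blast
  show "integrable M (\<lambda>\<omega>. tau (rect u k a l) H (u k) (\<lambda>e. t e \<omega>))"
    "0 \<le> expectation (\<lambda>\<omega>. tau (rect u k a l) H (u k) (\<lambda>e. t e \<omega>))"
    by (rule small_exponential_moment(1,2)[OF Y(1,2) g(2,1) zero_less_one])+
qed

section \<open>Position of sources and sinks relative to the tiles\<close>

lemma Ed_dist_le:
  assumes "{x, y} \<in> Ed" "norm v = 1"
  shows "\<bar>x \<bullet> v - y \<bullet> (v :: real^'n)\<bar> \<le> 1"
proof -
  have "\<bar>x \<bullet> v - y \<bullet> v\<bar> \<le> norm (x - y) * norm v"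
    using Cauchy_Schwarz_ineq2[of "x - y" v] by (simp add: inner_diff_left)
  then show ?thesis using assms by (simp add: Ed_iff dist_norm)
qed

text \<open>One step of length 1 cannot leave the cylinder from the region occupied by tiles, which
  keeps a margin of 2 laterally and of 1 vertically.\<close>

lemma tau_outside_tiles:
  fixes u :: "'n \<Rightarrow> real^'n"
  assumes u: "frame u" and x: "x \<in> rect_cyl u k a l h" "{x, y} \<in> Ed" "y \<notin> rect_cyl u k a l h"
    and h: "r + 1 \<le> h"
  shows "\<not> (\<bar>x \<bullet> u k - a k\<bar> \<le> r \<and> (\<forall>i. i \<noteq> k \<longrightarrow> a i + 2 \<le> x \<bullet> u i \<and> x \<bullet> u i \<le> a i + l i - 2))"
proof
  assume A: "\<bar>x \<bullet> u k - a k\<bar> \<le> r \<and> (\<forall>i. i \<noteq> k \<longrightarrow> a i + 2 \<le> x \<bullet> u i \<and> x \<bullet> u i \<le> a i + l i - 2)"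
  have d: "\<bar>x \<bullet> u i - y \<bullet> u i\<bar> \<le> 1" for i by (rule Ed_dist_le[OF x(2) frame_norm[OF u]])
  have "\<bar>y \<bullet> u k - a k\<bar> \<le> h" using A d[of k] h by linarith
  moreover have "a i \<le> y \<bullet> u i \<and> y \<bullet> u i \<le> a i + l i" if "i \<noteq> k" for i
  proof -
    have "a i + 2 \<le> x \<bullet> u i" "x \<bullet> u i \<le> a i + l i - 2" using A that by auto
    then show ?thesis using d[of i] by linarith
  qed
  ultimately show False using x(3) by (simp add: rect_cyl_def)
qed

lemma segment_near_end:
  fixes x y z v :: "real^'n"
  assumes "{x, y} \<in> Ed" "norm v = 1" "z \<in> closed_segment x y"
  shows "\<bar>x \<bullet> v - z \<bullet> v\<bar> \<le> 1"
proof -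
  obtain s where s: "0 \<le> s" "s \<le> 1" "z = (1 - s) *\<^sub>R x + s *\<^sub>R y"
    using assms(3) by (auto simp: in_segment)
  have "x \<bullet> v - z \<bullet> v = s * (x \<bullet> v - y \<bullet> v)" by (simp add: s(3) algebra_simps)
  then have "\<bar>x \<bullet> v - z \<bullet> v\<bar> = s * \<bar>x \<bullet> v - y \<bullet> v\<bar>" using s(1) by (simp add: abs_mult)
  also have "\<dots> \<le> 1 * 1" using s Ed_dist_le[OF assms(1,2)] by (intro mult_mono) auto
  finally show ?thesis by simp
qed

text \<open>The defining edge has length 1 and meets the shifted rectangle, so its endpoint is
  within 1 of that height.\<close>

lemma top_bot_level:
  fixes u :: "'n \<Rightarrow> real^'n"
  assumes u: "frame u"
  shows "x \<in> top_cyl (rect u k a l) h (u k) \<Longrightarrow> a k + h - 1 \<le> x \<bullet> u k"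
    and "x \<in> bot_cyl (rect u k a l) h (u k) \<Longrightarrow> x \<bullet> u k \<le> a k - h + 1"
proof -
  assume "x \<in> top_cyl (rect u k a l) h (u k)"
  then obtain y p where p: "{x, y} \<in> Ed" "p \<in> rect u k a l" "p + h *\<^sub>R u k \<in> closed_segment x y"
    unfolding top_cyl_def by blast
  have "(p + h *\<^sub>R u k) \<bullet> u k = a k + h" using p(2) by (simp add: rect_def inner_add_left frame_inner[OF u])
  then show "a k + h - 1 \<le> x \<bullet> u k" using segment_near_end[OF p(1) frame_norm[OF u] p(3), of k] by linarith
next
  assume "x \<in> bot_cyl (rect u k a l) h (u k)"
  then obtain y p where p: "{x, y} \<in> Ed" "p \<in> rect u k a l" "p - h *\<^sub>R u k \<in> closed_segment x y"
    unfolding bot_cyl_def by blast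
  have "(p - h *\<^sub>R u k) \<bullet> u k = a k - h" using p(2) by (simp add: rect_def inner_diff_left frame_inner[OF u])
  then show "x \<bullet> u k \<le> a k - h + 1" using segment_near_end[OF p(1) frame_norm[OF u] p(3), of k] by linarith
qed

text \<open>The order of quantifiers is the point: \<open>\<theta>\<close> and \<open>s\<close> are
  chosen from the reference tile at scale \<open>n\<close> alone, before the other rectangle, its
  height function and \<open>N\<close>. So \<open>\<theta>\<close> stays fixed while the face volume
  grows.\<close>

lemma flow_comparison:
  fixes u :: "'n \<Rightarrow> real^'n"
  assumes u: "frame u" and l: "\<And>i. 0 < l i" and h: "filterlim h at_top sequentially" and \<epsilon>: "0 < \<epsilon>"
  shows "\<forall>\<^sub>F n in sequentially. \<exists>\<theta>>0. \<exists>s>0. \<forall>u' a' l' h'.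
     frame u' \<and> u' k = u k \<and> (\<forall>i. 0 < l' i) \<and> filterlim h' at_top sequentially \<longrightarrow>
     (\<forall>\<^sub>F N in sequentially.
        (\<integral>\<^sup>+\<omega>. ennreal (exp (\<theta> * tau_scaled u' k a' l' h' N \<omega>)) \<partial>M)
          \<le> ennreal (exp (\<theta> * (face_vol k (\<lambda>i. real N * l' i) * (mean_tau u k a l h n + \<epsilon>)))) \<and>
        (\<integral>\<^sup>+\<omega>. ennreal (exp (\<theta> * (real (nat \<lfloor>h' N / s\<rfloor>) * phi_scaled u' k a' l' h' N \<omega>))) \<partial>M)
          \<le> ennreal (exp (\<theta> * (real (nat \<lfloor>h' N / s\<rfloor>) * (face_vol k (\<lambda>i. real N * l' i) * (mean_tau u k a l h n + \<epsilon>))))))"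
proof -
  let ?R = "real CARD('n)"
  \<comment> \<open>The error budget: glue edges may cost \<open>\<epsilon> / 2\<close> per unit of
    face, the tile moments the other half. Adding 1 to \<open>\<beta>\<close> allows
    \<open>\<beta> = 0\<close>.\<close>
  define \<delta> where "\<delta> = \<epsilon> / (2 * (\<beta> + 1))"
  have \<delta>: "0 < \<delta>" "\<delta> * \<beta> \<le> \<epsilon> / 2"
    using \<epsilon> \<beta>_nonneg by (auto simp: \<delta>_def field_simps)
  have big: "\<forall>\<^sub>F n in sequentially. \<forall>i. c \<le> real n * l i" if l: "\<And>i. 0 < l i" for c and l :: "'n \<Rightarrow> real"
  proof -
    have "\<forall>\<^sub>F n in sequentially. c \<le> real n * l i" for i
    proof -
      have "filterlim (\<lambda>n. l i * real n) at_top sequentially"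
        by (rule filterlim_tendsto_pos_mult_at_top[OF tendsto_const l filterlim_real_sequentially])
      then show ?thesis unfolding filterlim_at_top by (simp add: mult.commute)
    qed
    then show ?thesis by (simp add: eventually_all_finite)
  qed
  have hb: "\<forall>\<^sub>F n in sequentially. 2 * ?R + 1 \<le> h n" using h unfolding filterlim_at_top by blast
  show ?thesis
    using glue_bound_eventually[where k = k and l = l, OF l \<delta>(1)] big[of l, OF l, of "2 * ?R + 4"] hb eventually_gt_at_top[of 0]
  proof eventually_elim
    case (elim n)
    define ln where "ln i = real n * l i" for i
    define an where "an i = real n * a i" for i
    define H where "H = h n"
    have lnp: "0 < ln i" for i using elim l by (simp add: ln_def)
    have ln4: "2 * ?R + 4 \<le> ln i" for i using elim by (simp add: ln_def)
    have H1: "2 * ?R + 1 \<le> H" using elim by (simp add: H_def)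
    then have H0: "0 < H" by (smt (verit) of_nat_0_le_iff)
    define K0 where "K0 = rect_cyl u k an ln H"
    define P where "P = face_vol k ln"
    have P: "0 < P" unfolding P_def using lnp by (intro prod_pos) auto
    let ?Y = "\<lambda>\<omega>. tau (rect u k an ln) H (u k) (\<lambda>e. t e \<omega>)"
    note Y = tau_basic[where k = k and a = an and l = ln, OF u lnp H0]
    define \<epsilon>' where "\<epsilon>' = \<epsilon> / 2 * P"
    have \<epsilon>': "0 < \<epsilon>'" using \<epsilon> P by (simp add: \<epsilon>'_def)
    obtain g where g: "0 < g" "integrable M (\<lambda>\<omega>. exp (g * ?Y \<omega>))" using Y(3) by blast
    obtain \<theta>0 where \<theta>0: "0 < \<theta>0" "\<And>\<theta>. 0 < \<theta> \<Longrightarrow> \<theta> \<le> \<theta>0 \<Longrightarrow>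
       (\<integral>\<^sup>+\<omega>. ennreal (exp (\<theta> * ?Y \<omega>)) \<partial>M) \<le> ennreal (exp (\<theta> * (expectation ?Y + \<epsilon>')))"
      using small_exponential_moment(3)[OF Y(1,2) g(2,1) \<epsilon>'] by blast
    \<comment> \<open>The bound \<open>\<theta>0\<close> makes the tile moment small,
      \<open>\<gamma> / 2\<close> is the range for single glue edges.\<close>
    define \<theta> where "\<theta> = min \<theta>0 (\<gamma> / 2)"
    have \<theta>: "0 < \<theta>" "\<theta> \<le> \<gamma> / 2" "\<theta> \<le> \<theta>0" using \<theta>0(1) \<gamma> by (auto simp: \<theta>_def)
    define m where "m = expectation ?Y + \<epsilon>'"
    have m0: "0 \<le> m" using tau_integrable(2)[where k = k and a = an and l = ln, OF u lnp H0] \<epsilon>' by (simp add: m_def)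
    have mgf: "(\<integral>\<^sup>+\<omega>. ennreal (exp (\<theta> * maxflow (\<lambda>e. t e \<omega>) (bd_above K0 (u k) (an k)) (bd_below K0 (u k) (an k)) K0)) \<partial>M)
        \<le> ennreal (exp (\<theta> * m))"
      using \<theta>0(2)[OF \<theta>(1,3)] unfolding m_def K0_def tau_rect[where l = ln, OF u lnp H0] .
    \<comment> \<open>Slabs of half height \<open>R + H\<close> around levels with this spacing are
      disjoint; the additional 3 makes this strict and absorbs the edge length at the top.\<close>
    define s where "s = 2 * (?R + H) + 3"
    have s: "0 < s" using H0 by (simp add: s_def)
    have mean: "mean_tau u k a l h n = expectation ?Y / P"
      unfolding mean_tau_def P_def ln_def[abs_def] an_def[abs_def] H_def ..
    have mP: "m / P = mean_tau u k a l h n + \<epsilon> / 2" using P by (simp add: m_def \<epsilon>'_def mean field_simps)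
    have glue: "\<forall>\<^sub>F N in sequentially. glue_bound k ln (\<lambda>i. real N * l' i) \<le> \<delta> * face_vol k (\<lambda>i. real N * l' i)"
      if "\<forall>i. 0 < l' i" for l'
      using elim(1) that unfolding ln_def[abs_def] by blast
    have main: "\<forall>\<^sub>F N in sequentially.
        (\<integral>\<^sup>+\<omega>. ennreal (exp (\<theta> * tau_scaled u' k a' l' h' N \<omega>)) \<partial>M)
          \<le> ennreal (exp (\<theta> * (face_vol k (\<lambda>i. real N * l' i) * (mean_tau u k a l h n + \<epsilon>)))) \<and>
        (\<integral>\<^sup>+\<omega>. ennreal (exp (\<theta> * (real (nat \<lfloor>h' N / s\<rfloor>) * phi_scaled u' k a' l' h' N \<omega>))) \<partial>M)
          \<le> ennreal (exp (\<theta> * (real (nat \<lfloor>h' N / s\<rfloor>) * (face_vol k (\<lambda>i. real N * l' i) * (mean_tau u k a l h n + \<epsilon>)))))"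
      if u': "frame u'" and uk: "u' k = u k" and l': "\<forall>i. 0 < l' i" and h': "filterlim h' at_top sequentially"
      for u' a' l' h'
    proof -
      have "\<forall>\<^sub>F N in sequentially. ?R + H + 2 \<le> h' N" using h' unfolding filterlim_at_top by blast
      moreover have "\<forall>\<^sub>F N in sequentially. \<forall>i. 2 * (\<Sum>i\<in>UNIV - {k}. ln i + 2 * ?R + 1) + 4 \<le> real N * l' i"
        using l' by (intro big) auto
      ultimately show ?thesis using glue[OF l'] eventually_gt_at_top[of 0]
      proof eventually_elim
        case (elim N)
        define aN where "aN i = real N * a' i" for i
        define lN where "lN i = real N * l' i" for i
        define hN where "hN = h' N"
        define Q where "Q = face_vol k lN"
        have hN: "?R + H + 2 \<le> hN" using elim by (simp add: hN_def)
        have lN4: "2 * (\<Sum>i\<in>UNIV - {k}. ln i + 2 * ?R + 1) + 4 \<le> lN i" for i using elim by (simp add: lN_def)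
        have lNp: "0 < lN i" for i using l' elim by (simp add: lN_def)
        have hN0: "0 < hN" using hN H0 by (smt (verit) of_nat_0_le_iff)
        have Q: "0 < Q" unfolding Q_def using lNp by (intro prod_pos) auto
        have gb: "glue_bound k ln lN \<le> \<delta> * Q" using elim unfolding lN_def[abs_def] Q_def by blast
        have total: "Q / P * m + glue_bound k ln lN * \<beta> \<le> Q * (mean_tau u k a l h n + \<epsilon>)"
        proof -
          have "Q / P * m = Q * (mean_tau u k a l h n + \<epsilon> / 2)" unfolding mP[symmetric] by simp
          moreover have "glue_bound k ln lN * \<beta> \<le> Q * (\<epsilon> / 2)"
          proof -
            have "glue_bound k ln lN * \<beta> \<le> \<delta> * Q * \<beta>" using gb \<beta>_nonneg by (rule mult_right_mono)
            also have "\<dots> = Q * (\<delta> * \<beta>)" by simp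
            also have "\<dots> \<le> Q * (\<epsilon> / 2)" using \<delta>(2) Q by (intro mult_left_mono) auto
            finally show ?thesis .
          qed
          ultimately show ?thesis by (simp add: algebra_simps)
        qed
        let ?K = "rect_cyl u' k aN lN hN"
        have stacked: "(\<integral>\<^sup>+\<omega>. ennreal (exp (\<theta> * (real (card C) * maxflow (\<lambda>e. t e \<omega>) F1 F2 ?K))) \<partial>M)
           \<le> ennreal (exp (\<theta> * (real (card C) * (Q * (mean_tau u k a l h n + \<epsilon>)))))"
          if C: "finite C" "\<And>c c'. c \<in> C \<Longrightarrow> c' \<in> C \<Longrightarrow> c \<noteq> c' \<Longrightarrow> 2 * (?R + H) < \<bar>c - c'\<bar>"
          and F1: "\<And>x c. x \<in> F1 \<Longrightarrow> c \<in> C \<Longrightarrow> c < x \<bullet> u k \<and>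
              \<not> (\<bar>x \<bullet> u k - c\<bar> \<le> ?R + H \<and> (\<forall>i. i \<noteq> k \<longrightarrow> aN i + 2 \<le> x \<bullet> u' i \<and> x \<bullet> u' i \<le> aN i + lN i - 2))"
          and F2: "\<And>x c. x \<in> F2 \<Longrightarrow> c \<in> C \<Longrightarrow> x \<bullet> u k < c \<and>
              \<not> (\<bar>x \<bullet> u k - c\<bar> \<le> ?R + H \<and> (\<forall>i. i \<noteq> k \<longrightarrow> aN i + 2 \<le> x \<bullet> u' i \<and> x \<bullet> u' i \<le> aN i + lN i - 2))"
          for C F1 F2
        proof -
          have "(\<integral>\<^sup>+\<omega>. ennreal (exp (\<theta> * (real (card C) * maxflow (\<lambda>e. t e \<omega>) F1 F2 ?K))) \<partial>M)
            \<le> ennreal (exp (\<theta> * (real (card C) * (face_vol k lN / face_vol k ln * m + glue_bound k ln lN * \<beta>))))"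
            by (rule stacked_tilings[where l = ln and l' = lN, OF u u' refl uk ln4 lN4 H1 \<theta>(1,2) mgf[unfolded K0_def] m0 C F1 F2])
          also have "\<dots> \<le> ennreal (exp (\<theta> * (real (card C) * (Q * (mean_tau u k a l h n + \<epsilon>)))))"
            using total \<theta>(1) unfolding P_def Q_def by (intro ennreal_leI) (simp add: mult_left_mono)
          finally show ?thesis .
        qed
        have 1: "(\<integral>\<^sup>+\<omega>. ennreal (exp (\<theta> * tau (rect u' k aN lN) hN (u' k) (\<lambda>e. t e \<omega>))) \<partial>M)
           \<le> ennreal (exp (\<theta> * (Q * (mean_tau u k a l h n + \<epsilon>))))"
        proof -
          have out: "\<not> (\<bar>x \<bullet> u k - aN k\<bar> \<le> ?R + H \<and> (\<forall>i. i \<noteq> k \<longrightarrow> aN i + 2 \<le> x \<bullet> u' i \<and> x \<bullet> u' i \<le> aN i + lN i - 2))"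
            if "x \<in> ?K" "{x, y} \<in> Ed" "y \<notin> ?K" for x y
          proof -
            have "?R + H + 1 \<le> hN" using hN by simp
            from tau_outside_tiles[OF u' that this] show ?thesis unfolding uk .
          qed
          have "(\<integral>\<^sup>+\<omega>. ennreal (exp (\<theta> * (real (card {aN k}) * maxflow (\<lambda>e. t e \<omega>)
               (bd_above ?K (u' k) (aN k)) (bd_below ?K (u' k) (aN k)) ?K))) \<partial>M)
             \<le> ennreal (exp (\<theta> * (real (card {aN k}) * (Q * (mean_tau u k a l h n + \<epsilon>)))))"
          proof (rule stacked)
            show "c < x \<bullet> u k \<and> \<not> (\<bar>x \<bullet> u k - c\<bar> \<le> ?R + H \<and> (\<forall>i. i \<noteq> k \<longrightarrow> aN i + 2 \<le> x \<bullet> u' i \<and> x \<bullet> u' i \<le> aN i + lN i - 2))"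
              if "x \<in> bd_above ?K (u' k) (aN k)" "c \<in> {aN k}" for x c
              using that out unfolding bd_above_def uk by blast
            show "x \<bullet> u k < c \<and> \<not> (\<bar>x \<bullet> u k - c\<bar> \<le> ?R + H \<and> (\<forall>i. i \<noteq> k \<longrightarrow> aN i + 2 \<le> x \<bullet> u' i \<and> x \<bullet> u' i \<le> aN i + lN i - 2))"
              if "x \<in> bd_below ?K (u' k) (aN k)" "c \<in> {aN k}" for x c
              using that out unfolding bd_below_def uk by blast
          qed auto
          then show ?thesis unfolding tau_rect[where l = lN, OF u' lNp hN0] by simp
        qed
        define J where "J = nat \<lfloor>hN / s\<rfloor>"
        have 2: "(\<integral>\<^sup>+\<omega>. ennreal (exp (\<theta> * (real J * phi (rect u' k aN lN) hN (u' k) (\<lambda>e. t e \<omega>)))) \<partial>M)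
           \<le> ennreal (exp (\<theta> * (real J * (Q * (mean_tau u k a l h n + \<epsilon>)))))"
        proof -
          \<comment> \<open>Levels are stacked upwards from the middle of the cylinder only. The
            lower half separates all of them from the bottom, and the number \<open>J\<close> is
            still of order \<open>hN\<close>.\<close>
          define C where "C = (\<lambda>j::nat. aN k + real j * s) ` {..<J}"
          have cardC: "card C = J" unfolding C_def using s by (subst card_image) (auto simp: inj_on_def)
          have Js: "real j * s + s \<le> hN" if "j < J" for j
          proof -
            have "real (Suc j) \<le> real J" using that by linarith
            also have "real J \<le> hN / s" unfolding J_def using s hN0 by simp
            finally show ?thesis using s by (simp add: field_simps)
          qed
          \<comment> \<open>\<open>stacked\<close> expects its first set above the levels, so top
            and bottom are exchanged relative to \<open>phi\<close>.\<close>
          have "(\<integral>\<^sup>+\<omega>. ennreal (exp (\<theta> * (real (card C) * maxflow (\<lambda>e. t e \<omega>)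
               (top_cyl (rect u' k aN lN) hN (u' k)) (bot_cyl (rect u' k aN lN) hN (u' k)) ?K))) \<partial>M)
             \<le> ennreal (exp (\<theta> * (real (card C) * (Q * (mean_tau u k a l h n + \<epsilon>)))))"
          proof (rule stacked)
            show "finite C" by (simp add: C_def)
            show "2 * (?R + H) < \<bar>c - c'\<bar>" if cc: "c \<in> C" "c' \<in> C" "c \<noteq> c'" for c c'
            proof -
              obtain i j where ij: "c = aN k + real i * s" "c' = aN k + real j * s"
                using cc(1,2) by (auto simp: C_def)
              then have "1 \<le> \<bar>real i - real j\<bar>" using cc(3) by (cases "i = j") (auto simp: abs_if)
              then have "1 * s \<le> \<bar>real i - real j\<bar> * s" using s by (intro mult_right_mono) auto
              also have "\<dots> = \<bar>c - c'\<bar>" using s by (simp add: ij abs_mult flip: left_diff_distrib)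
              finally show ?thesis by (simp add: s_def)
            qed
            show "c < x \<bullet> u k \<and> \<not> (\<bar>x \<bullet> u k - c\<bar> \<le> ?R + H \<and> (\<forall>i. i \<noteq> k \<longrightarrow> aN i + 2 \<le> x \<bullet> u' i \<and> x \<bullet> u' i \<le> aN i + lN i - 2))"
              if xc: "x \<in> top_cyl (rect u' k aN lN) hN (u' k)" "c \<in> C" for x c
            proof -
              obtain j where j: "j < J" "c = aN k + real j * s" using xc(2) by (auto simp: C_def)
              have "aN k + hN - 1 \<le> x \<bullet> u k" using top_bot_level(1)[OF u' xc(1)] by (simp add: uk)
              then have "?R + H < x \<bullet> u k - c" using Js[OF j(1)] j(2) H0 by (simp add: s_def)
              moreover have "0 < ?R + H" using H0 by (simp add: add_nonneg_pos)
              ultimately show ?thesis by linarith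
            qed
            show "x \<bullet> u k < c \<and> \<not> (\<bar>x \<bullet> u k - c\<bar> \<le> ?R + H \<and> (\<forall>i. i \<noteq> k \<longrightarrow> aN i + 2 \<le> x \<bullet> u' i \<and> x \<bullet> u' i \<le> aN i + lN i - 2))"
              if xc: "x \<in> bot_cyl (rect u' k aN lN) hN (u' k)" "c \<in> C" for x c
            proof -
              obtain j where j: "j < J" "c = aN k + real j * s" using xc(2) by (auto simp: C_def)
              have "x \<bullet> u k \<le> aN k - hN + 1" using top_bot_level(2)[OF u' xc(1)] by (simp add: uk)
              moreover have "aN k \<le> c" using s j by simp
              ultimately have "?R + H < c - x \<bullet> u k" using hN by linarith
              moreover have "0 < ?R + H" using H0 by (simp add: add_nonneg_pos)
              ultimately show ?thesis by linarith
            qed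
          qed
          moreover have "phi (rect u' k aN lN) hN (u' k) T = maxflow T
               (top_cyl (rect u' k aN lN) hN (u' k)) (bot_cyl (rect u' k aN lN) hN (u' k)) ?K" for T
            unfolding phi_def cyl_rect[OF u'] by (rule maxflow_commute)
          ultimately show ?thesis unfolding cardC by simp
        qed
        show ?case
          using 1 2 unfolding J_def Q_def aN_def[abs_def] lN_def[abs_def] hN_def by blast
      qed
    qed
    show ?case
      using \<theta>(1) s main by blast
  qed
qed

end

section \<open>Convergence of the rescaled flows and the constant nu\<close>

lemma two_scale_limit_le:
  fixes x y :: "nat \<Rightarrow> real"
  assumes "x \<longlonglongrightarrow> L" "y \<longlonglongrightarrow> L'"
    and xy: "\<And>\<epsilon>. 0 < \<epsilon> \<Longrightarrow> \<forall>\<^sub>F n in sequentially. \<forall>\<^sub>F N in sequentially. y N \<le> x n + \<epsilon>"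
  shows "L' \<le> L"
proof (rule field_le_epsilon)
  fix e :: real assume e: "0 < e"
  have "\<forall>\<^sub>F n in sequentially. L' \<le> x n + e"
    using xy[OF e]
  proof eventually_elim
    case (elim n)
    show ?case by (rule tendsto_upperbound[OF assms(2) elim]) simp
  qed
  moreover have "(\<lambda>n. x n + e) \<longlonglongrightarrow> L + e" using assms(1) by (intro tendsto_intros)
  ultimately show "L' \<le> L + e" by (intro tendsto_lowerbound) auto
qed

text \<open>This takes the place of a subadditive limit theorem. The infimum of the eventual upper
  bounds is the limit superior; each late \<open>x n + \<epsilon>\<close> is such a bound, so
  \<open>x n\<close> cannot stay below it.\<close>

lemma two_scale_convergent:
  fixes x :: "nat \<Rightarrow> real"
  assumes nn: "\<forall>\<^sub>F n in sequentially. 0 \<le> x n"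
    and xx: "\<And>\<epsilon>. 0 < \<epsilon> \<Longrightarrow> \<forall>\<^sub>F n in sequentially. \<forall>\<^sub>F N in sequentially. x N \<le> x n + \<epsilon>"
  obtains L where "x \<longlonglongrightarrow> L"
proof -
  define S where "S = {b. \<forall>\<^sub>F N in sequentially. x N \<le> b}"
  have lb: "0 \<le> b" if "b \<in> S" for b
  proof -
    have "\<forall>\<^sub>F N in sequentially. 0 \<le> b" using that[unfolded S_def mem_Collect_eq] nn by eventually_elim simp
    then show ?thesis by simp
  qed
  have inS: "\<forall>\<^sub>F n in sequentially. x n + \<epsilon> \<in> S" if "0 < \<epsilon>" for \<epsilon>
    using xx[OF that] by eventually_elim (simp add: S_def)
  have "S \<noteq> {}"
  proof
    assume "S = {}"
    then have "\<forall>\<^sub>F n in (sequentially :: nat filter). False" using inS[of 1] by simp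
    then show False by simp
  qed
  have bdd: "bdd_below S" using lb by (intro bdd_belowI[of _ 0])
  have "x \<longlonglongrightarrow> Inf S"
  proof (rule order_tendstoI)
    fix b assume b: "b < Inf S"
    define \<epsilon> where "\<epsilon> = (Inf S - b) / 2"
    have "0 < \<epsilon>" using b by (simp add: \<epsilon>_def)
    from inS[OF this] show "\<forall>\<^sub>F n in sequentially. b < x n"
    proof eventually_elim
      case (elim n)
      then have "Inf S \<le> x n + \<epsilon>" using bdd by (intro cInf_lower)
      then show ?case using b by (simp add: \<epsilon>_def field_simps)
    qed
  next
    fix b assume "Inf S < b"
    then obtain c where c: "c \<in> S" "c < b" using cInf_less_iff[OF \<open>S \<noteq> {}\<close> bdd] by blast
    from c(1)[unfolded S_def mem_Collect_eq] show "\<forall>\<^sub>F n in sequentially. x n < b"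
      by eventually_elim (use c(2) in simp)
  qed
  then show thesis by (rule that)
qed

lemma max_0_le_exp:
  fixes y c :: real
  assumes "0 < c"
  shows "max 0 y \<le> exp (c * y) / c"
proof -
  have "c * y \<le> exp (c * y)" using exp_ge_add_one_self[of "c * y"] by linarith
  then show ?thesis using assms by (auto simp: max_def le_divide_eq mult.commute)
qed

context fpp
begin

text \<open>With P the face volume, the positive part of the excess is at most an exponential with
  rate \<open>\<theta> * P\<close> divided by that rate. The comparison bounds the mean of this
  exponential by 1, so the excess is at most \<open>1 / (\<theta> * P)\<close>, which vanishes as P
  grows.\<close>

lemma tau_excess:
  fixes u :: "'n \<Rightarrow> real^'n" and k :: 'n and a l :: "'n \<Rightarrow> real"
  assumes d: "2 \<le> CARD('n)" and u: "frame u" and l: "\<And>i. 0 < l i"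
    and h: "filterlim h at_top sequentially" and \<epsilon>: "0 < \<epsilon>"
  shows "\<forall>\<^sub>F n in sequentially. \<forall>u' a' l' h'.
     frame u' \<and> u' k = u k \<and> (\<forall>i. 0 < l' i) \<and> filterlim h' at_top sequentially \<longrightarrow>
     (\<forall>\<^sub>F N in sequentially. integrable M (tau_scaled u' k a' l' h' N) \<and>
        expectation (\<lambda>\<omega>. max 0 (tau_scaled u' k a' l' h' N \<omega> / face_vol k (\<lambda>i. real N * l' i)
           - (mean_tau u k a l h n + \<epsilon>))) \<le> \<epsilon>)"
  using flow_comparison[where k = k and a = a and l = l, OF u l h \<epsilon>]
proof (eventually_elim, intro allI impI, elim conjE exE)
  fix n and u' :: "'n \<Rightarrow> real^'n" and h' :: "nat \<Rightarrow> real" and a' l' :: "'n \<Rightarrow> real" and \<theta> s :: real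
  assume \<theta>: "0 < \<theta>" and
    cmp: "\<forall>u' a' l' h'. frame u' \<and> u' k = u k \<and> (\<forall>i. 0 < l' i) \<and> filterlim h' at_top sequentially \<longrightarrow>
     (\<forall>\<^sub>F N in sequentially.
        (\<integral>\<^sup>+\<omega>. ennreal (exp (\<theta> * tau_scaled u' k a' l' h' N \<omega>)) \<partial>M)
          \<le> ennreal (exp (\<theta> * (face_vol k (\<lambda>i. real N * l' i) * (mean_tau u k a l h n + \<epsilon>)))) \<and>
        (\<integral>\<^sup>+\<omega>. ennreal (exp (\<theta> * (real (nat \<lfloor>h' N / s\<rfloor>) * phi_scaled u' k a' l' h' N \<omega>))) \<partial>M)
          \<le> ennreal (exp (\<theta> * (real (nat \<lfloor>h' N / s\<rfloor>) * (face_vol k (\<lambda>i. real N * l' i) * (mean_tau u k a l h n + \<epsilon>))))))"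
    and u': "frame u'" "u' k = u k" and l': "\<forall>i. 0 < l' i" and h': "filterlim h' at_top sequentially"
  have "\<forall>\<^sub>F N in sequentially.
        (\<integral>\<^sup>+\<omega>. ennreal (exp (\<theta> * tau_scaled u' k a' l' h' N \<omega>)) \<partial>M)
          \<le> ennreal (exp (\<theta> * (face_vol k (\<lambda>i. real N * l' i) * (mean_tau u k a l h n + \<epsilon>))))"
    using cmp[rule_format, of u' l' h' a'] u' l' h' by (auto elim: eventually_mono)
  moreover have "\<forall>\<^sub>F N in sequentially. 1 / (\<theta> * \<epsilon>) \<le> face_vol k (\<lambda>i. real N * l' i)"
    using face_vol_at_top[OF d, of l' k] l' unfolding filterlim_at_top by blast
  moreover have "\<forall>\<^sub>F N in sequentially. 1 \<le> h' N" using h' unfolding filterlim_at_top by blast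
  ultimately show "\<forall>\<^sub>F N in sequentially. integrable M (tau_scaled u' k a' l' h' N) \<and>
        expectation (\<lambda>\<omega>. max 0 (tau_scaled u' k a' l' h' N \<omega> / face_vol k (\<lambda>i. real N * l' i)
           - (mean_tau u k a l h n + \<epsilon>))) \<le> \<epsilon>"
    using eventually_gt_at_top[of 0]
  proof eventually_elim
    case (elim N)
    define P where "P = face_vol k (\<lambda>i. real N * l' i)"
    define b where "b = mean_tau u k a l h n + \<epsilon>"
    let ?Y = "tau_scaled u' k a' l' h' N"
    have Nl: "0 < real N * l' i" for i using elim l' by simp
    have P: "0 < P" unfolding P_def using Nl by (intro prod_pos) auto
    have int: "integrable M ?Y"
      using elim by (intro tau_integrable(1) u' Nl) auto
    have meas: "?Y \<in> borel_measurable M" using int by auto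
    have "ennreal (expectation (\<lambda>\<omega>. max 0 (?Y \<omega> / P - b))) = (\<integral>\<^sup>+\<omega>. ennreal (max 0 (?Y \<omega> / P - b)) \<partial>M)"
      using int by (intro nn_integral_eq_integral[symmetric]) auto
    also have "\<dots> \<le> (\<integral>\<^sup>+\<omega>. ennreal (exp (- (\<theta> * P * b)) / (\<theta> * P)) * ennreal (exp (\<theta> * ?Y \<omega>)) \<partial>M)"
    proof (rule nn_integral_mono)
      fix \<omega>
      have "max 0 (?Y \<omega> / P - b) \<le> exp (\<theta> * P * (?Y \<omega> / P - b)) / (\<theta> * P)"
        using \<theta> P by (intro max_0_le_exp) auto
      also have "\<theta> * P * (?Y \<omega> / P - b) = - (\<theta> * P * b) + \<theta> * ?Y \<omega>" using P by (simp add: field_simps)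
      also have "exp (- (\<theta> * P * b) + \<theta> * ?Y \<omega>) / (\<theta> * P) = exp (- (\<theta> * P * b)) / (\<theta> * P) * exp (\<theta> * ?Y \<omega>)"
        unfolding exp_add by simp
      finally show "ennreal (max 0 (?Y \<omega> / P - b)) \<le> ennreal (exp (- (\<theta> * P * b)) / (\<theta> * P)) * ennreal (exp (\<theta> * ?Y \<omega>))"
        using \<theta> P by (subst ennreal_mult[symmetric]) (auto intro: ennreal_leI)
    qed
    also have "\<dots> = ennreal (exp (- (\<theta> * P * b)) / (\<theta> * P)) * (\<integral>\<^sup>+\<omega>. ennreal (exp (\<theta> * ?Y \<omega>)) \<partial>M)"
      using meas by (intro nn_integral_cmult) auto
    also have "\<dots> \<le> ennreal (exp (- (\<theta> * P * b)) / (\<theta> * P)) * ennreal (exp (\<theta> * (P * b)))"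
      using elim unfolding P_def b_def by (intro mult_left_mono) auto
    also have "\<dots> = ennreal (1 / (\<theta> * P))"
      using \<theta> P by (subst ennreal_mult[symmetric]) (auto simp: mult.assoc exp_minus field_simps)
    finally have "expectation (\<lambda>\<omega>. max 0 (?Y \<omega> / P - b)) \<le> 1 / (\<theta> * P)"
      using \<theta> P by (simp add: ennreal_le_iff)
    also have "\<dots> \<le> \<epsilon>"
      using elim(2) \<theta> \<epsilon> P unfolding P_def[symmetric] by (simp add: field_simps)
    finally show ?case using int unfolding P_def b_def by blast
  qed
qed

lemma mean_tau_two_scale:
  fixes u u' :: "'n \<Rightarrow> real^'n" and k :: 'n and a l a' l' :: "'n \<Rightarrow> real"
  assumes d: "2 \<le> CARD('n)" and u: "frame u" and l: "\<And>i. 0 < l i"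
    and h: "filterlim h at_top sequentially"
    and u': "frame u'" "u' k = u k" and l': "\<And>i. 0 < l' i" and h': "filterlim h' at_top sequentially"
    and \<epsilon>: "0 < \<epsilon>"
  shows "\<forall>\<^sub>F n in sequentially. \<forall>\<^sub>F N in sequentially. mean_tau u' k a' l' h' N \<le> mean_tau u k a l h n + \<epsilon>"
proof -
  have e2: "0 < \<epsilon> / 2" using \<epsilon> by simp
  from tau_excess[where k = k and a = a and l = l, OF d u l h e2] show ?thesis
  proof eventually_elim
    case (elim n)
    from elim[rule_format, of u' l' h' a'] u' l' h'
    have "\<forall>\<^sub>F N in sequentially. integrable M (tau_scaled u' k a' l' h' N) \<and>
        expectation (\<lambda>\<omega>. max 0 (tau_scaled u' k a' l' h' N \<omega> / face_vol k (\<lambda>i. real N * l' i)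
           - (mean_tau u k a l h n + \<epsilon> / 2))) \<le> \<epsilon> / 2" by blast
    then show ?case
    proof eventually_elim
      case (elim N)
      let ?Z = "\<lambda>\<omega>. tau_scaled u' k a' l' h' N \<omega> / face_vol k (\<lambda>i. real N * l' i) - (mean_tau u k a l h n + \<epsilon> / 2)"
      have int: "integrable M ?Z" using elim by auto
      have "expectation ?Z \<le> expectation (\<lambda>\<omega>. max 0 (?Z \<omega>))" using int by (intro integral_mono) auto
      moreover have "expectation ?Z = mean_tau u' k a' l' h' N - (mean_tau u k a l h n + \<epsilon> / 2)"
        using elim by (simp add: mean_tau_def prob_space)
      ultimately show ?case using elim by linarith
    qed
  qed
qed

lemma mean_tau_converges:
  fixes u :: "'n \<Rightarrow> real^'n" and k :: 'n and a l :: "'n \<Rightarrow> real"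
  assumes d: "2 \<le> CARD('n)" and u: "frame u" and l: "\<And>i. 0 < l i" and h: "filterlim h at_top sequentially"
  obtains L where "mean_tau u k a l h \<longlonglongrightarrow> L"
proof (rule two_scale_convergent)
  have "\<forall>\<^sub>F n in sequentially. 1 \<le> h n" using h unfolding filterlim_at_top by blast
  then show "\<forall>\<^sub>F n in sequentially. 0 \<le> mean_tau u k a l h n"
    using eventually_gt_at_top[of 0]
  proof eventually_elim
    case (elim n)
    have nl: "0 < real n * l i" for i using elim l by simp
    have "0 \<le> expectation (tau_scaled u k a l h n)"
      using elim by (intro tau_integrable(2) u nl) auto
    moreover have "0 \<le> face_vol k (\<lambda>i. real n * l i)" using nl by (intro prod_nonneg) (auto intro: less_imp_le)
    ultimately show ?case by (simp add: mean_tau_def)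
  qed
  show "\<forall>\<^sub>F n in sequentially. \<forall>\<^sub>F N in sequentially. mean_tau u k a l h N \<le> mean_tau u k a l h n + \<epsilon>"
    if "0 < \<epsilon>" for \<epsilon>
    by (rule mean_tau_two_scale[where l = l and l' = l, OF d u l h u refl l h that])
qed

text \<open>Either rectangle can provide the tiles for the other, since only the normals have to
  agree; this gives both inequalities between the limits.\<close>

lemma mean_tau_limit:
  fixes u u' :: "'n \<Rightarrow> real^'n" and k :: 'n and a l a' l' :: "'n \<Rightarrow> real"
  assumes d: "2 \<le> CARD('n)" and u: "frame u" and l: "\<And>i. 0 < l i"
    and h: "filterlim h at_top sequentially" and L: "mean_tau u k a l h \<longlonglongrightarrow> L"
    and u': "frame u'" "u' k = u k" and l': "\<And>i. 0 < l' i" and h': "filterlim h' at_top sequentially"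
  shows "mean_tau u' k a' l' h' \<longlonglongrightarrow> L"
proof -
  obtain L' where L': "mean_tau u' k a' l' h' \<longlonglongrightarrow> L'"
    using mean_tau_converges[where k = k and a = a' and l = l', OF d u'(1) l' h'] by blast
  have "L' \<le> L"
    by (rule two_scale_limit_le[OF L L']) (rule mean_tau_two_scale[where l = l and l' = l', OF d u l h u' l' h'])
  moreover have "L \<le> L'"
    by (rule two_scale_limit_le[OF L' L])
      (rule mean_tau_two_scale[where l = l' and l' = l, OF d u'(1) l' h' u u'(2)[symmetric] l h])
  ultimately show ?thesis using L' by simp
qed

lemma tau_converges_L1:
  fixes u :: "'n \<Rightarrow> real^'n" and k :: 'n and a l :: "'n \<Rightarrow> real"
  assumes d: "2 \<le> CARD('n)" and u: "frame u" and l: "\<And>i. 0 < l i"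
    and h: "filterlim h at_top sequentially" and L: "mean_tau u k a l h \<longlonglongrightarrow> L"
  shows "\<forall>\<^sub>F n in sequentially. integrable M (tau_scaled u k a l h n)"
    and "(\<lambda>n. expectation (\<lambda>\<omega>. \<bar>tau_scaled u k a l h n \<omega> / face_vol k (\<lambda>i. real n * l i) - L\<bar>)) \<longlonglongrightarrow> 0"
proof -
  let ?Z = "\<lambda>n \<omega>. tau_scaled u k a l h n \<omega> / face_vol k (\<lambda>i. real n * l i)"
  have ev: "\<forall>\<^sub>F N in sequentially. integrable M (tau_scaled u k a l h N) \<and>
     expectation (\<lambda>\<omega>. \<bar>?Z N \<omega> - L\<bar>) \<le> 7 * \<epsilon>" if \<epsilon>: "0 < \<epsilon>" for \<epsilon>
  proof -
    have "\<forall>\<^sub>F n in sequentially. dist (mean_tau u k a l h n) L < \<epsilon>" using L \<epsilon> by (rule tendstoD)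
    then have "\<forall>\<^sub>F n in sequentially. dist (mean_tau u k a l h n) L < \<epsilon> \<and> (\<forall>\<^sub>F N in sequentially. integrable M (tau_scaled u k a l h N) \<and>
        expectation (\<lambda>\<omega>. max 0 (?Z N \<omega> - (mean_tau u k a l h n + \<epsilon>))) \<le> \<epsilon>)"
      using tau_excess[where k = k and a = a and l = l, OF d u l h \<epsilon>]
    proof eventually_elim
      case (elim n)
      then show ?case using u l h by blast
    qed
    then obtain n where n: "dist (mean_tau u k a l h n) L < \<epsilon>"
      and N: "\<forall>\<^sub>F N in sequentially. integrable M (tau_scaled u k a l h N) \<and>
        expectation (\<lambda>\<omega>. max 0 (?Z N \<omega> - (mean_tau u k a l h n + \<epsilon>))) \<le> \<epsilon>"
      using eventually_happens' trivial_limit_sequentially by blast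
    have "\<forall>\<^sub>F N in sequentially. dist (mean_tau u k a l h N) L < \<epsilon>" using L \<epsilon> by (rule tendstoD)
    with N show ?thesis
    proof eventually_elim
      case (elim N)
      let ?b = "mean_tau u k a l h n + \<epsilon>"
      have int: "integrable M (?Z N)" using elim by auto
      \<comment> \<open>The positive part of \<open>Z - L\<close> controls its absolute value, since \<open>\<bar>y\<bar> = 2 max 0 y - y\<close>.\<close>
      have "expectation (\<lambda>\<omega>. \<bar>?Z N \<omega> - L\<bar>) \<le> expectation (\<lambda>\<omega>. 2 * max 0 (?Z N \<omega> - ?b) + 4 * \<epsilon> - (?Z N \<omega> - L))"
      proof (rule integral_mono)
        fix \<omega>
        have "?b \<le> L + 2 * \<epsilon>" using n by (simp add: dist_real_def abs_less_iff)
        then show "\<bar>?Z N \<omega> - L\<bar> \<le> 2 * max 0 (?Z N \<omega> - ?b) + 4 * \<epsilon> - (?Z N \<omega> - L)"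
          using \<epsilon> by (auto simp: abs_if max_def)
      qed (use int in auto)
      also have "\<dots> = 2 * expectation (\<lambda>\<omega>. max 0 (?Z N \<omega> - ?b)) + 4 * \<epsilon> - (mean_tau u k a l h N - L)"
        using int elim by (simp add: mean_tau_def prob_space)
      also have "\<dots> \<le> 7 * \<epsilon>" using elim by (simp add: dist_real_def abs_less_iff)
      finally show ?case using elim by blast
    qed
  qed
  show "\<forall>\<^sub>F n in sequentially. integrable M (tau_scaled u k a l h n)"
    using ev[of 1] by (auto elim: eventually_mono)
  show "(\<lambda>n. expectation (\<lambda>\<omega>. \<bar>?Z n \<omega> - L\<bar>)) \<longlonglongrightarrow> 0"
  proof (rule tendstoI)
    fix e :: real assume e: "0 < e"
    then have "0 < e / 8" by simp
    from ev[OF this] show "\<forall>\<^sub>F n in sequentially. dist (expectation (\<lambda>\<omega>. \<bar>?Z n \<omega> - L\<bar>)) 0 < e"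
    proof eventually_elim
      case (elim n)
      have "0 \<le> expectation (\<lambda>\<omega>. \<bar>?Z n \<omega> - L\<bar>)" by simp
      then show ?case using elim e by (simp add: dist_real_def)
    qed
  qed
qed

text \<open>The definite description needs existence for all rectangles and heights, which
  \<open>mean_tau_limit\<close> and \<open>tau_converges_L1\<close> supply, and uniqueness, for
  which one rectangle suffices.\<close>

lemma nu_eq:
  fixes u :: "'n \<Rightarrow> real^'n" and k :: 'n and a l :: "'n \<Rightarrow> real"
  assumes d: "2 \<le> CARD('n)" and u: "frame u" and l: "\<And>i. 0 < l i"
    and A: "nd_hyperrect (rect u k a l)" "unit_normal (rect u k a l) (u k)"
    and h: "filterlim h at_top sequentially" "\<And>n. 0 < h n" and L: "mean_tau u k a l h \<longlonglongrightarrow> L"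
  shows "nu M t (u k) = L / hausdorff_ratio k"
proof -
  let ?\<kappa> = "hausdorff_ratio k"
  have \<kappa>: "0 < ?\<kappa>" using d by (rule hausdorff_ratio_pos)
  define Z where "Z A h n \<omega> = tau ((\<lambda>x. real n *\<^sub>R x) ` A) (h n) (u k) (\<lambda>e. t e \<omega>) / area A n" for A h n \<omega>
  define good where "good c A h \<longleftrightarrow> (\<forall>\<^sub>F n in sequentially. integrable M (Z A h n)) \<and>
      (\<lambda>n. expectation (\<lambda>\<omega>. \<bar>Z A h n \<omega> - c\<bar>)) \<longlonglongrightarrow> 0" for c A h
  have nu_def': "nu M t (u k) = (THE c. \<forall>A h. nd_hyperrect A \<and> unit_normal A (u k) \<and> (\<forall>n. h n > 0) \<and>
      filterlim h at_top sequentially \<longrightarrow> good c A h)"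
    unfolding nu_def good_def Z_def ..
  have all: "good (L / ?\<kappa>) A h'"
    if A': "nd_hyperrect A" "unit_normal A (u k)" and h': "filterlim h' at_top sequentially" for A h'
  proof -
    obtain u' a' l' where u': "frame u'" "u' k = u k" "\<And>i. 0 < l' i" "A = rect u' k a' l'"
      using nd_hyperrect_rect[OF A', of k] by metis
    have L': "mean_tau u' k a' l' h' \<longlonglongrightarrow> L"
      by (rule mean_tau_limit[where l = l and l' = l', OF d u l h(1) L u'(1,2,3) h'])
    note conv = tau_converges_L1[where l = l', OF d u'(1,3) h' L']
    have Z_eq: "Z A h' n \<omega> = tau_scaled u' k a' l' h' n \<omega> / face_vol k (\<lambda>i. real n * l' i) / ?\<kappa>" if "0 < n" for n \<omega>
      using that by (simp add: Z_def u'(2)[symmetric] u'(4) rect_scaleR area_rect[where l = l', OF u'(1) d u'(3)] mult.commute)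
    have "\<forall>\<^sub>F n in sequentially. integrable M (Z A h' n)"
      using conv(1) eventually_gt_at_top[of 0]
    proof eventually_elim
      case (elim n)
      have "Z A h' n = (\<lambda>\<omega>. tau_scaled u' k a' l' h' n \<omega> / face_vol k (\<lambda>i. real n * l' i) / ?\<kappa>)"
        using Z_eq elim by (intro ext) simp
      then show ?case using elim by simp
    qed
    moreover have "(\<lambda>n. expectation (\<lambda>\<omega>. \<bar>Z A h' n \<omega> - L / ?\<kappa>\<bar>)) \<longlonglongrightarrow> 0"
    proof (rule Lim_transform_eventually)
      show "(\<lambda>n. expectation (\<lambda>\<omega>. \<bar>tau_scaled u' k a' l' h' n \<omega> / face_vol k (\<lambda>i. real n * l' i) - L\<bar>) / ?\<kappa>) \<longlonglongrightarrow> 0"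
        using tendsto_divide[OF conv(2) tendsto_const, of ?\<kappa>] \<kappa> by simp
      show "\<forall>\<^sub>F n in sequentially. expectation (\<lambda>\<omega>. \<bar>tau_scaled u' k a' l' h' n \<omega> / face_vol k (\<lambda>i. real n * l' i) - L\<bar>) / ?\<kappa>
          = expectation (\<lambda>\<omega>. \<bar>Z A h' n \<omega> - L / ?\<kappa>\<bar>)"
        using eventually_gt_at_top[of 0]
      proof eventually_elim
        case (elim n)
        have "\<bar>Z A h' n \<omega> - L / ?\<kappa>\<bar> = \<bar>tau_scaled u' k a' l' h' n \<omega> / face_vol k (\<lambda>i. real n * l' i) - L\<bar> / ?\<kappa>" for \<omega>
        proof -
          have "\<bar>x / ?\<kappa> - L / ?\<kappa>\<bar> = \<bar>x - L\<bar> / ?\<kappa>" for x using \<kappa> by (simp flip: diff_divide_distrib)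
          then show ?thesis unfolding Z_eq[OF elim] .
        qed
        then show ?case by simp
      qed
    qed
    ultimately show ?thesis by (simp add: good_def)
  qed
  show ?thesis
    unfolding nu_def'
  proof (rule the_equality)
    show "\<forall>A h. nd_hyperrect A \<and> unit_normal A (u k) \<and> (\<forall>n. h n > 0) \<and> filterlim h at_top sequentially \<longrightarrow> good (L / ?\<kappa>) A h"
      using all by blast
    fix c assume "\<forall>A h. nd_hyperrect A \<and> unit_normal A (u k) \<and> (\<forall>n. h n > 0) \<and> filterlim h at_top sequentially \<longrightarrow> good c A h"
    then have c: "good c (rect u k a l) h" using A h by blast
    have c': "good (L / ?\<kappa>) (rect u k a l) h" using all A h by blast
    let ?Z = "Z (rect u k a l) h"
    \<comment> \<open>Two L1 limits of the same sequence are constants whose difference is at most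
      the sum of the two vanishing distances.\<close>
    have "(\<lambda>n. expectation (\<lambda>\<omega>. \<bar>?Z n \<omega> - c\<bar>) + expectation (\<lambda>\<omega>. \<bar>?Z n \<omega> - L / ?\<kappa>\<bar>)) \<longlonglongrightarrow> 0 + 0"
      using c c' unfolding good_def by (intro tendsto_add) auto
    moreover have "\<forall>\<^sub>F n in sequentially. \<bar>c - L / ?\<kappa>\<bar> \<le> expectation (\<lambda>\<omega>. \<bar>?Z n \<omega> - c\<bar>) + expectation (\<lambda>\<omega>. \<bar>?Z n \<omega> - L / ?\<kappa>\<bar>)"
      using c[unfolded good_def, THEN conjunct1]
    proof eventually_elim
      case (elim n)
      have "expectation (\<lambda>\<omega>. \<bar>c - L / ?\<kappa>\<bar>) \<le> expectation (\<lambda>\<omega>. \<bar>?Z n \<omega> - c\<bar> + \<bar>?Z n \<omega> - L / ?\<kappa>\<bar>)"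
        using elim by (intro integral_mono) auto
      then show ?case using elim by (simp add: prob_space)
    qed
    ultimately have "\<bar>c - L / ?\<kappa>\<bar> \<le> 0 + 0" by (intro tendsto_lowerbound) auto
    then show "c = L / ?\<kappa>" by simp
  qed
qed

section \<open>Upper tail of phi\<close>

text \<open>For \<open>h > 1\<close> the vertices at the top lie strictly above those at the bottom,
  so a cut exists and the flow is a finite minimum of sums.\<close>

lemma phi_measurable:
  fixes u :: "'n \<Rightarrow> real^'n"
  assumes u: "frame u" and h: "1 < h"
  shows "(\<lambda>\<omega>. phi (rect u k a l) h (u k) (\<lambda>e. t e \<omega>)) \<in> borel_measurable M"
proof -
  let ?K = "rect_cyl u k a l h"
  have K: "closed ?K" "convex ?K" "bounded ?K"
    unfolding rect_cyl_frame_box by (rule closed_frame_box convex_frame_box bounded_frame_box[OF u])+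
  have "bot_cyl (rect u k a l) h (u k) \<inter> top_cyl (rect u k a l) h (u k) = {}"
    using top_bot_level[OF u] h by fastforce
  then show ?thesis
    unfolding phi_def cyl_rect[OF u] using edges_in_subset_Ed[of ?K] t_meas
    by (intro maxflow_measurable finite_edges_in K) auto
qed

text \<open>Chernoff's bound for J times phi: the event forces this product above J times
  \<open>b\<close> times the face, while its moment belongs to a smaller slope. The gap is
  multiplied by J, which is proportional to the height.\<close>

lemma phi_upper_tail:
  fixes u :: "'n \<Rightarrow> real^'n" and k :: 'n and a l :: "'n \<Rightarrow> real"
  assumes d: "2 \<le> CARD('n)" and u: "frame u" and l: "\<And>i. 0 < l i"
    and h: "filterlim h at_top sequentially" and L: "mean_tau u k a l h \<longlonglongrightarrow> L" and b: "L < b"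
  obtains c where "0 < c" "\<forall>\<^sub>F n in sequentially.
     prob {\<omega> \<in> space M. b * face_vol k (\<lambda>i. real n * l i) \<le> phi_scaled u k a l h n \<omega>}
       \<le> exp (- (c * (face_vol k (\<lambda>i. real n * l i) * h n)))"
proof -
  \<comment> \<open>One quarter is lost to the distance of the mean from \<open>L\<close>, one to
    the comparison, and \<open>2 * \<epsilon>\<close> remains as the gap.\<close>
  define \<epsilon> where "\<epsilon> = (b - L) / 4"
  have \<epsilon>: "0 < \<epsilon>" using b by (simp add: \<epsilon>_def)
  have "\<forall>\<^sub>F n in sequentially. dist (mean_tau u k a l h n) L < \<epsilon>" using L \<epsilon> by (rule tendstoD)
  then have "\<forall>\<^sub>F n in sequentially. \<exists>\<theta>>0. \<exists>s>0. (\<forall>\<^sub>F N in sequentially.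
        (\<integral>\<^sup>+\<omega>. ennreal (exp (\<theta> * (real (nat \<lfloor>h N / s\<rfloor>) * phi_scaled u k a l h N \<omega>))) \<partial>M)
          \<le> ennreal (exp (\<theta> * (real (nat \<lfloor>h N / s\<rfloor>) * (face_vol k (\<lambda>i. real N * l i) * (b - 2 * \<epsilon>))))))"
    using flow_comparison[where k = k and a = a and l = l, OF u l h \<epsilon>]
  proof eventually_elim
    case (elim n)
    then obtain \<theta> s where \<theta>: "0 < \<theta>" and s: "0 < s" and ev: "\<forall>\<^sub>F N in sequentially.
        (\<integral>\<^sup>+\<omega>. ennreal (exp (\<theta> * tau_scaled u k a l h N \<omega>)) \<partial>M)
          \<le> ennreal (exp (\<theta> * (face_vol k (\<lambda>i. real N * l i) * (mean_tau u k a l h n + \<epsilon>)))) \<and>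
        (\<integral>\<^sup>+\<omega>. ennreal (exp (\<theta> * (real (nat \<lfloor>h N / s\<rfloor>) * phi_scaled u k a l h N \<omega>))) \<partial>M)
          \<le> ennreal (exp (\<theta> * (real (nat \<lfloor>h N / s\<rfloor>) * (face_vol k (\<lambda>i. real N * l i) * (mean_tau u k a l h n + \<epsilon>)))))"
      using u l h by blast
    from ev have "\<forall>\<^sub>F N in sequentially.
        (\<integral>\<^sup>+\<omega>. ennreal (exp (\<theta> * (real (nat \<lfloor>h N / s\<rfloor>) * phi_scaled u k a l h N \<omega>))) \<partial>M)
          \<le> ennreal (exp (\<theta> * (real (nat \<lfloor>h N / s\<rfloor>) * (face_vol k (\<lambda>i. real N * l i) * (b - 2 * \<epsilon>)))))"
    proof eventually_elim
      case (elim N)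
      have P: "0 \<le> face_vol k (\<lambda>i. real N * l i)" by (intro prod_nonneg mult_nonneg_nonneg less_imp_le[OF l]) simp
      have "mean_tau u k a l h n + \<epsilon> \<le> b - 2 * \<epsilon>"
      proof -
        have "4 * \<epsilon> = b - L" by (simp add: \<epsilon>_def)
        then show ?thesis
          using \<open>dist (mean_tau u k a l h n) L < \<epsilon>\<close> unfolding dist_real_def by linarith
      qed
      then have "exp (\<theta> * (real (nat \<lfloor>h N / s\<rfloor>) * (face_vol k (\<lambda>i. real N * l i) * (mean_tau u k a l h n + \<epsilon>))))
        \<le> exp (\<theta> * (real (nat \<lfloor>h N / s\<rfloor>) * (face_vol k (\<lambda>i. real N * l i) * (b - 2 * \<epsilon>))))"
        unfolding exp_le_cancel_iff using \<theta> P by (intro mult_left_mono) auto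
      then show ?case using elim by (meson ennreal_leI order_trans)
    qed
    then show ?case using \<theta> s by blast
  qed
  then obtain \<theta> s where \<theta>: "0 < \<theta>" and s: "0 < s" and mgf: "\<forall>\<^sub>F N in sequentially.
        (\<integral>\<^sup>+\<omega>. ennreal (exp (\<theta> * (real (nat \<lfloor>h N / s\<rfloor>) * phi_scaled u k a l h N \<omega>))) \<partial>M)
          \<le> ennreal (exp (\<theta> * (real (nat \<lfloor>h N / s\<rfloor>) * (face_vol k (\<lambda>i. real N * l i) * (b - 2 * \<epsilon>)))))"
    using eventually_happens' trivial_limit_sequentially by blast
  have hs: "\<forall>\<^sub>F N in sequentially. max s 2 \<le> h N" using h unfolding filterlim_at_top by blast
  show thesis
  proof (rule that)
    show "0 < \<theta> * \<epsilon> / s" using \<theta> \<epsilon> s by simp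
    show "\<forall>\<^sub>F N in sequentially.
     prob {\<omega> \<in> space M. b * face_vol k (\<lambda>i. real N * l i) \<le> phi_scaled u k a l h N \<omega>}
       \<le> exp (- (\<theta> * \<epsilon> / s * (face_vol k (\<lambda>i. real N * l i) * h N)))"
      using mgf hs eventually_gt_at_top[of 0]
    proof eventually_elim
      case (elim N)
      define P where "P = face_vol k (\<lambda>i. real N * l i)"
      define J where "J = real (nat \<lfloor>h N / s\<rfloor>)"
      let ?Y = "phi_scaled u k a l h N"
      have P: "0 < P" unfolding P_def using l elim by (intro prod_pos) auto
      \<comment> \<open>A number that is at least 1 is at most twice its floor. This turns the gap
        \<open>2 * \<epsilon>\<close> into the rate
        \<open>\<theta> * \<epsilon> / s\<close>.\<close>
      have J: "h N / (2 * s) \<le> J" "0 \<le> J"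
      proof -
        have 1: "1 \<le> h N / s" using elim s by (simp add: le_divide_eq)
        then have fl: "1 \<le> \<lfloor>h N / s\<rfloor>" by simp
        then have "J = real_of_int \<lfloor>h N / s\<rfloor>" by (simp add: J_def)
        then have "h N / s - 1 < J" "1 \<le> J" using fl by linarith+
        then show "h N / (2 * s) \<le> J" using 1 by (simp add: field_simps)
      qed (simp add: J_def)
      have meas: "?Y \<in> borel_measurable M" using elim by (intro phi_measurable u) auto
      let ?S = "{\<omega> \<in> space M. b * P \<le> ?Y \<omega>}"
      have S: "?S \<in> sets M" using meas by measurable
      define c where "c = exp (- (\<theta> * (J * (P * b))))"
      have "ennreal (prob ?S) = (\<integral>\<^sup>+\<omega>. indicator ?S \<omega> \<partial>M)" using S by (simp add: emeasure_eq_measure)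
      also have "\<dots> \<le> (\<integral>\<^sup>+\<omega>. ennreal c * ennreal (exp (\<theta> * (J * ?Y \<omega>))) \<partial>M)"
      proof (rule nn_integral_mono)
        fix \<omega>
        show "indicator ?S \<omega> \<le> ennreal c * ennreal (exp (\<theta> * (J * ?Y \<omega>)))"
        proof (cases "\<omega> \<in> ?S")
          case True
          then have "\<theta> * (J * (P * b)) \<le> \<theta> * (J * ?Y \<omega>)" using \<theta> J(2) by (intro mult_left_mono) (auto simp: mult.commute)
          then have "1 \<le> c * exp (\<theta> * (J * ?Y \<omega>))" by (simp add: c_def flip: exp_add)
          then show ?thesis using True by (simp add: c_def flip: ennreal_mult ennreal_1 del: ennreal_1)
        qed simp
      qed
      also have "\<dots> = ennreal c * (\<integral>\<^sup>+\<omega>. ennreal (exp (\<theta> * (J * ?Y \<omega>))) \<partial>M)"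
        using meas by (intro nn_integral_cmult) auto
      also have "\<dots> \<le> ennreal c * ennreal (exp (\<theta> * (J * (P * (b - 2 * \<epsilon>)))))"
        using elim(1) unfolding J_def P_def by (intro mult_left_mono) auto
      also have "\<dots> = ennreal (exp (- (2 * \<theta> * \<epsilon> * P * J)))"
        by (simp add: c_def algebra_simps flip: ennreal_mult exp_add)
      finally have "prob ?S \<le> exp (- (2 * \<theta> * \<epsilon> * P * J))" by (simp add: ennreal_le_iff)
      also have "\<dots> \<le> exp (- (\<theta> * \<epsilon> / s * (P * h N)))"
      proof -
        have "2 * \<theta> * \<epsilon> * P * (h N / (2 * s)) \<le> 2 * \<theta> * \<epsilon> * P * J" using J(1) \<theta> \<epsilon> P by (intro mult_left_mono) auto
        then show ?thesis using s by (simp add: field_simps)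
      qed
      finally show ?case unfolding P_def .
    qed
  qed
qed

end

text \<open>Includes \<open>p = 0\<close>, where the negated logarithm is infinite.\<close>

lemma neg_elog_ge:
  assumes "0 \<le> p" "p \<le> exp (- x)"
  shows "ereal x \<le> - elog p"
proof (cases "p = 0")
  case False
  then have "ln p \<le> - x" using assms by (metis exp_gt_zero less_eq_real_def ln_exp ln_le_cancel_iff)
  then show ?thesis using False by (simp add: elog_def)
qed (simp add: elog_def)

theorem theorem4:
  fixes M :: "'w measure" and t :: "(real^'n) set \<Rightarrow> 'w \<Rightarrow> real"
    and F :: "real measure" and \<gamma> :: real
    and A :: "(real^'n) set" and v :: "real^'n" and h :: "nat \<Rightarrow> real" and lam :: real
  assumes "prob_space M"
    and "CARD('n) \<ge> 2"
    and "prob_space.indep_vars M (\<lambda>_. borel) t Ed"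
    and "\<forall>e\<in>Ed. distr M borel (t e) = F"
    and "AE x in F. 0 \<le> x"
    and "\<gamma> > 0" and "integrable F (\<lambda>x. exp (\<gamma> * x))"
    and "nd_hyperrect A" and "unit_normal A v"
    and "\<forall>n. h n > 0" and "filterlim h at_top sequentially"
    and "lam > nu M t v"
  shows "liminf (\<lambda>n. - elog (measure M {\<omega> \<in> space M.
             phi ((\<lambda>x. real n *\<^sub>R x) ` A) (h n) v (\<lambda>e. t e \<omega>) \<ge> lam * area A n})
           / ereal (area A n * h n)) > 0"
proof -
  interpret prob_space M by fact
  interpret fpp M t F \<gamma> using assms by unfold_locales auto
  note d = assms(2)
  \<comment> \<open>An arbitrary index, to carry the normal direction in all frames.\<close>
  obtain k :: 'n where True by blast
  obtain u a l where u: "frame u" "u k = v" and l: "\<And>i. 0 < l i" and A: "A = rect u k a l"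
    using nd_hyperrect_rect[OF assms(8,9), of k] by metis
  let ?\<kappa> = "hausdorff_ratio k"
  have \<kappa>: "0 < ?\<kappa>" using d by (rule hausdorff_ratio_pos)
  obtain L where L: "mean_tau u k a l h \<longlonglongrightarrow> L"
    using mean_tau_converges[where l = l, OF d u(1) l assms(11)] by blast
  have "nu M t v = L / ?\<kappa>"
    using nu_eq[where l = l, OF d u(1) l _ _ assms(11) _ L] assms(8,9,10) unfolding A u(2) by blast
  \<comment> \<open>The area is \<open>?\<kappa>\<close> times the face volume, so
    \<open>lam\<close> per unit of area means \<open>lam * ?\<kappa>\<close> per unit of face
    volume; \<open>?\<kappa>\<close> also divides the rate \<open>c\<close> below.\<close>
  then have "L < lam * ?\<kappa>" using assms(12) \<kappa> by (simp add: divide_less_eq)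
  from phi_upper_tail[where l = l, OF d u(1) l assms(11) L this]
  obtain c where c: "0 < c" and tail: "\<forall>\<^sub>F n in sequentially.
     prob {\<omega> \<in> space M. lam * ?\<kappa> * face_vol k (\<lambda>i. real n * l i) \<le> phi_scaled u k a l h n \<omega>}
       \<le> exp (- (c * (face_vol k (\<lambda>i. real n * l i) * h n)))" by blast
  have "0 < ereal (c / ?\<kappa>)" using c \<kappa> by simp
  also have "ereal (c / ?\<kappa>) \<le> liminf (\<lambda>n. - elog (measure M {\<omega> \<in> space M.
             phi ((\<lambda>x. real n *\<^sub>R x) ` A) (h n) v (\<lambda>e. t e \<omega>) \<ge> lam * area A n})
           / ereal (area A n * h n))"
  proof (rule Liminf_bounded)
    show "\<forall>\<^sub>F n in sequentially. ereal (c / ?\<kappa>) \<le> - elog (measure M {\<omega> \<in> space M.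
             phi ((\<lambda>x. real n *\<^sub>R x) ` A) (h n) v (\<lambda>e. t e \<omega>) \<ge> lam * area A n})
           / ereal (area A n * h n)"
      using tail eventually_gt_at_top[of 0]
    proof eventually_elim
      case (elim n)
      define P where "P = face_vol k (\<lambda>i. real n * l i)"
      have P: "0 < P" unfolding P_def using l elim by (intro prod_pos) auto
      have area: "area A n = ?\<kappa> * P"
        using area_rect[where l = l, OF u(1) d l elim(2)] unfolding A P_def .
      let ?p = "measure M {\<omega> \<in> space M. phi ((\<lambda>x. real n *\<^sub>R x) ` A) (h n) v (\<lambda>e. t e \<omega>) \<ge> lam * area A n}"
      have "?p \<le> exp (- (c * (P * h n)))"
        unfolding area using elim by (simp add: A rect_scaleR P_def u(2) mult.assoc)
      then have "ereal (c * (P * h n)) \<le> - elog ?p" by (intro neg_elog_ge) auto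
      moreover have pos: "0 < area A n * h n" using P \<kappa> assms(10) by (simp add: area)
      ultimately have "ereal (c * (P * h n)) / ereal (area A n * h n) \<le> - elog ?p / ereal (area A n * h n)"
        by (intro ereal_divide_right_mono) auto
      moreover have "ereal (c * (P * h n)) / ereal (area A n * h n) = ereal (c * (P * h n) / (area A n * h n))"
        using pos by (simp only: ereal_divide less_imp_neq[symmetric] if_False)
      moreover have "c * (P * h n) / (area A n * h n) = c / ?\<kappa>"
        using P \<kappa> assms(10)[rule_format, of n] by (simp add: area field_simps)
      ultimately show ?case by (simp only:)
    qed
  qed
  finally show ?thesis .
qed

end
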